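(* Let $d\ge 1$ be an integer and $H=-\Delta+|x|^2$ on $\mathbb{R}^d$. For $1\le p,q\le\infty$ and $\beta>0$, set $$\sigma_\beta := \frac{d}{2\beta}\left|\frac1p-\frac1q\right|.$$ (1) If $p,q\in(1,\infty)$, or $(p,q)=(1,\infty)$, or $p=1$ and $q\in[2,\infty)$, or $p\in(1,\infty)$ and $q=1$, then there exists a constant $C>0$ (independent of $t$ and $f$) such that for all $f\in L^p(\mathbb{R}^d)$ $$\|e^{-tH^\beta}f\|_{L^q}\le \begin{cases} C e^{-td^\beta}\|f\|_{L^p} & \text{if } t\ge 1,\\ C t^{-\sigma_\beta}\|f\|_{L^p} & \text{if } 0<t\le 1.\end{cases}$$ (2) If $0<\beta\le 1$, then for every $p,q\in[1,\infty]$ there exists a constant $C>0$ (independent of $t$ and $f$) such that for all $f\in L^p(\mathbb{R}^d)$ one has $\|e^{-tH^\beta}f\|_{L^q}\le C e^{-td^\beta}\|f\|_{L^p}$ for $t\ge 1$ and $\|e^{-tH^\beta}f\|_{L^q}\le C t^{-\sigma_\beta}\|f\|_{L^p}$ for $0<t\le 1$.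
   Context: Functions are complex-valued. For $k\in\mathbb{N}=\{0,1,2,\dots\}$ and $s\in\mathbb{R}$ let $h_k(s)=(\sqrt{\pi}\,2^k k!)^{-1/2}(-1)^k e^{s^2/2}\frac{d^k}{ds^k}e^{-s^2}$, and for $\alpha\in\mathbb{N}^d$ let $\Phi_\alpha(x)=\prod_{j=1}^d h_{\alpha_j}(x_j)$ be the normalized Hermite functions. They form an orthonormal basis of $L^2(\mathbb{R}^d)$ and $H\Phi_\alpha=(2|\alpha|+d)\Phi_\alpha$, where $|\alpha|=\alpha_1+\dots+\alpha_d$. Put $P_kf=\sum_{|\alpha|=k}\langle f,\Phi_\alpha\rangle\Phi_\alpha$, so that $H=\sum_{k\ge0}(2k+d)P_k$ and $H^\beta=\sum_{k\ge0}(2k+d)^\beta P_k$. The fractional heat semigroup is $$e^{-tH^\beta}f=\sum_{k=0}^\infty e^{-t(2k+d)^\beta}P_kf,\qquad t>0.$$ For $f\in L^p(\mathbb{R}^d)$ (more generally for tempered distributions $f$) the same formula is used, with $\langle f,\Phi_\alpha\rangle$ the extension of the $L^2$ inner product to the pairing between tempered distributions and Schwartz functions. *)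

theory Defs
  imports "HOL-Probability.Essential_Supremum"
begin

definition hermite_fun :: "nat \<Rightarrow> real \<Rightarrow> real" where
  "hermite_fun k s = (sqrt pi * 2 ^ k * fact k) powr (- 1 / 2) * (- 1) ^ k * exp (s\<^sup>2 / 2)
     * (deriv ^^ k) (\<lambda>u. exp (- u\<^sup>2)) s"

definition hermite_Phi :: "('n::finite \<Rightarrow> nat) \<Rightarrow> real ^ 'n \<Rightarrow> real" where
  "hermite_Phi \<alpha> x = (\<Prod>j\<in>UNIV. hermite_fun (\<alpha> j) (x $ j))"

(* No complex conjugate is needed since Phi is real-valued.  By Hoelder's inequality
   the integrand is absolutely integrable for every f in an L^p space, 1 <= p <= infinity. *)
definition hermite_coeff :: "(real ^ 'n::finite \<Rightarrow> complex) \<Rightarrow> ('n \<Rightarrow> nat) \<Rightarrow> complex" where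
  "hermite_coeff f \<alpha> = (LINT x|lebesgue. f x * complex_of_real (hermite_Phi \<alpha> x))"

lemma finite_multi_index: "finite {\<alpha> :: 'n::finite \<Rightarrow> nat. (\<Sum>j\<in>UNIV. \<alpha> j) = k}"
proof (rule finite_subset)
  show "{\<alpha> :: 'n \<Rightarrow> nat. (\<Sum>j\<in>UNIV. \<alpha> j) = k} \<subseteq> PiE UNIV (\<lambda>_. {..k})"
    by (auto simp: PiE_def intro: member_le_sum)
  show "finite (PiE (UNIV :: 'n set) (\<lambda>_. {..k}))"
    by (rule finite_PiE) auto
qed

definition hermite_proj :: "nat \<Rightarrow> (real ^ 'n::finite \<Rightarrow> complex) \<Rightarrow> real ^ 'n \<Rightarrow> complex" where
  "hermite_proj k f x =
     (\<Sum>\<alpha> | (\<Sum>j\<in>UNIV. \<alpha> j) = k. hermite_coeff f \<alpha> * complex_of_real (hermite_Phi \<alpha> x))"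

(* e^{-tH^beta} f for H = -Laplacian + |x|^2, through its Hermite expansion.  The series is
   summed pointwise.  For f in L^p and t, beta > 0 this loses nothing: P_k f grows at most
   polynomially in k, uniformly in x, so the series converges absolutely and uniformly on R^d,
   and its sum represents the limit in the sense of tempered distributions (and, for f in L^2,
   the L^2 limit). *)
definition frac_heat :: "real \<Rightarrow> real \<Rightarrow> (real ^ 'n::finite \<Rightarrow> complex) \<Rightarrow> real ^ 'n \<Rightarrow> complex" where
  "frac_heat \<beta> t f x =
     (\<Sum>k. complex_of_real (exp (- t * (2 * real k + real CARD('n)) powr \<beta>)) * hermite_proj k f x)"

(* L^p(R^d), 1 <= p <= infinity, at the level of functions rather than classes modulo
   a.e. equality. *)
definition Lp_space :: "ennreal \<Rightarrow> (real ^ 'n::finite \<Rightarrow> complex) set" where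
  "Lp_space p = {f \<in> borel_measurable lebesgue.
     if p = \<infinity> then esssup lebesgue (\<lambda>x. ennreal (cmod (f x))) < \<infinity>
     else integrable lebesgue (\<lambda>x. cmod (f x) powr enn2real p)}"

(* Meaningful only on Lp_space p. *)
definition Lp_norm :: "ennreal \<Rightarrow> (real ^ 'n::finite \<Rightarrow> complex) \<Rightarrow> real" where
  "Lp_norm p f =
     (if p = \<infinity> then enn2real (esssup lebesgue (\<lambda>x. ennreal (cmod (f x))))
      else (LINT x|lebesgue. cmod (f x) powr enn2real p) powr (1 / enn2real p))"

(* In ennreal, 1 / infinity = 0. *)
definition heat_exponent :: "nat \<Rightarrow> real \<Rightarrow> ennreal \<Rightarrow> ennreal \<Rightarrow> real" where
  "heat_exponent d \<beta> p q = real d / (2 * \<beta>) * \<bar>enn2real (1 / p) - enn2real (1 / q)\<bar>"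

end

theory Submission
  imports Defs "HOL-Complex_Analysis.Complex_Analysis" "HOL-Probability.Probability" "HOL-Real_Asymp.Real_Asymp"
begin

text \<open>
  The operator $e^{-tH^\beta}$ has the integral kernel
  $K_t(x,y) = \sum_k e^{-t(2k+d)^\beta} P_k(x,y)$, where $P_k(x,y)$, here \<open>hermite_kernel\<close>, is the
  kernel of the projection $P_k$. Everything follows from size estimates of $K_t$ that are fed into one
  statement about integral operators.

  \<^bold>\<open>From kernel bounds to Lebesgue space bounds.\<close> If all row and column integrals of a nonnegative
  kernel are at most $A$, and its supremum and its total mass are at most $B$, then the operator maps
  $L^p$ to $L^q$ with norm at most $A^{1-\delta} B^\delta$, where $\delta = |1/p - 1/q|$
  (\<open>Lp_kernel_bound\<close>). The corner cases are Schur's test ($\delta = 0$), $L^1 \to L^\infty$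
  (supremum) and $L^\infty \to L^1$ (total mass); the power mean inequality gives the others directly.
  For $t \le 1$ the kernel satisfies this with $A$ constant and $B$ a multiple of $t^{-d/(2\beta)}$,
  which yields exactly the factor $t^{-\sigma_\beta}$.

  \<^bold>\<open>Small times.\<close> For complex $z$ with positive real part, $e^{-zH}$ has an explicit kernel, by Mehler's
  formula in the variable $r = e^{-2z}$ (\<open>hermite_mehler_sums\<close>). If $|\mathrm{Im}\, z| \le \kappa\, \mathrm{Re}\, z$,
  then $r$ lies in a Stolz angle at $1$, the modulus of the Mehler kernel is a Gaussian, and its row
  integrals stay bounded while its supremum and its total mass are of order $(1-|r|)^{-d/2}$
  (\<open>stolz_point.prod_bounds\<close>). So it is enough to write the symbol $e^{-l^\beta}$ as a superposition
  of exponentials $e^{-zl}$ with $z$ in a sector and with enough integrability near $z = 0$; the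
  superposition of the Mehler kernels at the points $sz$ with $s = t^{1/\beta}$ then represents $K_t$
  (\<open>laplace_multiplier_kernel\<close>). For $\beta \le 1$ the classical subordination formula does this with
  positive weights on the positive axis. For $\beta > 1$ the symbol is not completely monotone and complex
  weights are needed. They come, for all $\beta$ alike, from Cauchy's formula: $f(z) = e^{-z^\beta}(1+z)^M - 1/(1+z)$ is
  holomorphic in a narrow sector around the positive axis, vanishes at the vertex and decays at infinity,
  so that $f(l)$ is an integral of $f(\zeta)/(\zeta - l)$ over the two bounding rays; on each ray
  $1/(\zeta - l)$ is the Laplace integral of an exponential along a second ray, chosen so that both
  exponents decay (\<open>ray_laplace_representation\<close>, \<open>fractional_laplace_representation\<close>). Afterwards the
  factor $(1+l)^M$ is divided out again. The powers of $1/(1+l)$ are Laplace transforms of Erlang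
  densities, whose zero at the origin compensates the singularity $(1-|r|)^{-d/2}$
  (\<open>heat_kernel_small_time\<close>).

  \<^bold>\<open>Large times.\<close> The Hermite functions grow at most polynomially in the index and decay in space
  (\<open>hermite_fun_bound\<close>, itself read off from Mehler's formula), so $|P_k(x,y)|$ is at most a polynomial
  in $k$ times $W(x) W(y)$, with $W$ bounded and integrable. For $t \ge 1$ the $k$-th coefficient is at most
  $e^{-(t-1)d^\beta}$ times its value at $t = 1$, and $|K_t(x,y)| \le C e^{-td^\beta} W(x) W(y)$ follows (\<open>heat_kernel_large_time\<close>).
\<close>

section \<open>Integral operators between Lebesgue spaces\<close>

text \<open>
  The power mean inequality for a measure with density \<open>m\<close> of mass at most
  \<open>A\<close>. Young's inequality with one scaling parameter \<open>c\<close> for all points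
  avoids the division by the actual mass, which may be $0$.
\<close>

lemma nn_integral_power_mean:
  fixes m :: "'a \<Rightarrow> ennreal" and g :: "'a \<Rightarrow> real"
  assumes [measurable]: "m \<in> borel_measurable M" "g \<in> borel_measurable M"
    and g: "\<And>x. 0 \<le> g x" and r: "1 \<le> r" and A: "0 < A" and G: "0 \<le> G"
    and mA: "(\<integral>\<^sup>+x. m x \<partial>M) \<le> ennreal A"
    and mG: "(\<integral>\<^sup>+x. m x * ennreal (g x powr r) \<partial>M) \<le> ennreal G"
  shows "(\<integral>\<^sup>+x. m x * ennreal (g x) \<partial>M) \<le> ennreal (A powr (1 - 1 / r) * G powr (1 / r))"
proof (cases "G = 0")
  case True
  have "(\<integral>\<^sup>+x. m x * ennreal (g x powr r) \<partial>M) = 0" using mG True by simp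
  then have "AE x in M. m x * ennreal (g x powr r) = 0" by (subst (asm) nn_integral_0_iff_AE) auto
  then have "AE x in M. m x * ennreal (g x) = 0"
    by eventually_elim (use g r in \<open>auto simp: ennreal_eq_0_iff\<close>)
  then have "(\<integral>\<^sup>+x. m x * ennreal (g x) \<partial>M) = 0" by (subst nn_integral_0_iff_AE) auto
  then show ?thesis by simp
next
  case False
  with G have G: "G > 0" by simp
  define c where "c = (G / A) powr (1 / r)"
  have c: "c > 0" using A G by (simp add: c_def)
  \<comment> \<open>Young's inequality, scaled by the value of \<open>c\<close> that is optimal after integration\<close>
  have young: "g x \<le> c powr (1 - r) / r * g x powr r + (1 - 1 / r) * c" for x
  proof (cases "r = 1")
    case False
    with r have r1: "1 < r" by simp
    define p where "p = r / (r - 1)"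
    have p: "1 < p" "1 / r + 1 / p = 1" "1 / p = 1 - 1 / r" using r1 by (auto simp: p_def field_simps)
    have e: "(- (1 - 1 / r)) * r = 1 - r" "(1 - 1 / r) * p = 1" using r1 by (auto simp: p_def field_simps)
    have "(g x * c powr (- (1 - 1 / r))) * c powr (1 - 1 / r)
        \<le> (g x * c powr (- (1 - 1 / r))) powr r / r + (c powr (1 - 1 / r)) powr p / p"
      by (rule Youngs_inequality) (use g r1 p c in auto)
    also have "(g x * c powr (- (1 - 1 / r))) * c powr (1 - 1 / r) = g x"
      using c by (simp add: powr_add[symmetric])
    also have "(g x * c powr (- (1 - 1 / r))) powr r = c powr (1 - r) * g x powr r"
      using g[of x] c unfolding e(1)[symmetric] by (simp add: powr_mult powr_powr)
    also have "(c powr (1 - 1 / r)) powr p / p = (1 - 1 / r) * c"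
      using c by (subst powr_powr, subst e(2)) (simp add: p(3) divide_inverse[of c p] inverse_eq_divide)
    finally show ?thesis by simp
  qed (use c g in auto)
  have e1: "c powr (1 - r) / r \<ge> 0" "(1 - 1 / r) * c \<ge> 0" using r c by auto
  have "(\<integral>\<^sup>+x. m x * ennreal (g x) \<partial>M)
      \<le> (\<integral>\<^sup>+x. ennreal (c powr (1 - r) / r) * (m x * ennreal (g x powr r)) + ennreal ((1 - 1 / r) * c) * m x \<partial>M)"
  proof (rule nn_integral_mono)
    fix x
    have "m x * ennreal (g x) \<le> m x * ennreal (c powr (1 - r) / r * g x powr r + (1 - 1 / r) * c)"
      by (intro mult_left_mono ennreal_leI young) auto
    also have "\<dots> = m x * (ennreal (c powr (1 - r) / r) * ennreal (g x powr r) + ennreal ((1 - 1 / r) * c))"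
    proof -
      have "ennreal (c powr (1 - r) / r * g x powr r + (1 - 1 / r) * c) = ennreal (c powr (1 - r) / r * g x powr r) + ennreal ((1 - 1 / r) * c)"
        by (intro ennreal_plus mult_nonneg_nonneg e1) auto
      then show ?thesis using e1 by (simp only: ennreal_mult powr_ge_zero)
    qed
    finally show "m x * ennreal (g x) \<le> ennreal (c powr (1 - r) / r) * (m x * ennreal (g x powr r)) + ennreal ((1 - 1 / r) * c) * m x"
      by (simp add: algebra_simps)
  qed
  also have "\<dots> = ennreal (c powr (1 - r) / r) * (\<integral>\<^sup>+x. m x * ennreal (g x powr r) \<partial>M) + ennreal ((1 - 1 / r) * c) * (\<integral>\<^sup>+x. m x \<partial>M)"
    by (simp add: nn_integral_add nn_integral_cmult)
  also have "\<dots> \<le> ennreal (c powr (1 - r) / r) * ennreal G + ennreal ((1 - 1 / r) * c) * ennreal A"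
    by (intro add_mono mult_left_mono mA mG) auto
  also have "\<dots> = ennreal (c powr (1 - r) / r * G + (1 - 1 / r) * c * A)"
  proof -
    have "0 \<le> c powr (1 - r) / r * G" "0 \<le> (1 - 1 / r) * c * A"
      using A G by (intro mult_nonneg_nonneg e1; simp)+
    then show ?thesis using e1 A G by (simp only: ennreal_mult[symmetric] ennreal_plus less_imp_le)
  qed
  also have "c * A = A powr (1 - 1 / r) * G powr (1 / r)"
    using A G by (simp add: c_def powr_divide powr_diff)
  moreover have "c powr (1 - r) * G = A powr (1 - 1 / r) * G powr (1 / r)"
  proof -
    have "c powr (1 - r) * G = (G / A) powr (1 / r - 1) * G"
      using r by (simp add: c_def powr_powr diff_divide_distrib)
    also have "\<dots> = A powr (1 - 1 / r) * G powr (1 / r)"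
      using A G by (simp add: powr_divide powr_diff field_simps)
    finally show ?thesis .
  qed
  ultimately have "(\<integral>\<^sup>+x. m x * ennreal (g x) \<partial>M) \<le> ennreal (A powr (1 - 1 / r) * G powr (1 / r) / r + (1 - 1 / r) * (A powr (1 - 1 / r) * G powr (1 / r)))"
    by (simp add: mult.assoc)
  also have "A powr (1 - 1 / r) * G powr (1 / r) / r + (1 - 1 / r) * (A powr (1 - 1 / r) * G powr (1 / r)) = A powr (1 - 1 / r) * G powr (1 / r)"
    by (simp add: algebra_simps)
  finally show ?thesis .
qed

lemma Lp_finite_boundI:
  fixes u :: "real ^ 'n::finite \<Rightarrow> complex"
  assumes [measurable]: "u \<in> borel_measurable lebesgue" and q: "1 \<le> q" "q < \<infinity>" and b: "0 \<le> b"
    and le: "(\<integral>\<^sup>+x. ennreal (cmod (u x) powr enn2real q) \<partial>lebesgue) \<le> ennreal (b powr enn2real q)"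
  shows "u \<in> Lp_space q \<and> Lp_norm q u \<le> b"
proof -
  define Q where "Q = enn2real q"
  have Q: "1 \<le> Q"
    using q by (cases q) (auto simp: Q_def)
  have int: "integrable lebesgue (\<lambda>x. cmod (u x) powr Q)"
    by (rule integrableI_bounded) (use le in \<open>auto simp: Q_def top_unique less_top[symmetric]\<close>)
  have "ennreal (LINT x|lebesgue. cmod (u x) powr Q) \<le> ennreal (b powr Q)"
    using le int by (subst nn_integral_eq_integral[symmetric]) (auto simp: Q_def)
  then have "(LINT x|lebesgue. cmod (u x) powr Q) \<le> b powr Q" by simp
  then have "(LINT x|lebesgue. cmod (u x) powr Q) powr (1 / Q) \<le> (b powr Q) powr (1 / Q)"
    using Q by (intro powr_mono2) auto
  also have "\<dots> = b" using Q b by (simp add: powr_powr)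
  finally show ?thesis using int q by (auto simp: Lp_space_def Lp_norm_def Q_def)
qed

lemma Lp_infinite_boundI:
  fixes u :: "real ^ 'n::finite \<Rightarrow> complex"
  assumes [measurable]: "u \<in> borel_measurable lebesgue" and b: "0 \<le> b" and le: "\<And>x. cmod (u x) \<le> b"
  shows "u \<in> Lp_space \<infinity> \<and> Lp_norm \<infinity> u \<le> b"
proof -
  have *: "esssup lebesgue (\<lambda>x. ennreal (cmod (u x))) \<le> ennreal b"
    by (rule esssup_I) (use le in \<open>auto intro!: ennreal_leI\<close>)
  then have "enn2real (esssup lebesgue (\<lambda>x. ennreal (cmod (u x)))) \<le> b"
    using b enn2real_leI by blast
  then show ?thesis using * by (auto simp: Lp_space_def Lp_norm_def top_unique less_top[symmetric])
qed

lemma Lp_finite_nn_integral: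
  assumes f: "f \<in> Lp_space p" and p: "1 \<le> p" "p < \<infinity>"
  shows "(\<integral>\<^sup>+x. ennreal (cmod (f x) powr enn2real p) \<partial>lebesgue) = ennreal (Lp_norm p f powr enn2real p)"
proof -
  have P: "1 \<le> enn2real p" using p by (cases p) auto
  have int: "integrable lebesgue (\<lambda>x. cmod (f x) powr enn2real p)"
    using f p by (auto simp: Lp_space_def)
  have "0 \<le> (LINT x|lebesgue. cmod (f x) powr enn2real p)" by (intro integral_nonneg_AE) auto
  then show ?thesis using p P int by (subst nn_integral_eq_integral) (auto simp: Lp_norm_def powr_powr)
qed

lemma Lp_norm_nonneg: "0 \<le> Lp_norm p f"
  by (auto simp: Lp_norm_def)

text \<open>
  Fubini's theorem is applied to products of Borel kernels with $|f|$, but $f$ is only Lebesgue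
  measurable; this provides a Borel representative of $|f|$.
\<close>

lemma Lp_space_borel_majorant:
  fixes f :: "real ^ 'n::finite \<Rightarrow> complex"
  assumes "f \<in> Lp_space p"
  obtains g :: "real ^ 'n \<Rightarrow> real" where "g \<in> borel_measurable borel" "\<And>x. 0 \<le> g x" "AE x in lebesgue. cmod (f x) = g x"
proof -
  have [measurable]: "f \<in> borel_measurable lebesgue" using assms by (auto simp: Lp_space_def)
  have "(\<lambda>x. cmod (f x)) \<in> borel_measurable lebesgue" by measurable
  then obtain g where g: "g \<in> borel_measurable lborel" "AE x in lborel. cmod (f x) = g x"
    using completion_ex_borel_measurable_real by blast
  show ?thesis
  proof
    show "(\<lambda>x. \<bar>g x\<bar>) \<in> borel_measurable borel" using g(1) by simp
    have "AE x in lborel. cmod (f x) = \<bar>g x\<bar>" using g(2) by eventually_elim (metis abs_norm_cancel)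
    then show "AE x in lebesgue. cmod (f x) = \<bar>g x\<bar>" by (rule AE_completion)
  qed auto
qed

text \<open>
  These four bounds are preserved by sums and superpositions of kernels, and together they control
  the operator between all pairs of Lebesgue spaces. One constant serves for rows and columns and
  one for supremum and total mass, since in each pair the two quantities are of the same order for
  heat kernels.
\<close>

definition kernel_bounds :: "(real ^ 'n::finite \<Rightarrow> real ^ 'n \<Rightarrow> ennreal) \<Rightarrow> ennreal \<Rightarrow> ennreal \<Rightarrow> bool" where
  "kernel_bounds J A B \<longleftrightarrow> case_prod J \<in> borel_measurable (borel \<Otimes>\<^sub>M borel)
     \<and> (\<forall>x. (\<integral>\<^sup>+y. J x y \<partial>lborel) \<le> A) \<and> (\<forall>y. (\<integral>\<^sup>+x. J x y \<partial>lborel) \<le> A)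
     \<and> (\<forall>x y. J x y \<le> B) \<and> (\<integral>\<^sup>+x. \<integral>\<^sup>+y. J x y \<partial>lborel \<partial>lborel) \<le> B"

lemma kernel_boundsI:
  assumes "case_prod J \<in> borel_measurable (borel \<Otimes>\<^sub>M borel)" "\<And>x y. J x y = J y x"
    and "\<And>x. (\<integral>\<^sup>+y. J x y \<partial>lborel) \<le> A" "\<And>x y. J x y \<le> B" "(\<integral>\<^sup>+x. \<integral>\<^sup>+y. J x y \<partial>lborel \<partial>lborel) \<le> B"
  shows "kernel_bounds J A B"
proof -
  have "(\<integral>\<^sup>+x. J x y \<partial>lborel) \<le> A" for y
    by (rule order_trans[OF eq_refl assms(3)]) (rule nn_integral_cong, rule assms(2))
  with assms(1,3-) show ?thesis by (simp add: kernel_bounds_def)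
qed

lemma kernel_bounds_mono: "kernel_bounds J A B \<Longrightarrow> A \<le> A' \<Longrightarrow> B \<le> B' \<Longrightarrow> kernel_bounds J A' B'"
  unfolding kernel_bounds_def by (blast intro: order_trans)

lemma kernel_bounds_cmult:
  assumes "kernel_bounds J A B"
  shows "kernel_bounds (\<lambda>x y. c * J x y) (c * A) (c * B)"
proof -
  have [measurable]: "case_prod J \<in> borel_measurable (borel \<Otimes>\<^sub>M borel)" using assms by (simp add: kernel_bounds_def)
  show ?thesis
    using assms unfolding kernel_bounds_def by (auto simp: nn_integral_cmult intro!: mult_left_mono)
qed

lemma kernel_bounds_add:
  assumes "kernel_bounds J A B" "kernel_bounds J' A' B'"
  shows "kernel_bounds (\<lambda>x y. J x y + J' x y) (A + A') (B + B')"
proof -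
  have [measurable]: "case_prod J \<in> borel_measurable (borel \<Otimes>\<^sub>M borel)" "case_prod J' \<in> borel_measurable (borel \<Otimes>\<^sub>M borel)"
    using assms by (simp_all add: kernel_bounds_def)
  show ?thesis
    using assms unfolding kernel_bounds_def by (auto simp: nn_integral_add intro!: add_mono)
qed

text \<open>
  Tonelli's theorem: each of the four quantities of a superposition is at most the superposition of
  those quantities.
\<close>

lemma kernel_bounds_superposition:
  fixes M :: "'w measure" and K :: "'w \<Rightarrow> (real ^ 'n::finite) \<times> (real ^ 'n) \<Rightarrow> ennreal"
  assumes sf: "sigma_finite_measure M"
    and K[measurable]: "case_prod K \<in> borel_measurable (M \<Otimes>\<^sub>M (borel \<Otimes>\<^sub>M borel))"
    and kb: "\<And>\<omega>. kernel_bounds (\<lambda>x y. K \<omega> (x, y)) (a \<omega>) (b \<omega>)"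
    and a: "(\<integral>\<^sup>+\<omega>. a \<omega> \<partial>M) \<le> A" and b: "(\<integral>\<^sup>+\<omega>. b \<omega> \<partial>M) \<le> B"
  shows "kernel_bounds (\<lambda>x y. \<integral>\<^sup>+\<omega>. K \<omega> (x, y) \<partial>M) A B"
proof -
  interpret sigma_finite_measure M by (rule sf)
  interpret P: pair_sigma_finite M "lborel :: (real ^ 'n) measure" ..
  note kb = kb[unfolded kernel_bounds_def]
  have fub: "(\<integral>\<^sup>+y. \<integral>\<^sup>+\<omega>. K \<omega> (x, y) \<partial>M \<partial>lborel) = (\<integral>\<^sup>+\<omega>. \<integral>\<^sup>+y. K \<omega> (x, y) \<partial>lborel \<partial>M)" for x
    by (rule P.Fubini') measurable
  show ?thesis
    unfolding kernel_bounds_def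
  proof (intro conjI allI)
    show "(\<lambda>(x, y). \<integral>\<^sup>+\<omega>. K \<omega> (x, y) \<partial>M) \<in> borel_measurable (borel \<Otimes>\<^sub>M borel)" by measurable
    fix x y
    show "(\<integral>\<^sup>+y. \<integral>\<^sup>+\<omega>. K \<omega> (x, y) \<partial>M \<partial>lborel) \<le> A"
      unfolding fub by (rule order_trans[OF nn_integral_mono a]) (use kb in blast)
    have "(\<integral>\<^sup>+x. \<integral>\<^sup>+\<omega>. K \<omega> (x, y) \<partial>M \<partial>lborel) = (\<integral>\<^sup>+\<omega>. \<integral>\<^sup>+x. K \<omega> (x, y) \<partial>lborel \<partial>M)"
      by (rule P.Fubini') measurable
    also have "\<dots> \<le> A" by (rule order_trans[OF nn_integral_mono a]) (use kb in blast)
    finally show "(\<integral>\<^sup>+x. \<integral>\<^sup>+\<omega>. K \<omega> (x, y) \<partial>M \<partial>lborel) \<le> A" .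
    show "(\<integral>\<^sup>+\<omega>. K \<omega> (x, y) \<partial>M) \<le> B" by (rule order_trans[OF nn_integral_mono b]) (use kb in blast)
  next
    have "(\<integral>\<^sup>+x. \<integral>\<^sup>+y. \<integral>\<^sup>+\<omega>. K \<omega> (x, y) \<partial>M \<partial>lborel \<partial>lborel) = (\<integral>\<^sup>+x. \<integral>\<^sup>+\<omega>. \<integral>\<^sup>+y. K \<omega> (x, y) \<partial>lborel \<partial>M \<partial>lborel)"
      by (simp only: fub)
    also have "\<dots> = (\<integral>\<^sup>+\<omega>. \<integral>\<^sup>+x. \<integral>\<^sup>+y. K \<omega> (x, y) \<partial>lborel \<partial>lborel \<partial>M)"
      by (rule P.Fubini') measurable
    also have "\<dots> \<le> B" by (rule order_trans[OF nn_integral_mono b]) (use kb in blast)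
    finally show "(\<integral>\<^sup>+x. \<integral>\<^sup>+y. \<integral>\<^sup>+\<omega>. K \<omega> (x, y) \<partial>M \<partial>lborel \<partial>lborel) \<le> B" .
  qed
qed

text \<open>
  The power mean inequality in each row bounds $|u(x)|^r$ by $A^{r-1} \int J(x,y) |f(y)|^r dy$. For
  $p \le q < \infty$ one takes $r = p$ to bound both the supremum of $|u|$ and its $L^p$ norm, and
  $|u|^q \le \sup |u|^{q-p} \cdot |u|^p$. For $q < p < \infty$ one takes $r = q$ and integrates in
  $x$; a second power mean with exponent $p/q$, against the column integrals \<open>m\<close>, whose
  total mass is at most $B$, brings in the $L^p$ norm of $f$.
\<close>

lemma Lp_kernel_bound:
  fixes J :: "real ^ 'n::finite \<Rightarrow> real ^ 'n \<Rightarrow> ennreal" and f u :: "real ^ 'n \<Rightarrow> complex"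
  assumes kb: "kernel_bounds J (ennreal A) (ennreal B)" and A: "0 < A" and B: "0 < B"
    and p: "1 \<le> p" and q: "1 \<le> q" and f: "f \<in> Lp_space p"
    and u[measurable]: "u \<in> borel_measurable lebesgue"
    and uJ: "\<And>x. ennreal (cmod (u x)) \<le> (\<integral>\<^sup>+y. J x y * ennreal (cmod (f y)) \<partial>lebesgue)"
    and \<delta>: "\<delta> = \<bar>enn2real (1 / p) - enn2real (1 / q)\<bar>"
  shows "u \<in> Lp_space q \<and> Lp_norm q u \<le> A powr (1 - \<delta>) * B powr \<delta> * Lp_norm p f"
proof -
  have J[measurable]: "case_prod J \<in> borel_measurable (borel \<Otimes>\<^sub>M borel)"
    and row: "(\<integral>\<^sup>+y. J x y \<partial>lborel) \<le> ennreal A" and col: "(\<integral>\<^sup>+x. J x y \<partial>lborel) \<le> ennreal A"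
    and sup: "J x y \<le> ennreal B" and dbl: "(\<integral>\<^sup>+x. \<integral>\<^sup>+y. J x y \<partial>lborel \<partial>lborel) \<le> ennreal B" for x y
    using kb by (auto simp: kernel_bounds_def)
  have J1[measurable]: "case_prod J \<in> borel_measurable (lborel \<Otimes>\<^sub>M lborel)"
    using J by (simp cong: measurable_cong_sets sets_pair_measure_cong)
  obtain g where g[measurable]: "g \<in> borel_measurable borel" and g0: "\<And>x. 0 \<le> g x"
    and fg: "AE x in lebesgue. cmod (f x) = g x"
    using Lp_space_borel_majorant[OF f] by metis
  define n where "n = Lp_norm p f"
  have n: "0 \<le> n" by (simp add: n_def Lp_norm_nonneg)
  have uT: "ennreal (cmod (u x)) \<le> (\<integral>\<^sup>+y. J x y * ennreal (g y) \<partial>lborel)" for x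
  proof -
    have "(\<integral>\<^sup>+y. J x y * ennreal (cmod (f y)) \<partial>lebesgue) = (\<integral>\<^sup>+y. J x y * ennreal (g y) \<partial>lebesgue)"
      by (rule nn_integral_cong_AE) (use fg in \<open>eventually_elim, auto\<close>)
    also have "\<dots> = (\<integral>\<^sup>+y. J x y * ennreal (g y) \<partial>lborel)"
      by (rule nn_integral_completion)
    finally show ?thesis using uJ[of x] by simp
  qed
  define m where "m y = (\<integral>\<^sup>+x. J x y \<partial>lborel)" for y
  have m[measurable]: "m \<in> borel_measurable borel"
    unfolding m_def by (rule lborel.borel_measurable_nn_integral[of "\<lambda>y x. J x y", simplified]) measurable
  have mA: "m y \<le> ennreal A" for y by (simp add: m_def col)
  have mB: "(\<integral>\<^sup>+y. m y \<partial>lborel) \<le> ennreal B"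
    unfolding m_def by (subst lborel_pair.Fubini') (use dbl in auto)
  \<comment> \<open>pointwise power mean against the measure with density \<open>J x\<close>, then integration in \<open>x\<close>\<close>
  have pt: "ennreal (cmod (u x) powr r) \<le> ennreal (A powr (r - 1)) * (\<integral>\<^sup>+y. J x y * ennreal (g y powr r) \<partial>lborel)"
    if r: "1 \<le> r" for x r
  proof (cases "(\<integral>\<^sup>+y. J x y * ennreal (g y powr r) \<partial>lborel)" rule: ennreal_cases)
    case (real G)
    have "ennreal (cmod (u x)) \<le> ennreal (A powr (1 - 1 / r) * G powr (1 / r))"
      by (rule order_trans[OF uT nn_integral_power_mean]) (use r A row real g0 in auto)
    then have "cmod (u x) \<le> A powr (1 - 1 / r) * G powr (1 / r)" by (simp add: real)
    then have "cmod (u x) powr r \<le> (A powr (1 - 1 / r) * G powr (1 / r)) powr r"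
      using r by (intro powr_mono2) auto
    also have "\<dots> = A powr ((1 - 1 / r) * r) * G"
      using r real A by (simp add: powr_mult powr_powr)
    also have "(1 - 1 / r) * r = r - 1"
      using r by (simp add: field_simps)
    finally show ?thesis using real by (simp add: ennreal_mult[symmetric] ennreal_leI)
  qed (use A in \<open>simp add: ennreal_mult_top\<close>)
  have L2: "(\<integral>\<^sup>+x. ennreal (cmod (u x) powr r) \<partial>lebesgue) \<le> ennreal (A powr (r - 1)) * (\<integral>\<^sup>+y. m y * ennreal (g y powr r) \<partial>lborel)"
    if r: "1 \<le> r" for r
  proof -
    have "(\<integral>\<^sup>+x. ennreal (cmod (u x) powr r) \<partial>lebesgue)
       \<le> (\<integral>\<^sup>+x. ennreal (A powr (r - 1)) * (\<integral>\<^sup>+y. J x y * ennreal (g y powr r) \<partial>lborel) \<partial>lebesgue)"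
      by (intro nn_integral_mono pt r)
    also have "\<dots> = (\<integral>\<^sup>+x. ennreal (A powr (r - 1)) * (\<integral>\<^sup>+y. J x y * ennreal (g y powr r) \<partial>lborel) \<partial>lborel)"
      by (rule nn_integral_completion)
    also have "\<dots> = ennreal (A powr (r - 1)) * (\<integral>\<^sup>+x. \<integral>\<^sup>+y. J x y * ennreal (g y powr r) \<partial>lborel \<partial>lborel)"
      by (rule nn_integral_cmult) measurable
    also have "(\<integral>\<^sup>+x. \<integral>\<^sup>+y. J x y * ennreal (g y powr r) \<partial>lborel \<partial>lborel) = (\<integral>\<^sup>+y. \<integral>\<^sup>+x. J x y * ennreal (g y powr r) \<partial>lborel \<partial>lborel)"
      by (rule lborel_pair.Fubini'[symmetric]) measurable
    also have "\<dots> = (\<integral>\<^sup>+y. m y * ennreal (g y powr r) \<partial>lborel)"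
      unfolding m_def by (intro nn_integral_cong nn_integral_multc) measurable
    finally show ?thesis .
  qed
  define P Q where "P = enn2real p" and "Q = enn2real q"
  have P: "1 \<le> P" "enn2real (1 / p) = 1 / P" if "p < \<infinity>"
    using that p by (cases p; auto simp: P_def divide_ennreal ennreal_1[symmetric] simp del: ennreal_1)+
  have Q: "1 \<le> Q" "enn2real (1 / q) = 1 / Q" if "q < \<infinity>"
    using that q by (cases q; auto simp: Q_def divide_ennreal ennreal_1[symmetric] simp del: ennreal_1)+
  have gn: "(\<integral>\<^sup>+y. ennreal (g y powr P) \<partial>lborel) = ennreal (n powr P)" if "p < \<infinity>"
  proof -
    have "(\<integral>\<^sup>+y. ennreal (g y powr P) \<partial>lborel) = (\<integral>\<^sup>+y. ennreal (g y powr P) \<partial>lebesgue)"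
      by (rule nn_integral_completion[symmetric])
    also have "\<dots> = (\<integral>\<^sup>+y. ennreal (cmod (f y) powr P) \<partial>lebesgue)"
      by (rule nn_integral_cong_AE) (use fg in \<open>eventually_elim, auto\<close>)
    also have "\<dots> = ennreal (n powr P)"
      using Lp_finite_nn_integral[OF f p that] by (simp add: P_def n_def)
    finally show ?thesis .
  qed
  have ginf: "AE y in lborel. g y \<le> n" if "p = \<infinity>"
  proof -
    have fin: "esssup lebesgue (\<lambda>x. ennreal (cmod (f x))) < \<infinity>" using f that by (auto simp: Lp_space_def)
    have "AE y in lebesgue. ennreal (cmod (f y)) \<le> esssup lebesgue (\<lambda>x. ennreal (cmod (f x)))" by (rule esssup_AE)
    then have "AE y in lebesgue. g y \<le> n" using fg
    proof eventually_elim
      case (elim y)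
      then have "ennreal (g y) \<le> ennreal n" using fin that by (simp add: n_def Lp_norm_def)
      then show ?case using n by simp
    qed
    then show ?thesis by (simp add: AE_completion_iff)
  qed
  have mgP: "(\<integral>\<^sup>+y. m y * ennreal (g y powr P) \<partial>lborel) \<le> ennreal (A * n powr P)" if "p < \<infinity>"
  proof -
    have "(\<integral>\<^sup>+y. m y * ennreal (g y powr P) \<partial>lborel) \<le> (\<integral>\<^sup>+y. ennreal A * ennreal (g y powr P) \<partial>lborel)"
      by (intro nn_integral_mono mult_right_mono mA) auto
    also have "\<dots> = ennreal (A * n powr P)"
      using A by (simp add: nn_integral_cmult gn[OF that] ennreal_mult)
    finally show ?thesis .
  qed
  have sup_p: "cmod (u x) \<le> A powr (1 - 1 / P) * B powr (1 / P) * n" if pf: "p < \<infinity>" for x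
  proof -
    have "(\<integral>\<^sup>+y. J x y * ennreal (g y powr P) \<partial>lborel) \<le> (\<integral>\<^sup>+y. ennreal B * ennreal (g y powr P) \<partial>lborel)"
      by (intro nn_integral_mono mult_right_mono sup) auto
    also have "\<dots> = ennreal (B * n powr P)"
      using B by (simp add: nn_integral_cmult gn[OF pf] ennreal_mult)
    finally have "(\<integral>\<^sup>+y. J x y * ennreal (g y) \<partial>lborel) \<le> ennreal (A powr (1 - 1 / P) * (B * n powr P) powr (1 / P))"
      by (intro nn_integral_power_mean) (use P[OF pf] A B n row g0 in auto)
    with uT[of x] have "ennreal (cmod (u x)) \<le> ennreal (A powr (1 - 1 / P) * (B * n powr P) powr (1 / P))"
      by (rule order_trans)
    then have "cmod (u x) \<le> A powr (1 - 1 / P) * (B * n powr P) powr (1 / P)" by simp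
    also have "\<dots> = A powr (1 - 1 / P) * B powr (1 / P) * n"
      using P[OF pf] B n by (simp add: powr_mult powr_powr)
    finally show ?thesis .
  qed
  consider "p = \<infinity>" "q = \<infinity>" | "p = \<infinity>" "q < \<infinity>" | "p < \<infinity>" "q = \<infinity>"
    | "p < \<infinity>" "q < \<infinity>" "p \<le> q" | "p < \<infinity>" "q < \<infinity>" "q < p"
    using top.not_eq_extremum by fastforce
  then show ?thesis
  proof cases
    case 1
    have d: "\<delta> = 0" using 1 by (simp add: \<delta>)
    have "cmod (u x) \<le> A * n" for x
    proof -
      have "(\<integral>\<^sup>+y. J x y * ennreal (g y) \<partial>lborel) \<le> (\<integral>\<^sup>+y. J x y * ennreal n \<partial>lborel)"
        by (rule nn_integral_mono_AE) (use ginf[OF 1(1)] in \<open>eventually_elim, auto intro!: mult_left_mono ennreal_leI\<close>)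
      also have "\<dots> = (\<integral>\<^sup>+y. J x y \<partial>lborel) * ennreal n" by (rule nn_integral_multc) measurable
      also have "\<dots> \<le> ennreal A * ennreal n" by (intro mult_right_mono row) auto
      finally have "ennreal (cmod (u x)) \<le> ennreal (A * n)"
        using uT[of x] A n by (simp add: ennreal_mult)
      then show ?thesis using A n by simp
    qed
    then show ?thesis using Lp_infinite_boundI[OF u, of "A * n"] A B n 1 d by (simp add: n_def)
  next
    case 2
    have d: "\<delta> = 1 / Q" using 2 Q by (simp add: \<delta>)
    have "(\<integral>\<^sup>+y. m y * ennreal (g y powr Q) \<partial>lborel) \<le> (\<integral>\<^sup>+y. m y * ennreal (n powr Q) \<partial>lborel)"
      by (rule nn_integral_mono_AE)
         (use ginf[OF 2(1)] in \<open>eventually_elim, use g0 Q[OF 2(2)] in \<open>auto intro!: mult_left_mono ennreal_leI powr_mono2\<close>\<close>)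
    also have "\<dots> = (\<integral>\<^sup>+y. m y \<partial>lborel) * ennreal (n powr Q)" by (rule nn_integral_multc) measurable
    also have "\<dots> \<le> ennreal B * ennreal (n powr Q)" by (intro mult_right_mono mB) auto
    finally have "(\<integral>\<^sup>+x. ennreal (cmod (u x) powr Q) \<partial>lebesgue) \<le> ennreal (A powr (Q - 1)) * (ennreal B * ennreal (n powr Q))"
      by (intro order_trans[OF L2] mult_left_mono Q 2) auto
    also have "\<dots> = ennreal (A powr (Q - 1) * B * n powr Q)"
      using B by (simp add: ennreal_mult mult.assoc)
    also have "A powr (Q - 1) * B * n powr Q = (A powr (1 - 1 / Q) * B powr (1 / Q) * n) powr Q"
    proof -
      have "(1 - 1 / Q) * Q = Q - 1" using Q[OF 2(2)] by (simp add: field_simps)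
      then show ?thesis using A B n Q[OF 2(2)] by (simp add: powr_mult powr_powr)
    qed
    finally show ?thesis
      using Lp_finite_boundI[OF u q 2(2), of "A powr (1 - \<delta>) * B powr \<delta> * n"] n by (simp add: d Q_def n_def)
  next
    case 3
    have d: "\<delta> = 1 / P" using 3 P by (simp add: \<delta>)
    show ?thesis using Lp_infinite_boundI[OF u _ sup_p[OF 3(1)]] 3 n d by (simp add: n_def)
  next
    case 4
    note PQ = P[OF 4(1)] Q[OF 4(2)]
    have le: "P \<le> Q" unfolding P_def Q_def using 4 by (intro enn2real_mono) auto
    then have d: "\<delta> = 1 / P - 1 / Q" using PQ by (simp add: \<delta> frac_le)
    define S where "S = A powr (1 - 1 / P) * B powr (1 / P) * n"
    have S: "0 \<le> S" using n by (simp add: S_def)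
    have "(\<integral>\<^sup>+x. ennreal (cmod (u x) powr Q) \<partial>lebesgue) \<le> (\<integral>\<^sup>+x. ennreal (S powr (Q - P)) * ennreal (cmod (u x) powr P) \<partial>lebesgue)"
    proof (rule nn_integral_mono)
      fix x
      have "cmod (u x) powr Q = cmod (u x) powr (Q - P) * cmod (u x) powr P"
        by (simp add: powr_add[symmetric])
      also have "\<dots> \<le> S powr (Q - P) * cmod (u x) powr P"
        using le sup_p[OF 4(1), of x] by (intro mult_right_mono powr_mono2) (auto simp: S_def)
      finally show "ennreal (cmod (u x) powr Q) \<le> ennreal (S powr (Q - P)) * ennreal (cmod (u x) powr P)"
        by (simp add: ennreal_mult[symmetric] ennreal_leI)
    qed
    also have "\<dots> = ennreal (S powr (Q - P)) * (\<integral>\<^sup>+x. ennreal (cmod (u x) powr P) \<partial>lebesgue)"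
      by (rule nn_integral_cmult) measurable
    also have "\<dots> \<le> ennreal (S powr (Q - P)) * (ennreal (A powr (P - 1)) * ennreal (A * n powr P))"
      by (intro mult_left_mono order_trans[OF L2] mgP PQ 4) auto
    also have "\<dots> = ennreal (S powr (Q - P) * A powr (P - 1) * A * n powr P)"
      using A by (simp add: ennreal_mult mult.assoc)
    also have "S powr (Q - P) * A powr (P - 1) * A * n powr P = (A powr (1 - \<delta>) * B powr \<delta> * n) powr Q"
    proof -
      have "S powr (Q - P) * A powr (P - 1) * A * n powr P
          = A powr ((1 - 1 / P) * (Q - P)) * A powr (P - 1) * A powr 1 * B powr (1 / P * (Q - P)) * (n powr (Q - P) * n powr P)"
        using A B n by (simp add: S_def powr_mult powr_powr)
      also have "n powr (Q - P) * n powr P = n powr Q" by (simp add: powr_add[symmetric])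
      also have "A powr ((1 - 1 / P) * (Q - P)) * A powr (P - 1) * A powr 1 = A powr ((1 - \<delta>) * Q)"
      proof -
        have "(1 - 1 / P) * (Q - P) + (P - 1) + 1 = (1 - \<delta>) * Q" using PQ by (simp add: d field_simps)
        then show ?thesis by (simp add: powr_add[symmetric] del: powr_one powr_one')
      qed
      also have "1 / P * (Q - P) = \<delta> * Q" using PQ by (simp add: d field_simps)
      finally show ?thesis using A B n by (simp add: powr_mult powr_powr)
    qed
    finally show ?thesis
      using Lp_finite_boundI[OF u q 4(2), of "A powr (1 - \<delta>) * B powr \<delta> * n"] n by (simp add: Q_def n_def)
  next
    case 5
    note PQ = P[OF 5(1)] Q[OF 5(2)]
    have le: "Q \<le> P" unfolding P_def Q_def using 5 by (intro enn2real_mono) auto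
    then have d: "\<delta> = 1 / Q - 1 / P" using PQ by (simp add: \<delta> frac_le)
    have "(\<integral>\<^sup>+y. m y * ennreal (g y powr Q) \<partial>lborel) \<le> ennreal (B powr (1 - 1 / (P / Q)) * (A * n powr P) powr (1 / (P / Q)))"
    proof (rule nn_integral_power_mean)
      show "(\<integral>\<^sup>+y. m y * ennreal ((g y powr Q) powr (P / Q)) \<partial>lborel) \<le> ennreal (A * n powr P)"
        using mgP[OF 5(1)] PQ by (simp add: powr_powr)
    qed (use mB A B PQ le in auto)
    then have "(\<integral>\<^sup>+x. ennreal (cmod (u x) powr Q) \<partial>lebesgue)
       \<le> ennreal (A powr (Q - 1)) * ennreal (B powr (1 - 1 / (P / Q)) * (A * n powr P) powr (1 / (P / Q)))"
      by (intro order_trans[OF L2] mult_left_mono PQ) auto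
    also have "\<dots> = ennreal (A powr (Q - 1) * (B powr (1 - 1 / (P / Q)) * (A * n powr P) powr (1 / (P / Q))))"
      by (simp add: ennreal_mult)
    also have "A powr (Q - 1) * (B powr (1 - 1 / (P / Q)) * (A * n powr P) powr (1 / (P / Q))) = (A powr (1 - \<delta>) * B powr \<delta> * n) powr Q"
    proof -
      have e: "Q - 1 + Q / P = (1 - \<delta>) * Q" "1 - Q / P = \<delta> * Q" using PQ by (simp_all add: d field_simps)
      have "A powr (Q - 1) * (B powr (1 - 1 / (P / Q)) * (A * n powr P) powr (1 / (P / Q)))
         = A powr (Q - 1) * A powr (Q / P) * B powr (1 - Q / P) * n powr Q"
        using A B n PQ by (simp add: powr_mult powr_powr)
      also have "\<dots> = A powr (Q - 1 + Q / P) * B powr (1 - Q / P) * n powr Q" by (simp add: powr_add)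
      finally show ?thesis using A B n unfolding e by (simp add: powr_mult powr_powr)
    qed
    finally show ?thesis
      using Lp_finite_boundI[OF u q 5(2), of "A powr (1 - \<delta>) * B powr \<delta> * n"] n by (simp add: Q_def n_def)
  qed
qed

section \<open>Mehler's formula\<close>

text \<open>
  The derivatives of $e^{-x^2}$, defined through the three-term recurrence of the Hermite
  polynomials, from which the differential equation of the Mehler series is read off.
\<close>

fun gauss_deriv :: "nat \<Rightarrow> real \<Rightarrow> real" where
  "gauss_deriv 0 x = exp (- x\<^sup>2)"
| "gauss_deriv (Suc 0) x = - 2 * x * exp (- x\<^sup>2)"
| "gauss_deriv (Suc (Suc k)) x = - 2 * x * gauss_deriv (Suc k) x - 2 * (real k + 1) * gauss_deriv k x"

lemma gauss_deriv_has_derivative: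
  "(gauss_deriv k has_field_derivative gauss_deriv (Suc k) x) (at x)"
proof (induction k x rule: gauss_deriv.induct)
  case (1 x)
  have "gauss_deriv 0 = (\<lambda>x. exp (- x\<^sup>2))" by auto
  then show ?case by (auto intro!: derivative_eq_intros)
next
  case (2 x)
  have "gauss_deriv (Suc 0) = (\<lambda>x. - 2 * x * exp (- x\<^sup>2))" by auto
  then show ?case by (auto intro!: derivative_eq_intros simp: algebra_simps power2_eq_square)
next
  case (3 k x)
  have "gauss_deriv (Suc (Suc k)) = (\<lambda>x. - 2 * x * gauss_deriv (Suc k) x - 2 * (real k + 1) * gauss_deriv k x)" by auto
  then show ?case by (auto intro!: derivative_eq_intros 3 simp: algebra_simps)
qed

lemma deriv_funpow_gauss: "(deriv ^^ k) (\<lambda>u. exp (- u\<^sup>2)) = gauss_deriv k"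
proof (induction k)
  case (Suc k)
  have "deriv (gauss_deriv k) x = gauss_deriv (Suc k) x" for x
    by (rule DERIV_imp_deriv) (rule gauss_deriv_has_derivative)
  then show ?case using Suc by auto
qed auto

lemma hermite_fun_mult:
  "hermite_fun k x * hermite_fun k y
     = exp ((x\<^sup>2 + y\<^sup>2) / 2) / sqrt pi * (gauss_deriv k x * gauss_deriv k y / (2 ^ k * fact k))"
proof -
  define c where "c = sqrt pi * 2 ^ k * fact k"
  have c: "c > 0" by (simp add: c_def)
  have "c powr (-1/2) * c powr (-1/2) = 1 / c"
    using c by (simp add: powr_add[symmetric] powr_minus_divide)
  moreover have "(-1) ^ k * (-1) ^ k = (1::real)" by (simp add: power_add[symmetric])
  moreover have "hermite_fun k x * hermite_fun k y = (c powr (-1/2) * c powr (-1/2)) * ((-1) ^ k * (-1) ^ k)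
      * (exp (x\<^sup>2 / 2) * exp (y\<^sup>2 / 2)) * (gauss_deriv k x * gauss_deriv k y)"
    unfolding hermite_fun_def deriv_funpow_gauss c_def by (simp only: mult_ac minus_divide_left)
  ultimately show ?thesis
    by (simp add: c_def add_divide_distrib exp_add)
qed

text \<open>
  The Mehler series $\sum_k h_k(x) h_k(y) r^k$ as a formal power series in $r$, without the factor
  $e^{(x^2+y^2)/2} / \sqrt{\pi}$.
\<close>

definition mehler_fps :: "real \<Rightarrow> real \<Rightarrow> complex fps" where
  "mehler_fps x y = Abs_fps (\<lambda>k. of_real (gauss_deriv k x * gauss_deriv k y / (2 ^ k * fact k)))"

text \<open>
  Mehler's formula is proved by comparing differential equations in $r$. The series satisfies
  $(1-r^2)^2 A' = (r(1-r^2) + 2xy(1+r^2) - 2(x^2+y^2) r) A$ because the products $h_k(x) h_k(y)$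
  obey a recurrence of order four in $k$ that follows from the two three-term recurrences. That
  recurrence is an identity between polynomials in \<open>N\<close>, \<open>x\<close>,
  \<open>y\<close> and the values \<open>p0\<close>, \<open>p1\<close>, \<open>q0\<close>,
  \<open>q1\<close>.
\<close>

lemma mehler_fps_ode:
  fixes x y :: real
  defines "s \<equiv> fps_const (complex_of_real (x\<^sup>2 + y\<^sup>2))" and "c \<equiv> fps_const (complex_of_real (2 * x * y))"
  shows "fps_deriv (mehler_fps x y) * (1 - fps_X\<^sup>2)\<^sup>2
       = (fps_X * (1 - fps_X\<^sup>2) + c * (1 + fps_X\<^sup>2) - 2 * s * fps_X) * mehler_fps x y"
proof -
  let ?A = "mehler_fps x y"
  define a where "a k = gauss_deriv k x * gauss_deriv k y / (2 ^ k * fact k)" for k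
  have rec: "(real n + 4) * a (n + 4) - 2 * (real n + 2) * a (n + 2) + real n * a n
      = a (n + 2) - a n + 2 * x * y * (a (n + 3) + a (n + 1)) - 2 * (x\<^sup>2 + y\<^sup>2) * a (n + 2)" for n
  proof -
    define p0 p1 q0 q1 N where "p0 = gauss_deriv n x" and "p1 = gauss_deriv (Suc n) x"
      and "q0 = gauss_deriv n y" and "q1 = gauss_deriv (Suc n) y" and "N = real n"
    define p2 q2 where "p2 = - 2 * x * p1 - 2 * (N + 1) * p0" and "q2 = - 2 * y * q1 - 2 * (N + 1) * q0"
    define p3 q3 where "p3 = - 2 * x * p2 - 2 * (N + 2) * p1" and "q3 = - 2 * y * q2 - 2 * (N + 2) * q1"
    define p4 q4 where "p4 = - 2 * x * p3 - 2 * (N + 3) * p2" and "q4 = - 2 * y * q3 - 2 * (N + 3) * q2"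
    define D where "D = 2 ^ n * (fact n :: real)"
    have pos: "N + 1 \<noteq> 0" "N + 2 \<noteq> 0" "N + 3 \<noteq> 0" "N + 4 \<noteq> 0" "D \<noteq> 0"
      by (simp_all add: N_def D_def)
    \<comment> \<open>a common denominator for the coefficients \<open>a n\<close>, \<dots>, \<open>a (n + 4)\<close>\<close>
    define C where "C = 1 / (16 * (N + 1) * (N + 2) * (N + 3) * D)"
    have f1: "2 ^ (n + 1) * fact (n + 1) = 2 * (N + 1) * D"
      by (simp add: D_def N_def algebra_simps)
    have f2: "2 ^ (n + 2) * fact (n + 2) = 4 * (N + 2) * (N + 1) * D"
      by (simp add: D_def N_def algebra_simps numeral_eq_Suc)
    have f3: "2 ^ (n + 3) * fact (n + 3) = 8 * (N + 3) * (N + 2) * (N + 1) * D"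
      by (simp add: D_def N_def algebra_simps numeral_eq_Suc)
    have f4: "2 ^ (n + 4) * fact (n + 4) = 16 * (N + 4) * (N + 3) * (N + 2) * (N + 1) * D"
      by (simp add: D_def N_def algebra_simps numeral_eq_Suc)
    have g: "gauss_deriv (n + 1) x = p1" "gauss_deriv (n + 2) x = p2" "gauss_deriv (n + 3) x = p3" "gauss_deriv (n + 4) x = p4"
       "gauss_deriv (n + 1) y = q1" "gauss_deriv (n + 2) y = q2" "gauss_deriv (n + 3) y = q3" "gauss_deriv (n + 4) y = q4"
      by (simp_all add: p0_def p1_def p2_def p3_def p4_def q0_def q1_def q2_def q3_def q4_def N_def numeral_eq_Suc add_ac)
    have a0: "a n = 16 * (N + 1) * (N + 2) * (N + 3) * C * (p0 * q0)"
      unfolding a_def D_def[symmetric] p0_def[symmetric] q0_def[symmetric] C_def using pos by simp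
    have a1: "a (n + 1) = 8 * (N + 2) * (N + 3) * C * (p1 * q1)"
    proof -
      have "8 * (N + 2) * (N + 3) * C = 1 / (2 * (N + 1) * D)" unfolding C_def using pos by (subst eq_divide_eq) (simp, algebra?)
      then show ?thesis unfolding a_def g f1 by simp
    qed
    have a2: "a (n + 2) = 4 * (N + 3) * C * (p2 * q2)"
    proof -
      have "4 * (N + 3) * C = 1 / (4 * (N + 2) * (N + 1) * D)" unfolding C_def using pos by (subst eq_divide_eq) (simp, algebra?)
      then show ?thesis unfolding a_def g f2 by simp
    qed
    have a3: "a (n + 3) = 2 * C * (p3 * q3)"
    proof -
      have "2 * C = 1 / (8 * (N + 3) * (N + 2) * (N + 1) * D)" unfolding C_def using pos by (subst eq_divide_eq) (simp, algebra?)
      then show ?thesis unfolding a_def g f3 by simp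
    qed
    have a4: "(N + 4) * a (n + 4) = C * (p4 * q4)"
    proof -
      have "C = (N + 4) / (16 * (N + 4) * (N + 3) * (N + 2) * (N + 1) * D)" unfolding C_def using pos
        by (subst frac_eq_eq) (simp, simp, algebra)
      then show ?thesis unfolding a_def g f4 by simp
    qed
    have "p4 * q4 - 2 * (N + 2) * (4 * (N + 3) * (p2 * q2)) + N * (16 * (N + 1) * (N + 2) * (N + 3) * (p0 * q0))
      = 4 * (N + 3) * (p2 * q2) - 16 * (N + 1) * (N + 2) * (N + 3) * (p0 * q0)
        + 2 * x * y * (2 * (p3 * q3) + 8 * (N + 2) * (N + 3) * (p1 * q1)) - 2 * (x\<^sup>2 + y\<^sup>2) * (4 * (N + 3) * (p2 * q2))"
      using p2_def q2_def p3_def q3_def p4_def q4_def by algebra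
    then have "C * (p4 * q4 - 2 * (N + 2) * (4 * (N + 3) * (p2 * q2)) + N * (16 * (N + 1) * (N + 2) * (N + 3) * (p0 * q0)))
      = C * (4 * (N + 3) * (p2 * q2) - 16 * (N + 1) * (N + 2) * (N + 3) * (p0 * q0)
        + 2 * x * y * (2 * (p3 * q3) + 8 * (N + 2) * (N + 3) * (p1 * q1)) - 2 * (x\<^sup>2 + y\<^sup>2) * (4 * (N + 3) * (p2 * q2)))"
      by (rule arg_cong)
    moreover have "C * (p4 * q4 - 2 * (N + 2) * (4 * (N + 3) * (p2 * q2)) + N * (16 * (N + 1) * (N + 2) * (N + 3) * (p0 * q0)))
      = C * (p4 * q4) - 2 * (N + 2) * (4 * (N + 3) * C * (p2 * q2)) + N * (16 * (N + 1) * (N + 2) * (N + 3) * C * (p0 * q0))"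
      by algebra
    moreover have "C * (4 * (N + 3) * (p2 * q2) - 16 * (N + 1) * (N + 2) * (N + 3) * (p0 * q0)
        + 2 * x * y * (2 * (p3 * q3) + 8 * (N + 2) * (N + 3) * (p1 * q1)) - 2 * (x\<^sup>2 + y\<^sup>2) * (4 * (N + 3) * (p2 * q2)))
      = 4 * (N + 3) * C * (p2 * q2) - 16 * (N + 1) * (N + 2) * (N + 3) * C * (p0 * q0)
        + 2 * x * y * (2 * C * (p3 * q3) + 8 * (N + 2) * (N + 3) * C * (p1 * q1)) - 2 * (x\<^sup>2 + y\<^sup>2) * (4 * (N + 3) * C * (p2 * q2))"
      by algebra
    ultimately show ?thesis
      unfolding N_def[symmetric] a4 a3 a2 a1 a0 by (metis (no_types))
  qed
  have low: "a 1 = 2 * x * y * a 0" "2 * a 2 = a 0 + 2 * x * y * a 1 - 2 * (x\<^sup>2 + y\<^sup>2) * a 0"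
    "3 * a 3 - 2 * a 1 = a 1 + 2 * x * y * (a 2 + a 0) - 2 * (x\<^sup>2 + y\<^sup>2) * a 1"
    by (simp_all add: a_def numeral_eq_Suc power2_eq_square field_simps)
  have nth: "fps_nth ?A k = of_real (a k)" for k by (simp add: mehler_fps_def a_def)
  have "fps_deriv ?A - fps_const 2 * (fps_X ^ 2 * fps_deriv ?A) + fps_X ^ 4 * fps_deriv ?A
      = fps_X * ?A - fps_X ^ 3 * ?A + c * (?A + fps_X ^ 2 * ?A) - fps_const 2 * (s * (fps_X * ?A))"
    (is "?L = ?R")
  proof (rule fps_ext)
    fix k :: nat
    have "k = 0 \<or> k = 1 \<or> k = 2 \<or> (\<exists>n. k = n + 3)" by presburger
    then consider "k = 0" | "k = 1" | "k = 2" | n where "k = n + 3" by blast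
    then show "fps_nth ?L k = fps_nth ?R k"
    proof cases
      case 1
      have "fps_nth ?L k = of_real (a 1)" using 1 by (simp add: nth fps_X_power_mult_nth)
      also have "\<dots> = of_real (2 * x * y * a 0)" by (rule arg_cong[OF low(1)])
      also have "\<dots> = fps_nth ?R k" using 1 by (simp add: nth fps_X_power_mult_nth c_def s_def)
      finally show ?thesis .
    next
      case 2
      have "fps_nth ?L k = of_real (2 * a 2)" using 2 by (simp add: nth fps_X_power_mult_nth numeral_2_eq_2)
      also have "\<dots> = of_real (a 0 + 2 * x * y * a 1 - 2 * (x\<^sup>2 + y\<^sup>2) * a 0)" by (rule arg_cong[OF low(2)])
      also have "\<dots> = fps_nth ?R k" using 2 by (simp add: nth fps_X_power_mult_nth c_def s_def)
      finally show ?thesis .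
    next
      case 3
      have "fps_nth ?L k = of_real (3 * a 3 - 2 * a 1)" using 3 by (simp add: nth fps_X_power_mult_nth numeral_3_eq_3)
      also have "\<dots> = of_real (a 1 + 2 * x * y * (a 2 + a 0) - 2 * (x\<^sup>2 + y\<^sup>2) * a 1)" by (rule arg_cong[OF low(3)])
      also have "\<dots> = fps_nth ?R k"
      proof -
        have r: "fps_nth (fps_X * ?A) 2 = of_real (a 1)" "fps_nth (fps_X ^ 3 * ?A) 2 = 0"
          "fps_nth (fps_X ^ 2 * ?A) 2 = of_real (a 0)"
          by (simp_all add: nth fps_X_power_mult_nth)
        show ?thesis
          unfolding 3 fps_add_nth fps_sub_nth fps_mult_left_const_nth c_def s_def r nth by simp
      qed
      finally show ?thesis .
    next
      case 4
      have d: "fps_nth (fps_deriv ?A) (n + 3) = of_real ((real n + 4) * a (n + 4))"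
        "fps_nth (fps_X ^ 2 * fps_deriv ?A) (n + 3) = of_real ((real n + 2) * a (n + 2))"
        "fps_nth (fps_X ^ 4 * fps_deriv ?A) (n + 3) = of_real (real n * a n)"
      proof -
        have D: "fps_nth (fps_deriv ?A) j = of_real ((real j + 1) * a (j + 1))" for j by (simp add: nth)
        show "fps_nth (fps_deriv ?A) (n + 3) = of_real ((real n + 4) * a (n + 4))"
          unfolding D by (simp add: algebra_simps)
        have "n + 3 - 2 = n + 1" "\<not> n + 3 < 2" by auto
        then show "fps_nth (fps_X ^ 2 * fps_deriv ?A) (n + 3) = of_real ((real n + 2) * a (n + 2))"
          unfolding fps_X_power_mult_nth D by (simp add: algebra_simps)
        show "fps_nth (fps_X ^ 4 * fps_deriv ?A) (n + 3) = of_real (real n * a n)"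
          unfolding fps_X_power_mult_nth D by (cases n) auto
      qed
      have r: "fps_nth (fps_X * ?A) (n + 3) = of_real (a (n + 2))" "fps_nth (fps_X ^ 3 * ?A) (n + 3) = of_real (a n)"
         "fps_nth (fps_X ^ 2 * ?A) (n + 3) = of_real (a (n + 1))"
      proof -
        have "n + 3 - 1 = n + 2" "n + 3 - 2 = n + 1" "\<not> n + 3 < 2" by auto
        then show "fps_nth (fps_X * ?A) (n + 3) = of_real (a (n + 2))" "fps_nth (fps_X ^ 2 * ?A) (n + 3) = of_real (a (n + 1))"
          by (simp_all add: fps_X_power_mult_nth nth)
      qed (simp add: fps_X_power_mult_nth nth)
      have "fps_nth ?L k = of_real ((real n + 4) * a (n + 4)) - 2 * of_real ((real n + 2) * a (n + 2)) + of_real (real n * a n)"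
        unfolding 4 fps_add_nth fps_sub_nth fps_mult_left_const_nth d ..
      also have "\<dots> = of_real ((real n + 4) * a (n + 4) - 2 * (real n + 2) * a (n + 2) + real n * a n)" by simp
      also have "\<dots> = of_real (a (n + 2) - a n + 2 * x * y * (a (n + 3) + a (n + 1)) - 2 * (x\<^sup>2 + y\<^sup>2) * a (n + 2))"
        by (simp only: rec)
      also have "\<dots> = fps_nth ?R k"
        unfolding 4 fps_add_nth fps_sub_nth fps_mult_left_const_nth c_def s_def r nth by simp
      finally show ?thesis .
    qed
  qed
  then have *: "?L = ?R" .
  have "fps_deriv ?A * (1 - fps_X\<^sup>2)\<^sup>2 = ?L"
    by (simp add: fps_numeral_fps_const[symmetric] power2_eq_square power4_eq_xxxx algebra_simps)
  also note *
  also have "?R = (fps_X * (1 - fps_X\<^sup>2) + c * (1 + fps_X\<^sup>2) - 2 * s * fps_X) * ?A"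
    by (simp add: fps_numeral_fps_const[symmetric] power2_eq_square power3_eq_cube algebra_simps)
  finally show ?thesis .
qed

lemma fps_linear_ode_unique:
  fixes A B U V :: "complex fps"
  assumes A: "fps_deriv A * U = V * A" and B: "fps_deriv B * U = V * B"
    and U: "fps_nth U 0 \<noteq> 0" and AB: "fps_nth A 0 = fps_nth B 0"
  shows "A = B"
proof -
  define D where "D = A - B"
  have D: "fps_deriv D * U = V * D" using A B by (simp add: D_def algebra_simps)
  have "\<forall>i\<le>n. fps_nth D i = 0" for n
  proof (induction n)
    case 0
    then show ?case using AB by (simp add: D_def)
  next
    case (Suc n)
    have d0: "fps_nth (fps_deriv D) i = 0" if "i < n" for i using Suc that by (simp add: Suc_leI)
    have "fps_nth (V * D) n = 0" using Suc by (simp add: fps_mult_nth)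
    then have "0 = (\<Sum>i=0..n. fps_nth (fps_deriv D) i * fps_nth U (n - i))"
      unfolding D[symmetric] by (simp only: fps_mult_nth)
    also have "\<dots> = (\<Sum>i\<in>{n}. fps_nth (fps_deriv D) i * fps_nth U (n - i))"
      by (rule sum.mono_neutral_right) (use d0 in auto)
    finally have "fps_nth (fps_deriv D) n = 0" using U by simp
    then have "fps_nth D (Suc n) = 0" by (simp del: of_nat_Suc)
    then show ?case using Suc by (auto simp: le_Suc_eq)
  qed
  then have "D = 0" by (intro fps_ext) auto
  then show ?thesis by (simp add: D_def)
qed

text \<open>
  The closed form $(\pi(1-r^2))^{-1/2} \exp(\ldots)$, with the principal branch of the square root,
  which is holomorphic on the unit disc since $1 - r^2$ stays in the right half plane.
\<close>

definition mehler :: "complex \<Rightarrow> real \<Rightarrow> real \<Rightarrow> complex" where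
  "mehler r x y = exp (- Ln (1 - r\<^sup>2) / 2) / of_real (sqrt pi)
     * exp (- of_real (x\<^sup>2 + y\<^sup>2) / 2 + (2 * r * of_real (x * y) - r\<^sup>2 * of_real (x\<^sup>2 + y\<^sup>2)) / (1 - r\<^sup>2))"

lemma one_minus_square_nonpos:
  assumes "norm (r::complex) < 1"
  shows "1 - r\<^sup>2 \<notin> \<real>\<^sub>\<le>\<^sub>0" "1 - r\<^sup>2 \<noteq> 0"
proof -
  have "Re (r\<^sup>2) \<le> norm (r\<^sup>2)" by (rule complex_Re_le_cmod)
  also have "\<dots> < 1" using assms by (simp add: norm_power power_less_one_iff)
  finally have "Re (1 - r\<^sup>2) > 0" by simp
  then show "1 - r\<^sup>2 \<notin> \<real>\<^sub>\<le>\<^sub>0" "1 - r\<^sup>2 \<noteq> 0" by (auto simp: complex_nonpos_Reals_iff)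
qed

text \<open>
  The closed form solves the differential equation of \<open>mehler_fps\<close> and has the same
  value at $r = 0$. Being holomorphic on the whole unit disc, it is also the sum of the series
  there.
\<close>

lemma mehler_has_fps_expansion:
  "(\<lambda>r. mehler r x y) has_fps_expansion Abs_fps (\<lambda>k. of_real (hermite_fun k x * hermite_fun k y))"
  and holomorphic_on_mehler: "(\<lambda>r. mehler r x y) holomorphic_on ball 0 1"
proof -
  define s c where "s = complex_of_real (x\<^sup>2 + y\<^sup>2)" and "c = complex_of_real (2 * x * y)"
  \<comment> \<open>the closed form normalised so that its value at 0 is the constant term of \<open>mehler_fps\<close>\<close>
  define E where "E r = of_real (exp (- (x\<^sup>2 + y\<^sup>2))) * exp (- Ln (1 - r\<^sup>2) / 2 + (r * c - r\<^sup>2 * s) / (1 - r\<^sup>2))" for r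
  define K where "K = exp ((x\<^sup>2 + y\<^sup>2) / 2) / sqrt pi"
  have mE: "mehler r x y = of_real K * E r" for r
  proof -
    define S where "S = x\<^sup>2 + y\<^sup>2"
    have "complex_of_real K * of_real (exp (- S)) = of_real (K * exp (- S))" by simp
    also have "K * exp (- S) = exp (- S / 2) / sqrt pi"
      by (simp add: K_def S_def[symmetric] exp_add[symmetric])
    also have "complex_of_real \<dots> = exp (- of_real S / 2) / of_real (sqrt pi)"
      by (simp add: exp_of_real[symmetric])
    finally have 1: "of_real K * of_real (exp (- S)) = (exp (- of_real S / 2) / of_real (sqrt pi) :: complex)" .
    have "2 * r * of_real (x * y) - r\<^sup>2 * of_real S = r * c - r\<^sup>2 * s" by (simp add: c_def s_def S_def)
    then have "mehler r x y = (exp (- of_real S / 2) / of_real (sqrt pi)) * (exp (- Ln (1 - r\<^sup>2) / 2) * exp ((r * c - r\<^sup>2 * s) / (1 - r\<^sup>2)))"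
      unfolding mehler_def S_def[symmetric] by (simp only: exp_add) (simp add: mult_ac)
    also have "\<dots> = of_real K * E r"
      unfolding 1[symmetric] E_def S_def[symmetric] by (simp only: exp_add mult.assoc)
    finally show ?thesis .
  qed
  have hol: "E holomorphic_on ball 0 1"
    unfolding E_def using one_minus_square_nonpos by (auto intro!: holomorphic_intros)
  have ode: "deriv E r * (1 - r\<^sup>2)\<^sup>2 = (r * (1 - r\<^sup>2) + c * (1 + r\<^sup>2) - 2 * s * r) * E r" if r: "norm r < 1" for r
  proof -
    define u where "u = 1 - r\<^sup>2"
    have u: "u \<noteq> 0" "u \<notin> \<real>\<^sub>\<le>\<^sub>0" using one_minus_square_nonpos[OF r] by (auto simp: u_def)
    have d1: "((\<lambda>r. 1 - r\<^sup>2) has_field_derivative (- 2 * r)) (at r)"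
      by (auto intro!: derivative_eq_intros)
    have d2: "((\<lambda>r. r * c - r\<^sup>2 * s) has_field_derivative (c - 2 * r * s)) (at r)"
      by (auto intro!: derivative_eq_intros)
    have d3: "((\<lambda>r. Ln (1 - r\<^sup>2)) has_field_derivative (inverse (1 - r\<^sup>2) * (- 2 * r))) (at r)"
      by (rule DERIV_chain2[OF has_field_derivative_Ln d1]) (use u in \<open>simp add: u_def\<close>)
    have "((\<lambda>r. - Ln (1 - r\<^sup>2) / 2 + (r * c - r\<^sup>2 * s) / (1 - r\<^sup>2)) has_field_derivative
        (- (inverse (1 - r\<^sup>2) * (- 2 * r)) / 2 + ((c - 2 * r * s) * (1 - r\<^sup>2) - (r * c - r\<^sup>2 * s) * (- 2 * r)) / ((1 - r\<^sup>2) * (1 - r\<^sup>2)))) (at r)"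
      by (rule DERIV_add[OF DERIV_cdivide[OF DERIV_minus[OF d3]] DERIV_divide[OF d2 d1]]) (use u in \<open>simp add: u_def\<close>)
    also have "- (inverse (1 - r\<^sup>2) * (- 2 * r)) / 2 = r / u"
      unfolding u_def[symmetric] using u by (simp add: field_simps)
    also have "((c - 2 * r * s) * (1 - r\<^sup>2) - (r * c - r\<^sup>2 * s) * (- 2 * r)) / ((1 - r\<^sup>2) * (1 - r\<^sup>2))
        = ((c - 2 * r * s) * u + 2 * r * (r * c - r\<^sup>2 * s)) / u\<^sup>2"
      by (simp add: u_def[symmetric] power2_eq_square[of u] mult_ac)
    finally have "(E has_field_derivative (E r * (r / u + ((c - 2 * r * s) * u + 2 * r * (r * c - r\<^sup>2 * s)) / u\<^sup>2))) (at r)"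
      unfolding E_def mult.assoc by (rule DERIV_cmult[OF DERIV_fun_exp])
    then have "deriv E r = E r * (r / u + ((c - 2 * r * s) * u + 2 * r * (r * c - r\<^sup>2 * s)) / u\<^sup>2)"
      by (rule DERIV_imp_deriv)
    also have "\<dots> * u\<^sup>2 = E r * (r * u + ((c - 2 * r * s) * u + 2 * r * (r * c - r\<^sup>2 * s)))"
      using u by (simp add: field_simps power2_eq_square)
    also have "(c - 2 * r * s) * u + 2 * r * (r * c - r\<^sup>2 * s) = c * (1 + r\<^sup>2) - 2 * s * r"
      unfolding u_def by algebra
    finally show ?thesis by (simp add: u_def mult_ac add_diff_eq)
  qed
  define P where "P = fps_expansion E 0"
  have P: "E has_fps_expansion P"
    unfolding P_def by (rule has_fps_expansion_fps_expansion[OF _ _ hol]) auto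
  have "(\<lambda>r. deriv E r * (1 - r\<^sup>2)\<^sup>2) has_fps_expansion fps_deriv P * (1 - fps_X\<^sup>2)\<^sup>2"
    by (intro fps_expansion_intros P)
  moreover have ev: "\<forall>\<^sub>F r in nhds 0. deriv E r * (1 - r\<^sup>2)\<^sup>2 = (r * (1 - r\<^sup>2) + c * (1 + r\<^sup>2) - 2 * s * r) * E r"
    by (rule eventually_nhds_in_open[of "ball 0 1", THEN eventually_mono]) (auto simp: ode)
  ultimately have "(\<lambda>r. (r * (1 - r\<^sup>2) + c * (1 + r\<^sup>2) - 2 * s * r) * E r) has_fps_expansion fps_deriv P * (1 - fps_X\<^sup>2)\<^sup>2"
    using has_fps_expansion_cong[OF ev refl] by simp
  moreover have "(\<lambda>r. (r * (1 - r\<^sup>2) + c * (1 + r\<^sup>2) - 2 * s * r) * E r) has_fps_expansion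
      (fps_X * (1 - fps_X\<^sup>2) + fps_const c * (1 + fps_X\<^sup>2) - 2 * fps_const s * fps_X) * P"
    by (intro fps_expansion_intros P)
  ultimately have odeP: "fps_deriv P * (1 - fps_X\<^sup>2)\<^sup>2
      = (fps_X * (1 - fps_X\<^sup>2) + fps_const c * (1 + fps_X\<^sup>2) - 2 * fps_const s * fps_X) * P"
    by (rule fps_expansion_unique_complex)
  have P0: "fps_nth P 0 = fps_nth (mehler_fps x y) 0"
  proof -
    have "fps_nth (mehler_fps x y) 0 = of_real (exp (- x\<^sup>2) * exp (- y\<^sup>2))" by (simp add: mehler_fps_def)
    also have "exp (- x\<^sup>2) * exp (- y\<^sup>2) = exp (- (x\<^sup>2 + y\<^sup>2))" by (simp add: exp_add[symmetric])
    also have "complex_of_real \<dots> = E 0" by (simp add: E_def)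
    also have "\<dots> = fps_nth P 0" by (rule has_fps_expansion_imp_0_eq_fps_nth_0[OF P])
    finally show ?thesis ..
  qed
  have "P = mehler_fps x y"
    by (rule fps_linear_ode_unique[OF odeP _ _ P0])
       (use mehler_fps_ode[of x y] in \<open>auto simp: s_def c_def\<close>)
  with P have "E has_fps_expansion mehler_fps x y" by simp
  then have "(\<lambda>r. of_real K * E r) has_fps_expansion fps_const (of_real K) * mehler_fps x y"
    by (intro fps_expansion_intros)
  also have "fps_const (of_real K) * mehler_fps x y = Abs_fps (\<lambda>k. of_real (hermite_fun k x * hermite_fun k y))"
    by (rule fps_ext) (simp add: hermite_fun_mult mehler_fps_def K_def)
  finally show "(\<lambda>r. mehler r x y) has_fps_expansion Abs_fps (\<lambda>k. of_real (hermite_fun k x * hermite_fun k y))"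
    by (simp add: mE)
  show "(\<lambda>r. mehler r x y) holomorphic_on ball 0 1"
    unfolding mE by (intro holomorphic_intros hol)
qed

lemma hermite_mehler_sums:
  assumes "norm r < 1"
  shows "(\<lambda>k. of_real (hermite_fun k x * hermite_fun k y) * r ^ k) sums mehler r x y"
  using has_fps_expansion_imp_sums_complex[OF mehler_has_fps_expansion, of x y "ereal 1" r] holomorphic_on_mehler assms
  by simp

text \<open>
  The modulus of the Mehler kernel. In the coordinates $x - y$ and $x + y$ its exponent is diagonal,
  with coefficients $\mathrm{Re}\,((1+r)/(1-r))/4$ and $\mathrm{Re}\,((1-r)/(1+r))/4$.
\<close>

definition mehler_majorant :: "complex \<Rightarrow> real \<Rightarrow> real \<Rightarrow> real" where
  "mehler_majorant r x y = 1 / sqrt (pi * norm (1 - r) * norm (1 + r))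
     * exp (- (1 - (norm r)\<^sup>2) / 4 * ((x - y)\<^sup>2 / (norm (1 - r))\<^sup>2 + (x + y)\<^sup>2 / (norm (1 + r))\<^sup>2))"

lemma norm_mehler:
  assumes "norm r < 1"
  shows "norm (mehler r x y) = mehler_majorant r x y"
proof -
  have r: "1 - r \<noteq> 0" "1 + r \<noteq> 0" "1 - r\<^sup>2 \<noteq> 0"
    using assms one_minus_square_nonpos[OF assms] by (auto simp: add_eq_0_iff)
  have f: "1 - r\<^sup>2 = (1 - r) * (1 + r)" by algebra
  have "norm (exp (- Ln (1 - r\<^sup>2) / 2) / of_real (sqrt pi)) = exp (- ln (norm (1 - r\<^sup>2)) / 2) / sqrt pi"
    using r by (simp add: norm_divide)
  also have "exp (- ln (norm (1 - r\<^sup>2)) / 2) = 1 / sqrt (norm (1 - r\<^sup>2))"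
  proof -
    have "ln (sqrt (norm (1 - r\<^sup>2))) = ln (norm (1 - r\<^sup>2)) / 2" using r by (simp add: ln_sqrt)
    then have "exp (- ln (norm (1 - r\<^sup>2)) / 2) = exp (- ln (sqrt (norm (1 - r\<^sup>2))))" by simp
    also have "\<dots> = 1 / sqrt (norm (1 - r\<^sup>2))" using r by (simp add: exp_minus inverse_eq_divide)
    finally show ?thesis .
  qed
  finally have 1: "norm (exp (- Ln (1 - r\<^sup>2) / 2) / of_real (sqrt pi)) = 1 / sqrt (pi * norm (1 - r) * norm (1 + r))"
    by (simp add: f norm_mult real_sqrt_mult)
  define A B where "A = (1 + r) / (1 - r)" and "B = (1 - r) / (1 + r)"
  have e: "- of_real (x\<^sup>2 + y\<^sup>2) / 2 + (2 * r * of_real (x * y) - r\<^sup>2 * of_real (x\<^sup>2 + y\<^sup>2)) / (1 - r\<^sup>2)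
      = - (of_real ((x - y)\<^sup>2) * A + of_real ((x + y)\<^sup>2) * B) / 4"
  proof -
    have "- S / 2 + X / u = (- S * u + 2 * X) / (2 * u)" if "u \<noteq> 0" for S X u :: complex
      using that by (simp add: field_simps)
    from this[OF r(3)] have "- of_real (x\<^sup>2 + y\<^sup>2) / 2 + (2 * r * of_real (x * y) - r\<^sup>2 * of_real (x\<^sup>2 + y\<^sup>2)) / (1 - r\<^sup>2)
       = (- of_real (x\<^sup>2 + y\<^sup>2) * (1 - r\<^sup>2) + 2 * (2 * r * of_real (x * y) - r\<^sup>2 * of_real (x\<^sup>2 + y\<^sup>2))) / (2 * (1 - r\<^sup>2))"
      .
    also have "- of_real (x\<^sup>2 + y\<^sup>2) * (1 - r\<^sup>2) + 2 * (2 * r * of_real (x * y) - r\<^sup>2 * of_real (x\<^sup>2 + y\<^sup>2))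
       = - (of_real ((x - y)\<^sup>2) * (1 + r)\<^sup>2 + of_real ((x + y)\<^sup>2) * (1 - r)\<^sup>2) / 2"
      by (simp add: power2_eq_square field_simps)
    also have "\<dots> / (2 * (1 - r\<^sup>2)) = - (of_real ((x - y)\<^sup>2) * ((1 + r)\<^sup>2 / (1 - r\<^sup>2)) + of_real ((x + y)\<^sup>2) * ((1 - r)\<^sup>2 / (1 - r\<^sup>2))) / 4"
    proof -
      have "- (p * P + q * Q) / 2 / (2 * u) = - (p * (P / u) + q * (Q / u)) / 4" if "u \<noteq> 0" for p q P Q u :: complex
        using that by (simp add: field_simps)
      from this[OF r(3)] show ?thesis .
    qed
    also have "(1 + r)\<^sup>2 / (1 - r\<^sup>2) = A" using r unfolding A_def f by (simp add: power2_eq_square)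
    also have "(1 - r)\<^sup>2 / (1 - r\<^sup>2) = B" using r unfolding B_def f by (simp add: power2_eq_square)
    finally show ?thesis .
  qed
  have n: "(norm r)\<^sup>2 = (Re r)\<^sup>2 + (Im r)\<^sup>2" by (rule cmod_power2)
  have A: "Re A = (1 - (norm r)\<^sup>2) / (norm (1 - r))\<^sup>2" unfolding A_def n Re_divide cmod_power2[of "1 - r"]
    by (simp add: power2_eq_square algebra_simps)
  have B: "Re B = (1 - (norm r)\<^sup>2) / (norm (1 + r))\<^sup>2" unfolding B_def n Re_divide cmod_power2[of "1 + r"]
    by (simp add: power2_eq_square algebra_simps)
  have "norm (exp (- of_real (x\<^sup>2 + y\<^sup>2) / 2 + (2 * r * of_real (x * y) - r\<^sup>2 * of_real (x\<^sup>2 + y\<^sup>2)) / (1 - r\<^sup>2)))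
      = exp (- (1 - (norm r)\<^sup>2) / 4 * ((x - y)\<^sup>2 / (norm (1 - r))\<^sup>2 + (x + y)\<^sup>2 / (norm (1 + r))\<^sup>2))"
  proof -
    have "Re (- (of_real a * A + of_real b * B) / 4) = - (1 - (norm r)\<^sup>2) / 4 * (a / (norm (1 - r))\<^sup>2 + b / (norm (1 + r))\<^sup>2)" for a b
    proof -
      have "- (a * (N / p) + b * (N / q)) / 4 = - N / 4 * (a / p + b / q)" for N p q :: real
        by (simp add: distrib_left mult.commute)
      from this[of "1 - (norm r)\<^sup>2" "(norm (1 - r))\<^sup>2" "(norm (1 + r))\<^sup>2"]
      show ?thesis unfolding A[symmetric] B[symmetric] by simp
    qed
    then show ?thesis unfolding e norm_exp_eq_Re by (rule arg_cong)
  qed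
  with 1 show ?thesis unfolding mehler_def mehler_majorant_def norm_mult by simp
qed

section \<open>The Mehler kernel in a Stolz angle\<close>

text \<open>
  A sector around the positive axis is mapped by $z \mapsto e^{-2z}$ into a Stolz angle at $1$: with
  $z = a + ib$ the radial part of $1 - e^{-2z}$ is $1 - e^{-2a}$ and the angular part is at most
  $2|b|e^{-2a} \le \kappa (1 - e^{-2a})$.
\<close>

lemma stolz_exp:
  assumes z: "\<bar>Im z\<bar> \<le> \<kappa> * Re z" "0 < Re z" and \<kappa>: "0 \<le> \<kappa>"
  shows "norm (1 - exp (- 2 * z)) \<le> (1 + \<kappa>) * (1 - norm (exp (- 2 * z)))"
proof -
  define a b where "a = Re z" and "b = Im z"
  define e where "e = exp (- 2 * a)"
  have n: "norm (exp (- 2 * z)) = e" by (simp add: norm_exp_eq_Re e_def a_def)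
  have "- 2 * z = of_real (- 2 * a) + \<i> * of_real (- 2 * b)" by (simp add: a_def b_def complex_eq_iff)
  then have "exp (- 2 * z) = of_real e * exp (\<i> * of_real (- 2 * b))"
    by (simp only: exp_add exp_of_real e_def)
  then have "1 - exp (- 2 * z) = of_real (1 - e) - of_real e * (exp (\<i> * of_real (- 2 * b)) - 1)"
    by (simp add: algebra_simps)
  then have "norm (1 - exp (- 2 * z)) \<le> norm (complex_of_real (1 - e)) + norm (of_real e * (exp (\<i> * of_real (- 2 * b)) - 1))"
    by (metis norm_triangle_ineq4)
  also have "norm (complex_of_real (1 - e)) = 1 - e" using z by (simp add: e_def a_def norm_of_real del: of_real_diff)
  also have "norm (of_real e * (exp (\<i> * of_real (- 2 * b)) - 1)) \<le> e * (2 * \<bar>b\<bar>)"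
    unfolding norm_mult dist_exp_i_1 using abs_sin_x_le_abs_x[of b] by (simp add: e_def)
  also have "e * (2 * \<bar>b\<bar>) \<le> e * (2 * (\<kappa> * a))" using z by (simp add: e_def a_def b_def)
  also have "\<dots> = \<kappa> * (e * (2 * a))" by simp
  also have "e * (2 * a) \<le> 1 - e"
  proof -
    have "e * (1 + 2 * a) \<le> e * exp (2 * a)" by (intro mult_left_mono exp_ge_add_one_self) (simp add: e_def)
    also have "\<dots> = 1" by (simp add: e_def exp_add[symmetric])
    finally show ?thesis by (simp add: algebra_simps)
  qed
  finally have "norm (1 - exp (- 2 * z)) \<le> 1 - e + \<kappa> * (1 - e)" using \<kappa> by (simp add: mult_left_mono)
  then show ?thesis by (simp only: n distrib_right mult_1)
qed

text \<open>
  In a Stolz angle at $1$ the point $r$ stays away from $-1$.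
\<close>

lemma stolz_one_plus:
  fixes r :: complex
  assumes "norm r < 1" "norm (1 - r) \<le> L * (1 - norm r)" "0 \<le> L"
  shows "2 \<le> (1 + L) * norm (1 + r)"
proof -
  have a: "2 \<le> norm (1 + r) + norm (1 - r)"
    using norm_triangle_ineq[of "1 + r" "1 - r"] by simp
  have b: "1 - norm r \<le> norm (1 + r)"
    using norm_triangle_ineq4[of "1 + r" r] by simp
  have "norm (1 - r) \<le> L * norm (1 + r)"
    using assms(2) mult_left_mono[OF b assms(3)] by linarith
  with a show ?thesis by (simp add: algebra_simps)
qed

lemma nn_integral_gauss:
  fixes a m :: real
  assumes a: "0 < a"
  shows "(\<integral>\<^sup>+y. ennreal (exp (- a * (y - m)\<^sup>2)) \<partial>lborel) = ennreal (sqrt (pi / a))"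
proof -
  define \<sigma> where "\<sigma> = 1 / sqrt (2 * a)"
  have \<sigma>: "\<sigma> > 0" and \<sigma>2: "2 * \<sigma>\<^sup>2 = 1 / a" using a by (simp_all add: \<sigma>_def power_divide)
  have "exp (- a * (y - m)\<^sup>2) = sqrt (pi / a) * normal_density m \<sigma> y" for y
  proof -
    have "2 * pi * \<sigma>\<^sup>2 = pi / a" using \<sigma>2 by (simp add: field_simps)
    moreover have "- (y - m)\<^sup>2 / (2 * \<sigma>\<^sup>2) = - a * (y - m)\<^sup>2" unfolding \<sigma>2 using a by (simp add: field_simps)
    ultimately show ?thesis using a by (simp add: normal_density_def)
  qed
  then have "(\<integral>\<^sup>+y. ennreal (exp (- a * (y - m)\<^sup>2)) \<partial>lborel)
      = (\<integral>\<^sup>+y. ennreal (sqrt (pi / a)) * ennreal (normal_density m \<sigma> y) \<partial>lborel)"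
    using a by (simp add: ennreal_mult normal_density_nonneg)
  also have "\<dots> = ennreal (sqrt (pi / a)) * (\<integral>\<^sup>+y. ennreal (normal_density m \<sigma> y) \<partial>lborel)"
    by (rule nn_integral_cmult) measurable
  also have "(\<integral>\<^sup>+y. ennreal (normal_density m \<sigma> y) \<partial>lborel) = 1"
    using \<sigma> by (simp add: nn_integral_eq_integral normal_density_nonneg)
  finally show ?thesis by simp
qed

text \<open>
  Completing the square in $y$ leaves a Gaussian in $x$ with coefficient $4ab/(a+b)$.
\<close>

lemma nn_integral_gauss2:
  fixes a b :: real
  assumes a: "0 < a" and b: "0 < b"
  shows "(\<integral>\<^sup>+x. \<integral>\<^sup>+y. ennreal (exp (- a * (x - y)\<^sup>2 - b * (x + y)\<^sup>2)) \<partial>lborel \<partial>lborel) = ennreal (pi / (2 * sqrt (a * b)))"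
proof -
  define m c where "m = (a - b) / (a + b)" and "c = 4 * a * b / (a + b)"
  have c: "c > 0" using a b by (simp add: c_def)
  have e: "- a * (x - y)\<^sup>2 - b * (x + y)\<^sup>2 = - (a + b) * (y - m * x)\<^sup>2 + - c * (x - 0)\<^sup>2" for x y
  proof -
    have m: "(a + b) * m = a - b" using a b by (simp add: m_def)
    have c: "c = (a + b) - (a - b) * m"
      using a b by (simp add: m_def c_def field_simps) (simp add: power2_eq_square algebra_simps)?
    show ?thesis unfolding c using m by algebra
  qed
  have "(\<integral>\<^sup>+x. \<integral>\<^sup>+y. ennreal (exp (- a * (x - y)\<^sup>2 - b * (x + y)\<^sup>2)) \<partial>lborel \<partial>lborel)
     = (\<integral>\<^sup>+x. \<integral>\<^sup>+y. ennreal (exp (- c * (x - 0)\<^sup>2)) * ennreal (exp (- (a + b) * (y - m * x)\<^sup>2)) \<partial>lborel \<partial>lborel)"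
    unfolding e exp_add by (simp add: ennreal_mult mult.commute)
  also have "\<dots> = (\<integral>\<^sup>+x. ennreal (exp (- c * (x - 0)\<^sup>2)) * ennreal (sqrt (pi / (a + b))) \<partial>lborel)"
  proof (rule nn_integral_cong)
    fix x :: real
    have "(\<integral>\<^sup>+y. ennreal (exp (- c * (x - 0)\<^sup>2)) * ennreal (exp (- (a + b) * (y - m * x)\<^sup>2)) \<partial>lborel)
       = ennreal (exp (- c * (x - 0)\<^sup>2)) * (\<integral>\<^sup>+y. ennreal (exp (- (a + b) * (y - m * x)\<^sup>2)) \<partial>lborel)"
      by (rule nn_integral_cmult) measurable
    then show "(\<integral>\<^sup>+y. ennreal (exp (- c * (x - 0)\<^sup>2)) * ennreal (exp (- (a + b) * (y - m * x)\<^sup>2)) \<partial>lborel)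
       = ennreal (exp (- c * (x - 0)\<^sup>2)) * ennreal (sqrt (pi / (a + b)))"
      using a b by (subst (asm) nn_integral_gauss) auto
  qed
  also have "\<dots> = (\<integral>\<^sup>+x. ennreal (exp (- c * (x - 0)\<^sup>2)) \<partial>lborel) * ennreal (sqrt (pi / (a + b)))"
    by (rule nn_integral_multc) measurable
  also have "\<dots> = ennreal (sqrt (pi / c) * sqrt (pi / (a + b)))"
    by (subst nn_integral_gauss[OF c]) (use a b c in \<open>simp add: ennreal_mult\<close>)
  also have "sqrt (pi / c) * sqrt (pi / (a + b)) = sqrt (pi\<^sup>2 / (4 * (a * b)))"
  proof -
    have "pi / c * (pi / (a + b)) = pi\<^sup>2 / (4 * (a * b))"
      using a b by (simp add: c_def power2_eq_square)
    then show ?thesis unfolding real_sqrt_mult[symmetric] by (rule arg_cong)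
  qed
  also have "\<dots> = pi / (2 * sqrt (a * b))"
    by (simp add: real_sqrt_divide real_sqrt_mult)
  finally show ?thesis .
qed

lemma mehler_majorant_nonneg: "0 \<le> mehler_majorant r x y"
  by (simp add: mehler_majorant_def)

lemma mehler_majorant_measurable[measurable]:
  "(\<lambda>z. mehler_majorant (f z) (g z) (h z)) \<in> borel_measurable M"
  if [measurable]: "f \<in> borel_measurable M" "g \<in> borel_measurable M" "h \<in> borel_measurable M"
  unfolding mehler_majorant_def by measurable

lemma mehler_majorant_commute: "mehler_majorant r x y = mehler_majorant r y x"
  by (simp add: mehler_majorant_def power2_commute add.commute)

text \<open>
  Points of the Stolz angle at $1$ with aperture \<open>L\<close>. There $|1-r|$ and $1-|r|$ are
  comparable, which is what keeps the row integrals of the complex-time kernel bounded.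
\<close>

locale stolz_point =
  fixes r :: complex and L :: real
  assumes r1: "norm r < 1" and stolz: "norm (1 - r) \<le> L * (1 - norm r)" and L: "0 \<le> L"
begin

lemma pos: "0 < norm (1 - r)" "0 < norm (1 + r)" "0 < 1 - norm r" "0 < 1 - (norm r)\<^sup>2"
  using r1 by (auto simp: add_eq_0_iff power_less_one_iff)

lemma majorant_le: "mehler_majorant r x y \<le> 1 / sqrt (pi * norm (1 - r) * norm (1 + r))
     * exp (- ((1 - (norm r)\<^sup>2) / (4 * (norm (1 - r))\<^sup>2)) * (y - x)\<^sup>2)"
proof -
  have e: "- ((1 - (norm r)\<^sup>2) / (4 * (norm (1 - r))\<^sup>2)) * (y - x)\<^sup>2 = - (1 - (norm r)\<^sup>2) / 4 * ((x - y)\<^sup>2 / (norm (1 - r))\<^sup>2)"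
  proof -
    have "- (N / (4 * p)) * q = - N / 4 * (q / p)" for N p q :: real by simp
    then show ?thesis unfolding power2_commute[of y x] .
  qed
  show ?thesis unfolding mehler_majorant_def e
    using pos by (intro mult_left_mono iffD2[OF exp_le_cancel_iff] mult_left_mono_neg) auto
qed

text \<open>
  The Gaussian in $x - y$ has mass $2 (|1-r| / (|1+r| (1-|r|^2)))^{1/2}$, and in a Stolz angle
  $|1-r| \le L (1-|r|)$ cancels the small denominator.
\<close>

lemma majorant_row: "(\<integral>\<^sup>+y. ennreal (mehler_majorant r x y) \<partial>lborel) \<le> ennreal (2 * (1 + L))"
proof -
  define u v w where "u = norm (1 - r)" and "v = norm (1 + r)" and "w = norm r"
  have p: "u > 0" "v > 0" "w < 1" "0 \<le> w" "1 - w\<^sup>2 > 0" using pos r1 by (auto simp: u_def v_def w_def)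
  define a where "a = (1 - w\<^sup>2) / (4 * u\<^sup>2)"
  have a: "a > 0" using p by (simp add: a_def)
  have "(\<integral>\<^sup>+y. ennreal (mehler_majorant r x y) \<partial>lborel) \<le> (\<integral>\<^sup>+y. ennreal (1 / sqrt (pi * u * v)) * ennreal (exp (- a * (y - x)\<^sup>2)) \<partial>lborel)"
    unfolding a_def u_def v_def w_def using majorant_le pos
    by (intro nn_integral_mono) (auto simp: ennreal_mult[symmetric] intro!: ennreal_leI simp del: exp_le_cancel_iff)
  also have "\<dots> = ennreal (1 / sqrt (pi * u * v) * sqrt (pi / a))"
    using a p by (subst nn_integral_cmult, measurable, subst nn_integral_gauss) (auto simp: ennreal_mult[symmetric])
  also have "1 / sqrt (pi * u * v) * sqrt (pi / a) = sqrt (4 * (u / (v * (1 - w\<^sup>2))))"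
  proof -
    have "1 / sqrt X * sqrt Y = sqrt (Y / X)" for X Y by (simp add: real_sqrt_divide)
    then have "1 / sqrt (pi * u * v) * sqrt (pi / a) = sqrt (pi / a / (pi * u * v))" .
    also have "pi / a / (pi * u * v) = 4 * (u / (v * (1 - w\<^sup>2)))"
      using p by (simp add: a_def power2_eq_square[of u])
    finally show ?thesis .
  qed
  also have "\<dots> \<le> sqrt (4 * (1 + L)\<^sup>2)"
  proof (intro iffD2[OF real_sqrt_le_iff] mult_left_mono)
    have "u \<le> L * (1 - w)" using stolz by (simp add: u_def w_def)
    also have "\<dots> \<le> L * (1 - w\<^sup>2)" using p L by (intro mult_left_mono) (auto simp: power2_eq_square mult_left_le)
    also have "\<dots> \<le> (1 + L) * (1 - w\<^sup>2)" using p by (intro mult_right_mono) auto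
    finally have 1: "u \<le> (1 + L) * (1 - w\<^sup>2)" .
    have "1 \<le> (1 + L) * v" using stolz_one_plus[OF r1 stolz L] by (simp add: v_def)
    then have "(1 + L) * (1 - w\<^sup>2) * 1 \<le> (1 + L) * (1 - w\<^sup>2) * ((1 + L) * v)"
      using p L by (intro mult_left_mono) auto
    with 1 have "u \<le> (1 + L)\<^sup>2 * (v * (1 - w\<^sup>2))" by (simp add: power2_eq_square mult_ac)
    then show "u / (v * (1 - w\<^sup>2)) \<le> (1 + L)\<^sup>2" using p by (simp add: pos_divide_le_eq)
  qed auto
  also have "sqrt (4 * (1 + L)\<^sup>2) = 2 * (1 + L)" using L by (simp add: real_sqrt_mult)
  finally show ?thesis by (simp add: ennreal_leI)
qed

lemma majorant_sup: "mehler_majorant r x y \<le> 8 * sqrt ((1 + L) / (1 - norm r))"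
proof -
  define u v w where "u = norm (1 - r)" and "v = norm (1 + r)" and "w = norm r"
  have p: "u > 0" "v > 0" "w < 1" "0 \<le> w" "1 - w\<^sup>2 > 0" using pos r1 by (auto simp: u_def v_def w_def)
  have "mehler_majorant r x y \<le> 1 / sqrt (pi * u * v) * exp (- ((1 - w\<^sup>2) / (4 * u\<^sup>2)) * (y - x)\<^sup>2)"
    using majorant_le by (simp add: u_def v_def w_def)
  also have "\<dots> \<le> 1 / sqrt (pi * u * v) * 1" using p by (intro mult_left_mono) auto
  also have "\<dots> = sqrt (1 / (pi * u * v))" by (simp add: real_sqrt_divide)
  also have "\<dots> \<le> sqrt ((1 + L) / (1 - w))"
  proof (intro iffD2[OF real_sqrt_le_iff])
    have u: "1 - w \<le> u" using norm_triangle_ineq4[of 1 "1 - r"] unfolding u_def w_def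
      by (metis norm_one norm_triangle_ineq2)
    have v: "1 \<le> (1 + L) * v" using stolz_one_plus[OF r1 stolz L] by (simp add: v_def)
    have "1 * (1 - w) \<le> ((1 + L) * v) * u" using p v u by (intro mult_mono) auto
    also have "\<dots> \<le> ((1 + L) * v * u) * pi"
      using p L pi_ge_two mult_left_mono[of 1 pi "(1 + L) * v * u"] by simp
    finally show "1 / (pi * u * v) \<le> (1 + L) / (1 - w)" using p by (simp add: field_simps)
  qed
  also have "\<dots> \<le> 8 * sqrt ((1 + L) / (1 - norm r))" using p L by (simp add: w_def)
  finally show ?thesis .
qed

text \<open>
  Integrating the Gaussian in both diagonal directions gives $2 (\pi |1-r| |1+r|)^{1/2} /
  (1-|r|^2)$; one half of the singularity of the denominator is cancelled by $|1-r|$.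
\<close>

lemma majorant_mass: "(\<integral>\<^sup>+x. \<integral>\<^sup>+y. ennreal (mehler_majorant r x y) \<partial>lborel \<partial>lborel) \<le> ennreal (8 * sqrt ((1 + L) / (1 - norm r)))"
proof -
  define u v w where "u = norm (1 - r)" and "v = norm (1 + r)" and "w = norm r"
  have p: "u > 0" "v > 0" "w < 1" "0 \<le> w" "1 - w\<^sup>2 > 0" using pos r1 by (auto simp: u_def v_def w_def)
  define a b where "a = (1 - w\<^sup>2) / (4 * u\<^sup>2)" and "b = (1 - w\<^sup>2) / (4 * v\<^sup>2)"
  have ab: "a > 0" "b > 0" using p by (simp_all add: a_def b_def)
  have "mehler_majorant r x y = 1 / sqrt (pi * u * v) * exp (- a * (x - y)\<^sup>2 - b * (x + y)\<^sup>2)" for x y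
  proof -
    have "- (1 - w\<^sup>2) / 4 * ((x - y)\<^sup>2 / u\<^sup>2 + (x + y)\<^sup>2 / v\<^sup>2) = - a * (x - y)\<^sup>2 - b * (x + y)\<^sup>2"
    proof -
      have "- N / 4 * (p / U + q / V) = - (N / (4 * U)) * p - (N / (4 * V)) * q" for N p q U V :: real
        by (cases "U = 0"; cases "V = 0"; simp add: field_simps)
      then show ?thesis unfolding a_def b_def .
    qed
    then show ?thesis unfolding mehler_majorant_def u_def[symmetric] v_def[symmetric] w_def[symmetric] by (rule arg_cong)
  qed
  then have "(\<integral>\<^sup>+x. \<integral>\<^sup>+y. ennreal (mehler_majorant r x y) \<partial>lborel \<partial>lborel)
     = (\<integral>\<^sup>+x. \<integral>\<^sup>+y. ennreal (1 / sqrt (pi * u * v)) * ennreal (exp (- a * (x - y)\<^sup>2 - b * (x + y)\<^sup>2)) \<partial>lborel \<partial>lborel)"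
    using p by (simp add: ennreal_mult[symmetric])
  also have "\<dots> = (\<integral>\<^sup>+x. ennreal (1 / sqrt (pi * u * v)) * (\<integral>\<^sup>+y. ennreal (exp (- a * (x - y)\<^sup>2 - b * (x + y)\<^sup>2)) \<partial>lborel) \<partial>lborel)"
    by (intro nn_integral_cong nn_integral_cmult) measurable
  also have "\<dots> = ennreal (1 / sqrt (pi * u * v)) * (\<integral>\<^sup>+x. \<integral>\<^sup>+y. ennreal (exp (- a * (x - y)\<^sup>2 - b * (x + y)\<^sup>2)) \<partial>lborel \<partial>lborel)"
    by (intro nn_integral_cmult) measurable
  also have "\<dots> = ennreal (1 / sqrt (pi * u * v) * (pi / (2 * sqrt (a * b))))"
    using ab p by (subst nn_integral_gauss2) (auto simp: ennreal_mult[symmetric])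
  also have "1 / sqrt (pi * u * v) * (pi / (2 * sqrt (a * b))) = 2 * sqrt (pi * (u * v) / (1 - w\<^sup>2)\<^sup>2)"
  proof -
    have "a * b = ((1 - w\<^sup>2) / (4 * (u * v)))\<^sup>2" by (simp add: a_def b_def power2_eq_square)
    then have "sqrt (a * b) = (1 - w\<^sup>2) / (4 * (u * v))" using p by simp
    moreover have "1 / S * (pi / (2 * (W / (4 * X)))) = 2 * (pi * X / S) / W" for S W X :: real by simp
    ultimately have "1 / sqrt (pi * u * v) * (pi / (2 * sqrt (a * b))) = 2 * ((pi * (u * v)) / sqrt (pi * (u * v))) / (1 - w\<^sup>2)"
      by (simp only: mult.assoc)
    also have "(pi * (u * v)) / sqrt (pi * (u * v)) = sqrt (pi * (u * v))" using p by (simp add: real_div_sqrt)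
    finally show ?thesis using p by (simp add: real_sqrt_divide)
  qed
  also have "\<dots> \<le> 2 * sqrt (16 * ((1 + L) / (1 - w)))"
  proof (intro mult_left_mono iffD2[OF real_sqrt_le_iff])
    have v: "v \<le> 2" using norm_triangle_ineq[of 1 r] r1 by (simp add: v_def)
    have u: "u \<le> (1 + L) * (1 - w)" using stolz pos(3) by (simp add: u_def w_def algebra_simps)
    have "u * v \<le> ((1 + L) * (1 - w)) * 2" using u v p L by (intro mult_mono) auto
    from mult_mono[OF less_imp_le[OF pi_less_4] this] have "pi * (u * v) \<le> 4 * (((1 + L) * (1 - w)) * 2)" using p by simp
    also have "\<dots> \<le> 16 * ((1 + L) * (1 - w))" using p L by simp
    finally have 1: "pi * (u * v) \<le> 16 * ((1 + L) * (1 - w))" .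
    have "1 - w \<le> 1 - w\<^sup>2" using p by (simp add: power2_eq_square mult_left_le)
    then have 2: "(1 - w)\<^sup>2 \<le> (1 - w\<^sup>2)\<^sup>2" using p by (intro power_mono) auto
    have "pi * (u * v) / (1 - w\<^sup>2)\<^sup>2 \<le> 16 * ((1 + L) * (1 - w)) / (1 - w)\<^sup>2"
      using 1 2 p L by (intro frac_le) auto
    also have "\<dots> = 16 * ((1 + L) / (1 - w))" using p by (simp add: power2_eq_square)
    finally show "pi * (u * v) / (1 - w\<^sup>2)\<^sup>2 \<le> 16 * ((1 + L) / (1 - w))" .
  qed auto
  also have "2 * sqrt (16 * X) = 8 * sqrt X" for X by (simp add: real_sqrt_mult)
  finally show ?thesis by (simp add: ennreal_leI w_def)
qed

end

section \<open>Hermite functions and projection kernels in several variables\<close>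

no_notation fps_nth (infixl "$" 75)

text \<open>
  A single term of the Mehler series on the diagonal is at most its sum, so $h_k(s)^2 \rho^k$ is
  bounded by the Gaussian kernel. At $\rho = 1 - 1/(k+2)$ the factor $\rho^k$ is bounded below and
  the Gaussian decays on the scale $\sqrt k$, which costs a power of $k$ when it is replaced by a
  rational function.
\<close>

lemma hermite_fun_bound: "\<bar>hermite_fun k s\<bar> \<le> 7 * (real k + 2)\<^sup>2 / (1 + s\<^sup>2)"
proof -
  define n where "n = real k + 2"
  have n: "n \<ge> 2" by (simp add: n_def)
  define \<rho> where "\<rho> = 1 - 1 / n"
  have \<rho>: "0 < \<rho>" "\<rho> < 1" "1 - \<rho> = 1 / n" using n by (auto simp: \<rho>_def)
  have sums: "(\<lambda>j. hermite_fun j s * hermite_fun j s * \<rho> ^ j) sums Re (mehler (of_real \<rho>) s s)"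
    using sums_Re[OF hermite_mehler_sums[of "of_real \<rho>" s s]] \<rho> by (simp flip: of_real_mult of_real_power)
  have "hermite_fun k s * hermite_fun k s * \<rho> ^ k \<le> Re (mehler (of_real \<rho>) s s)"
    using sum_le_suminf[OF sums_summable[OF sums], of "{k}"] sums_unique[OF sums] \<rho> by simp
  also have "\<dots> \<le> norm (mehler (of_real \<rho>) s s)" by (rule complex_Re_le_cmod)
  also have "\<dots> = mehler_majorant (of_real \<rho>) s s" using \<rho> by (intro norm_mehler) simp
  also have "\<dots> = 1 / sqrt (pi * (1 - \<rho>) * (1 + \<rho>)) * exp (- ((1 - \<rho>) / (1 + \<rho>) * s\<^sup>2))"
  proof -
    have nn: "norm (1 - complex_of_real \<rho>) = 1 - \<rho>" "norm (1 + complex_of_real \<rho>) = 1 + \<rho>" "norm (complex_of_real \<rho>) = \<rho>"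
      using \<rho> by (metis abs_of_pos norm_of_real of_real_1 of_real_diff diff_gt_0_iff_gt,
        metis abs_of_pos norm_of_real of_real_1 of_real_add add_pos_pos zero_less_one, simp)
    have "- (1 - \<rho>\<^sup>2) / 4 * ((s + s)\<^sup>2 / (1 + \<rho>)\<^sup>2) = - ((1 - \<rho>) / (1 + \<rho>) * s\<^sup>2)"
      using \<rho> by (simp add: power2_eq_square divide_simps) algebra
    then show ?thesis unfolding mehler_majorant_def nn by simp
  qed
  also have "\<dots> \<le> n * exp (- (s\<^sup>2 / (2 * n)))"
  proof (intro mult_mono)
    have "1 / n \<le> pi * (1 - \<rho>) * (1 + \<rho>)"
    proof -
      have "1 * 1 \<le> pi * (1 + \<rho>)" using \<rho> pi_ge_two by (intro mult_mono) auto
      then have "(1 / n) * 1 \<le> (1 / n) * (pi * (1 + \<rho>))" using n by (intro mult_left_mono) auto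
      then show ?thesis unfolding \<rho>(3) by (simp add: mult_ac)
    qed
    then have "1 / sqrt (pi * (1 - \<rho>) * (1 + \<rho>)) \<le> 1 / sqrt (1 / n)"
      using n \<rho> by (intro divide_left_mono real_sqrt_le_mono mult_pos_pos) auto
    also have "\<dots> = sqrt n" using n by (simp add: real_sqrt_divide)
    also have "\<dots> \<le> n" using n sqrt_le_D[of n n] by (intro real_le_lsqrt) (auto simp: power2_eq_square)
    finally show "1 / sqrt (pi * (1 - \<rho>) * (1 + \<rho>)) \<le> n" .
    have "1 / (2 * n) * s\<^sup>2 \<le> (1 - \<rho>) / (1 + \<rho>) * s\<^sup>2"
      unfolding \<rho>(3) using n \<rho> by (intro mult_right_mono) (auto simp: divide_simps)
    then show "exp (- ((1 - \<rho>) / (1 + \<rho>) * s\<^sup>2)) \<le> exp (- (s\<^sup>2 / (2 * n)))" by simp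
  qed (use n in auto)
  also have "\<dots> \<le> n * (4 * n / (1 + s\<^sup>2))\<^sup>2"
  proof (intro mult_left_mono)
    have "(1 + s\<^sup>2) / (4 * n) \<le> 1 + s\<^sup>2 / (4 * n)" using n by (simp add: field_simps)
    also have "\<dots> \<le> exp (s\<^sup>2 / (4 * n))" by (rule exp_ge_add_one_self)
    finally have "exp (- (s\<^sup>2 / (4 * n))) \<le> 4 * n / (1 + s\<^sup>2)"
      using n by (simp add: exp_minus divide_simps add_pos_nonneg mult.commute)
    then have "(exp (- (s\<^sup>2 / (4 * n))))\<^sup>2 \<le> (4 * n / (1 + s\<^sup>2))\<^sup>2" by (intro power_mono) auto
    also have "(exp (- (s\<^sup>2 / (4 * n))))\<^sup>2 = exp (- (s\<^sup>2 / (2 * n)))" by (simp add: exp_double[symmetric])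
    finally show "exp (- (s\<^sup>2 / (2 * n))) \<le> (4 * n / (1 + s\<^sup>2))\<^sup>2" .
  qed (use n in auto)
  finally have 1: "(hermite_fun k s)\<^sup>2 * \<rho> ^ k \<le> n * (4 * n / (1 + s\<^sup>2))\<^sup>2" by (simp add: power2_eq_square)
  have 2: "1 \<le> 3 * \<rho> ^ k"
  proof -
    have k: "n - 1 = real k + 1" by (simp add: n_def)
    have "(1 + 1 / (n - 1)) ^ k \<le> exp (1 / (n - 1)) ^ k" using n by (intro power_mono exp_ge_add_one_self) auto
    also have "\<dots> = exp (real k / (n - 1))" by (simp add: exp_of_nat_mult[symmetric])
    also have "\<dots> \<le> exp 1" unfolding k by simp
    also have "\<dots> \<le> 3" by (rule exp_le)
    finally have "(1 + 1 / (n - 1)) ^ k * \<rho> ^ k \<le> 3 * \<rho> ^ k" using \<rho> by (intro mult_right_mono) auto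
    moreover have "(1 + 1 / (n - 1)) * \<rho> = 1" using n by (simp add: \<rho>_def field_simps)
    ultimately show ?thesis by (simp flip: power_mult_distrib)
  qed
  have "(hermite_fun k s)\<^sup>2 * 1 \<le> (hermite_fun k s)\<^sup>2 * (3 * \<rho> ^ k)" using 2 by (intro mult_left_mono) auto
  also have "\<dots> \<le> 3 * (n * (4 * n / (1 + s\<^sup>2))\<^sup>2)" using 1 by simp
  also have "\<dots> = 48 * n ^ 3 / (1 + s\<^sup>2)\<^sup>2" by (simp add: power_divide power_mult_distrib power2_eq_square power3_eq_cube)
  also have "\<dots> \<le> 49 * n ^ 4 / (1 + s\<^sup>2)\<^sup>2"
    using n power_increasing[of 3 4 n] by (intro divide_right_mono mult_mono) auto
  also have "\<dots> = (7 * n\<^sup>2 / (1 + s\<^sup>2))\<^sup>2" by (simp add: power_divide power_mult_distrib)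
  finally have "(hermite_fun k s)\<^sup>2 \<le> (7 * n\<^sup>2 / (1 + s\<^sup>2))\<^sup>2" by simp
  then have "\<bar>hermite_fun k s\<bar> \<le> \<bar>7 * n\<^sup>2 / (1 + s\<^sup>2)\<bar>" by (simp only: abs_le_square_iff)
  also have "\<bar>7 * n\<^sup>2 / (1 + s\<^sup>2)\<bar> = 7 * n\<^sup>2 / (1 + s\<^sup>2)" by (intro abs_of_nonneg divide_nonneg_nonneg) auto
  finally show ?thesis by (simp only: n_def)
qed

definition hermite_kernel :: "nat \<Rightarrow> real ^ 'n::finite \<Rightarrow> real ^ 'n \<Rightarrow> real" where
  "hermite_kernel k x y = (\<Sum>\<alpha> | (\<Sum>j\<in>UNIV. \<alpha> j) = k. hermite_Phi \<alpha> x * hermite_Phi \<alpha> y)"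

text \<open>
  Any bounded integrable weight of product form that dominates the Hermite functions up to powers of
  the index would do.
\<close>

definition decay_weight :: "real ^ 'n::finite \<Rightarrow> real" where
  "decay_weight x = (\<Prod>j\<in>UNIV. 1 / (1 + (x $ j)\<^sup>2))"

lemma hermite_Phi_bound:
  fixes x :: "real ^ 'n::finite"
  assumes "(\<Sum>j\<in>UNIV. \<alpha> j) = k"
  shows "\<bar>hermite_Phi \<alpha> x\<bar> \<le> (7 * (real k + 2)\<^sup>2) ^ CARD('n) * decay_weight x"
proof -
  have "\<bar>hermite_Phi \<alpha> x\<bar> = (\<Prod>j\<in>UNIV. \<bar>hermite_fun (\<alpha> j) (x $ j)\<bar>)" by (simp add: hermite_Phi_def abs_prod)
  also have "\<dots> \<le> (\<Prod>j\<in>UNIV. 7 * (real k + 2)\<^sup>2 * (1 / (1 + (x $ j)\<^sup>2)))"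
  proof (intro prod_mono conjI)
    fix j :: 'n
    have "\<alpha> j \<le> k" using assms member_le_sum[of j UNIV \<alpha>] by simp
    then have "7 * (real (\<alpha> j) + 2)\<^sup>2 / (1 + (x $ j)\<^sup>2) \<le> 7 * (real k + 2)\<^sup>2 / (1 + (x $ j)\<^sup>2)"
      by (intro divide_right_mono mult_left_mono power_mono) auto
    with hermite_fun_bound[of "\<alpha> j" "x $ j"]
    show "\<bar>hermite_fun (\<alpha> j) (x $ j)\<bar> \<le> 7 * (real k + 2)\<^sup>2 * (1 / (1 + (x $ j)\<^sup>2))" by simp
  qed auto
  also have "\<dots> = (7 * (real k + 2)\<^sup>2) ^ CARD('n) * decay_weight x"
    unfolding prod.distrib decay_weight_def by simp
  finally show ?thesis .
qed

lemma card_multi_index_le: "card {\<alpha> :: 'n::finite \<Rightarrow> nat. (\<Sum>j\<in>UNIV. \<alpha> j) = k} \<le> (k + 1) ^ CARD('n)"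
proof -
  have "{\<alpha> :: 'n \<Rightarrow> nat. (\<Sum>j\<in>UNIV. \<alpha> j) = k} \<subseteq> PiE UNIV (\<lambda>_. {..k})"
    by (auto simp: PiE_def intro: member_le_sum)
  then have "card {\<alpha> :: 'n \<Rightarrow> nat. (\<Sum>j\<in>UNIV. \<alpha> j) = k} \<le> card (PiE (UNIV :: 'n set) (\<lambda>_. {..k}))"
    by (intro card_mono finite_PiE) auto
  also have "\<dots> = (k + 1) ^ CARD('n)" by (subst card_PiE) auto
  finally show ?thesis .
qed

lemma decay_weight_nonneg: "0 \<le> decay_weight x"
  unfolding decay_weight_def by (intro prod_nonneg) auto

lemma decay_weight_le_1: "decay_weight x \<le> 1"
  unfolding decay_weight_def by (intro prod_le_1) (auto simp: divide_simps add_pos_nonneg)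

lemma hermite_kernel_bound:
  fixes x y :: "real ^ 'n::finite"
  shows "\<bar>hermite_kernel k x y\<bar> \<le> 49 ^ CARD('n) * (real k + 2) ^ (5 * CARD('n)) * (decay_weight x * decay_weight y)"
proof -
  let ?b = "(7 * (real k + 2)\<^sup>2) ^ CARD('n)"
  have "\<bar>hermite_kernel k x y\<bar> \<le> (\<Sum>\<alpha> | (\<Sum>j\<in>UNIV. \<alpha> j) = k. \<bar>hermite_Phi \<alpha> x * hermite_Phi \<alpha> y\<bar>)"
    unfolding hermite_kernel_def by (rule sum_abs)
  also have "\<dots> \<le> (\<Sum>\<alpha> :: 'n \<Rightarrow> nat | (\<Sum>j\<in>UNIV. \<alpha> j) = k. (?b * decay_weight x) * (?b * decay_weight y))"
  proof (rule sum_mono)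
    fix \<alpha> :: "'n \<Rightarrow> nat" assume "\<alpha> \<in> {\<alpha>. (\<Sum>j\<in>UNIV. \<alpha> j) = k}"
    then have "(\<Sum>j\<in>UNIV. \<alpha> j) = k" by simp
    note b = hermite_Phi_bound[OF this]
    show "\<bar>hermite_Phi \<alpha> x * hermite_Phi \<alpha> y\<bar> \<le> (?b * decay_weight x) * (?b * decay_weight y)"
      unfolding abs_mult by (intro mult_mono b) (auto simp: decay_weight_nonneg)
  qed
  also have "\<dots> = real (card {\<alpha> :: 'n \<Rightarrow> nat. (\<Sum>j\<in>UNIV. \<alpha> j) = k}) * (?b * ?b * (decay_weight x * decay_weight y))"
    by (simp add: mult_ac)
  also have "\<dots> \<le> (real k + 2) ^ CARD('n) * (?b * ?b * (decay_weight x * decay_weight y))"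
  proof (intro mult_right_mono)
    have "real (card {\<alpha> :: 'n \<Rightarrow> nat. (\<Sum>j\<in>UNIV. \<alpha> j) = k}) \<le> real ((k + 1) ^ CARD('n))"
      using card_multi_index_le by (rule of_nat_mono)
    also have "\<dots> \<le> (real k + 2) ^ CARD('n)" unfolding of_nat_power by (intro power_mono) auto
    finally show "real (card {\<alpha> :: 'n \<Rightarrow> nat. (\<Sum>j\<in>UNIV. \<alpha> j) = k}) \<le> (real k + 2) ^ CARD('n)" .
  qed (auto simp: decay_weight_nonneg)
  also have "(real k + 2) ^ CARD('n) * (?b * ?b * (decay_weight x * decay_weight y))
    = 49 ^ CARD('n) * (real k + 2) ^ (5 * CARD('n)) * (decay_weight x * decay_weight y)"
  proof -
    have "(real k + 2) * (7 * (real k + 2)\<^sup>2) * (7 * (real k + 2)\<^sup>2) = 49 * (real k + 2) ^ 5"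
      by (simp add: power2_eq_square eval_nat_numeral)
    then have "((real k + 2) * (7 * (real k + 2)\<^sup>2) * (7 * (real k + 2)\<^sup>2)) ^ CARD('n) = (49 * (real k + 2) ^ 5) ^ CARD('n)" by simp
    then have "(real k + 2) ^ CARD('n) * (?b * ?b) = 49 ^ CARD('n) * (real k + 2) ^ (5 * CARD('n))"
      by (simp only: power_mult_distrib power_mult mult.assoc)
    then show ?thesis by (simp only: mult.assoc[symmetric])
  qed
  finally show ?thesis .
qed

text \<open>
  Mehler's formula in dimension $d$: multiplying the one-dimensional power series collects in degree
  \<open>k\<close> exactly the multi-indices of length \<open>k\<close>. The coefficients of a
  product of power series are indexed by multisets, which correspond to multi-indices through
  \<open>count\<close>.
\<close>

lemma hermite_kernel_sums:
  fixes x y :: "real ^ 'n::finite"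
  assumes r: "norm r < 1"
  shows "(\<lambda>k. of_real (hermite_kernel k x y) * r ^ k) sums (\<Prod>j\<in>UNIV. mehler r (x $ j) (y $ j))"
proof -
  define A where "A j = Abs_fps (\<lambda>k. complex_of_real (hermite_fun k (x $ j) * hermite_fun k (y $ j)))" for j
  have "(\<lambda>r. \<Prod>j\<in>UNIV. mehler r (x $ j) (y $ j)) has_fps_expansion (\<Prod>j\<in>UNIV. A j)"
    unfolding A_def by (intro fps_expansion_intros mehler_has_fps_expansion)
  moreover have "(\<lambda>r. \<Prod>j\<in>UNIV. mehler r (x $ j) (y $ j)) holomorphic_on ball 0 1"
    by (intro holomorphic_intros holomorphic_on_mehler)
  ultimately have "(\<lambda>k. fps_nth (\<Prod>j\<in>UNIV. A j) k * r ^ k) sums (\<Prod>j\<in>UNIV. mehler r (x $ j) (y $ j))"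
    using has_fps_expansion_imp_sums_complex[of _ _ "ereal 1" r] r by simp
  moreover have "fps_nth (\<Prod>j\<in>UNIV. A j) k = of_real (hermite_kernel k x y)" for k
  proof -
    have bij: "bij_betw count (multisets_of_size (UNIV :: 'n set) k) {\<alpha>. (\<Sum>j\<in>UNIV. \<alpha> j) = k}"
    proof (rule bij_betw_byWitness[where f' = Abs_multiset])
      have size: "size X = (\<Sum>j\<in>UNIV. count X j)" for X :: "'n multiset"
        unfolding size_multiset_overloaded_eq by (rule sum.mono_neutral_left) (auto simp: not_in_iff)
      have c: "count (Abs_multiset \<alpha>) = \<alpha>" for \<alpha> :: "'n \<Rightarrow> nat" by (rule count_Abs_multiset) simp
      show "count ` multisets_of_size (UNIV :: 'n set) k \<subseteq> {\<alpha>. (\<Sum>j\<in>UNIV. \<alpha> j) = k}"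
        by (auto simp: multisets_of_size_def size)
      show "Abs_multiset ` {\<alpha> :: 'n \<Rightarrow> nat. (\<Sum>j\<in>UNIV. \<alpha> j) = k} \<subseteq> multisets_of_size UNIV k"
        by (auto simp: multisets_of_size_def size c)
    qed (auto simp: count_inverse count_Abs_multiset)
    have "fps_nth (\<Prod>j\<in>UNIV. A j) k = (\<Sum>X\<in>multisets_of_size UNIV k. \<Prod>j\<in>UNIV. fps_nth (A j) (count X j))"
      by (rule fps_prod_nth') simp
    also have "\<dots> = (\<Sum>\<alpha> | (\<Sum>j\<in>UNIV. \<alpha> j) = k. \<Prod>j\<in>UNIV. fps_nth (A j) (\<alpha> j))"
      by (rule sum.reindex_bij_betw[OF bij, of "\<lambda>\<alpha>. \<Prod>j\<in>UNIV. fps_nth (A j) (\<alpha> j)"])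
    also have "\<dots> = of_real (hermite_kernel k x y)"
      by (simp add: A_def hermite_kernel_def hermite_Phi_def prod.distrib)
    finally show ?thesis .
  qed
  ultimately show ?thesis by simp
qed

lemma nn_integral_vec_prod:
  fixes f :: "'n::finite \<Rightarrow> real \<Rightarrow> ennreal"
  assumes [measurable]: "\<And>j. f j \<in> borel_measurable borel"
  shows "(\<integral>\<^sup>+x. (\<Prod>j\<in>UNIV. f j (x $ j)) \<partial>(lborel :: (real ^ 'n) measure)) = (\<Prod>j\<in>UNIV. \<integral>\<^sup>+s. f j s \<partial>lborel)"
proof -
  define ix where "ix b = (THE j. b = axis j (1::real))" for b :: "real ^ 'n"
  have ix: "ix (axis j 1) = j" for j by (simp add: ix_def axis_eq_axis)
  have B: "(Basis :: (real ^ 'n) set) = (\<lambda>j. axis j 1) ` UNIV" by (auto simp: Basis_vec_def)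
  have inj: "inj (\<lambda>j::'n. axis j (1::real))" by (auto simp: inj_on_def axis_eq_axis)
  have "(\<integral>\<^sup>+x. (\<Prod>b\<in>Basis. f (ix b) (x \<bullet> b)) \<partial>(lborel :: (real ^ 'n) measure)) = (\<Prod>b\<in>(Basis :: (real ^ 'n) set). \<integral>\<^sup>+s. f (ix b) s \<partial>lborel)"
    by (rule nn_integral_lborel_prod) auto
  then show ?thesis unfolding B prod.reindex[OF inj] by (simp add: ix inner_axis)
qed

lemma nn_integral_decay_weight:
  "(\<integral>\<^sup>+x. ennreal (decay_weight x) \<partial>(lborel :: (real ^ 'n::finite) measure)) = ennreal (pi ^ CARD('n))"
proof -
  have 1: "(\<integral>\<^sup>+s. ennreal (1 / (1 + s\<^sup>2)) \<partial>lborel) = ennreal pi"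
  proof -
    have "integrable lborel (\<lambda>s::real. 1 / (1 + s\<^sup>2))"
      using integrable_inverse_1_plus_square by (simp add: set_integrable_def einterval_def inverse_eq_divide)
    moreover have "(LINT s|lborel. 1 / (1 + s\<^sup>2)) = pi"
      using LBINT_inverse_1_plus_square
      by (simp add: interval_lebesgue_integral_def set_lebesgue_integral_def einterval_def inverse_eq_divide)
    ultimately show ?thesis by (subst nn_integral_eq_integral) (auto simp: add_nonneg_nonneg)
  qed
  have "(\<integral>\<^sup>+x. ennreal (decay_weight x) \<partial>(lborel :: (real ^ 'n) measure))
     = (\<integral>\<^sup>+x. (\<Prod>j\<in>UNIV. ennreal (1 / (1 + (x $ j)\<^sup>2))) \<partial>(lborel :: (real ^ 'n) measure))"
    unfolding decay_weight_def by (subst prod_ennreal) auto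
  also have "\<dots> = (\<Prod>j\<in>(UNIV :: 'n set). \<integral>\<^sup>+s. ennreal (1 / (1 + s\<^sup>2)) \<partial>lborel)"
    by (rule nn_integral_vec_prod) measurable
  also have "\<dots> = ennreal (pi ^ CARD('n))" by (simp add: 1 ennreal_power)
  finally show ?thesis .
qed

section \<open>Laplace integrals along a ray\<close>

text \<open>
  Cauchy's formula at \<open>l\<close> on the triangle with vertices $0$ and $R(1 \pm i\kappa)$. The
  reflection symmetry of \<open>f\<close> makes the integrals over the two bounding rays conjugate
  to each other, so that their difference is an imaginary part; the third side is the error term.
\<close>

lemma sector_Cauchy_estimate:
  fixes f :: "complex \<Rightarrow> complex" and \<kappa> l :: real
  defines "T \<equiv> {z. \<bar>Im z\<bar> \<le> \<kappa> * Re z}" and "b \<equiv> Complex 1 \<kappa>"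
  assumes \<kappa>: "0 < \<kappa>" and l: "0 < l"
    and cont: "continuous_on T f"
    and hol: "f holomorphic_on {z. \<bar>Im z\<bar> < \<kappa> * Re z}"
    and sym: "\<And>z. z \<in> T \<Longrightarrow> f (cnj z) = cnj (f z)"
    and R: "l < R" and B: "0 \<le> B" "\<And>z. z \<in> T \<Longrightarrow> Re z = R \<Longrightarrow> norm (f z) \<le> B"
  shows "\<bar>Re (f l) + Im (LINT r:{0..R}|lborel. f (r * b) * b / (r * b - l)) / pi\<bar> \<le> B / (R - l) * (\<kappa> * R)"
proof -
  have R0: "0 < R" using R l by simp
  have cvx: "convex T"
  proof -
    have "T = {z. Im z \<le> \<kappa> * Re z} \<inter> {z. - Im z \<le> \<kappa> * Re z}" by (auto simp: T_def abs_le_iff)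
    moreover have "convex {z. Im z \<le> \<kappa> * Re z}"
      using convex_halfspace_le[of "Complex (- \<kappa>) 1" 0] by (simp add: inner_complex_def algebra_simps)
    moreover have "convex {z. - Im z \<le> \<kappa> * Re z}"
      using convex_halfspace_le[of "Complex (- \<kappa>) (- 1)" 0] by (simp add: inner_complex_def algebra_simps)
    ultimately show ?thesis by (simp add: convex_Int)
  qed
  have int_sub: "interior T \<subseteq> {z. \<bar>Im z\<bar> < \<kappa> * Re z}"
  proof
    fix z assume "z \<in> interior T"
    then obtain e where e: "e > 0" "ball z e \<subseteq> T" by (meson interior_subset mem_interior)
    have "z - of_real (e / 2) \<in> ball z e" using e(1) by (simp add: dist_norm)
    then have "z - of_real (e / 2) \<in> T" using e(2) by blast
    then have "\<bar>Im z\<bar> \<le> \<kappa> * (Re z - e / 2)" by (simp add: T_def)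
    also have "\<dots> < \<kappa> * Re z" using \<kappa> e(1) by simp
    finally show "z \<in> {z. \<bar>Im z\<bar> < \<kappa> * Re z}" by simp
  qed
  have open_sector: "open {z. \<bar>Im z\<bar> < \<kappa> * Re z}"
    by (intro open_Collect_less continuous_intros)
  have lint: "complex_of_real l \<in> interior T"
    by (rule interiorI[OF open_sector]) (use \<kappa> l in \<open>auto simp: T_def\<close>)
  define p where "p = complex_of_real R * cnj b"
  define q where "q = complex_of_real R * b"
  have pq: "Re p = R" "Im p = - \<kappa> * R" "Re q = R" "Im q = \<kappa> * R" by (simp_all add: p_def q_def b_def)
  have PT: "0 \<in> T" "p \<in> T" "q \<in> T" using \<kappa> R0 by (simp_all add: T_def pq abs_mult)
  have segs: "closed_segment 0 p \<subseteq> T" "closed_segment p q \<subseteq> T" "closed_segment q 0 \<subseteq> T"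
    using PT cvx by (simp_all add: closed_segment_subset)
  \<comment> \<open>the point \<open>l\<close> lies inside the triangle and off its three sides\<close>
  have tri: "complex_of_real l \<in> interior (convex hull {0, p, q})"
  proof (rule interiorI[of "{z. \<bar>Im z\<bar> < \<kappa> * Re z} \<inter> {z. Re z < R}"])
    show "open ({z. \<bar>Im z\<bar> < \<kappa> * Re z} \<inter> {z. Re z < R})"
      using open_sector by (intro open_Int open_Collect_less continuous_intros)
    show "{z. \<bar>Im z\<bar> < \<kappa> * Re z} \<inter> {z. Re z < R} \<subseteq> convex hull {0, p, q}"
    proof
      fix z assume z: "z \<in> {z. \<bar>Im z\<bar> < \<kappa> * Re z} \<inter> {z. Re z < R}"
      define u v where "u = (Re z / R - Im z / (\<kappa> * R)) / 2" and "v = (Re z / R + Im z / (\<kappa> * R)) / 2"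
      have i: "\<bar>Im z\<bar> / (\<kappa> * R) \<le> Re z / R" using z \<kappa> R0 by (simp add: divide_simps mult_ac)
      have i': "\<bar>Im z / (\<kappa> * R)\<bar> \<le> Re z / R" using i \<kappa> R0 by (simp add: abs_mult)
      have uv: "0 \<le> u" "0 \<le> v"
      proof -
        have "0 \<le> (y - x) / 2 \<and> 0 \<le> (y + x) / 2" if "\<bar>x\<bar> \<le> y" for x y :: real using that by auto
        from this[OF i'] show "0 \<le> u" "0 \<le> v" by (simp_all only: u_def v_def)
      qed
      have "u + v = Re z / R" by (simp add: u_def v_def field_simps)
      also have "\<dots> \<le> 1" using z R0 by simp
      finally have 1: "u + v \<le> 1" .
      have "z = (1 - u - v) *\<^sub>R 0 + u *\<^sub>R p + v *\<^sub>R q"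
        using \<kappa> R0 by (auto simp: complex_eq_iff pq u_def v_def field_simps)
      then show "z \<in> convex hull {0, p, q}"
        unfolding convex_hull_3 using uv 1 by (intro CollectI exI[of _ "1 - u - v"] exI[of _ u] exI[of _ v]) auto
    qed
  qed (use \<kappa> l R in auto)
  then have off: "complex_of_real l \<notin> closed_segment 0 p" "complex_of_real l \<notin> closed_segment p q" "complex_of_real l \<notin> closed_segment q 0"
    using interior_of_triangle[of 0 p q] by (auto simp: closed_segment_commute)
  let ?\<gamma> = "linepath 0 p +++ linepath p q +++ linepath q 0"
  let ?h = "\<lambda>w. f w / (w - complex_of_real l)"
  have wn: "winding_number ?\<gamma> l = 1"
    using \<kappa> R0 l by (subst winding_number_triangle[OF tri]) (simp add: pq algebra_simps)
  have path: "path_image ?\<gamma> \<subseteq> T - {complex_of_real l}"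
    using segs off by (auto simp: path_image_join)
  have "(?h has_contour_integral (2 * pi * \<i> * winding_number ?\<gamma> l * f l)) ?\<gamma>"
    by (rule Cauchy_integral_formula_weak[OF cvx finite.emptyI cont _ _ _ path])
       (use lint int_sub hol open_sector in \<open>auto simp: holomorphic_on_open field_differentiable_def\<close>)
  then have cauchy: "contour_integral ?\<gamma> ?h = 2 * pi * \<i> * f l"
    unfolding wn by (simp add: contour_integral_unique)
  have chol: "continuous_on S ?h" if "S \<subseteq> T" "complex_of_real l \<notin> S" for S
    using that by (intro continuous_intros continuous_on_subset[OF cont]) auto
  have ci: "?h contour_integrable_on linepath 0 p" "?h contour_integrable_on linepath p q" "?h contour_integrable_on linepath q 0"
    using segs off by (auto intro!: contour_integrable_continuous_linepath chol)
  have split: "contour_integral ?\<gamma> ?h = contour_integral (linepath 0 p) ?h + contour_integral (linepath p q) ?h + contour_integral (linepath q 0) ?h"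
    using ci by (simp add: contour_integrable_joinI)
  define J where "J = (LINT r:{0..R}|lborel. f (r * b) * b / (r * b - l))"
  have bT: "complex_of_real r * b \<in> T" "complex_of_real r * b \<noteq> complex_of_real l" if "0 \<le> r" for r
    using that \<kappa> l by (auto simp: T_def b_def abs_mult complex_eq_iff)
  \<comment> \<open>the upper ray, rescaled from \<open>[0, 1]\<close> to \<open>[0, R]\<close>\<close>
  have up: "contour_integral (linepath 0 q) ?h = J"
  proof -
    let ?g = "\<lambda>t::real. f (complex_of_real (R * t) * b) / (complex_of_real (R * t) * b - l) * q"
    have "contour_integral (linepath 0 q) ?h = integral {0..1} ?g"
      by (simp add: contour_integral_integral linepath_def q_def scaleR_conv_of_real mult_ac)
    also have "\<dots> = (LINT t:{0..1}|lborel. ?g t)"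
    proof (rule set_borel_integral_eq_integral(2)[symmetric, OF borel_integrable_atLeastAtMost'])
      have "continuous_on {0..1} (\<lambda>t::real. f (complex_of_real (R * t) * b))"
        by (rule continuous_on_compose2[OF cont]) (use bT R0 in \<open>auto intro!: continuous_intros simp del: of_real_mult\<close>)
      then show "continuous_on {0..1} ?g"
        using bT R0 by (intro continuous_intros) (auto simp del: of_real_mult)
    qed
    also have "\<dots> = (LINT t|lborel. R *\<^sub>R (indicator {0..R} (0 + R * t) *\<^sub>R (f (complex_of_real (0 + R * t) * b) * b / (complex_of_real (0 + R * t) * b - l))))"
      unfolding set_lebesgue_integral_def
      by (rule Bochner_Integration.integral_cong)
         (use R0 in \<open>auto simp: indicator_def q_def scaleR_conv_of_real mult_le_cancel_left1 zero_le_mult_iff\<close>)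
    also have "\<dots> = \<bar>R\<bar> *\<^sub>R (LINT t|lborel. (indicator {0..R} (0 + R * t) *\<^sub>R (f (complex_of_real (0 + R * t) * b) * b / (complex_of_real (0 + R * t) * b - l))))"
      by (subst Bochner_Integration.integral_scaleR_right) (use R0 in auto)
    also have "\<dots> = J"
      unfolding J_def set_lebesgue_integral_def using R0
      by (subst lborel_integral_real_affine[where c = R and t = 0]) auto
    finally show ?thesis .
  qed
  have up': "contour_integral (linepath q 0) ?h = - J"
  proof -
    have "contour_integral (linepath q 0) ?h = - contour_integral (linepath 0 q) ?h"
      using segs off by (intro contour_integral_reverse_linepath chol) auto
    then show ?thesis by (simp add: up)
  qed
  have low: "contour_integral (linepath 0 p) ?h = cnj J"
  proof -
    have "contour_integral (linepath 0 p) ?h = integral {0..1} (\<lambda>t. cnj (f (linepath 0 q t) / (linepath 0 q t - l) * (q - 0)))"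
      unfolding contour_integral_integral vector_derivative_linepath_at
    proof (rule Henstock_Kurzweil_Integration.integral_cong)
      fix t :: real assume t: "t \<in> {0..1}"
      have 1: "linepath 0 p t = cnj (linepath 0 q t)" by (simp add: linepath_def p_def q_def)
      have 2: "linepath 0 q t \<in> T" using t segs(3) linepath_in_path[of t 0 q] by (auto simp: closed_segment_commute)
      show "f (linepath 0 p t) / (linepath 0 p t - complex_of_real l) * (p - 0) = cnj (f (linepath 0 q t) / (linepath 0 q t - l) * (q - 0))"
        unfolding 1 sym[OF 2] by (simp add: p_def q_def)
    qed
    also have "\<dots> = cnj (integral {0..1} (\<lambda>t. f (linepath 0 q t) / (linepath 0 q t - l) * (q - 0)))"
      by (rule integral_cnj[symmetric])
    also have "\<dots> = cnj (contour_integral (linepath 0 q) ?h)"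
      by (simp add: contour_integral_integral)
    finally show ?thesis by (simp add: up)
  qed
  define V where "V = contour_integral (linepath p q) ?h"
  have V: "norm V \<le> B / (R - l) * norm (q - p)"
    unfolding V_def
  proof (rule contour_integral_bound_linepath[OF ci(2)])
    fix w assume w: "w \<in> closed_segment p q"
    then obtain t where "w = (1 - t) *\<^sub>R p + t *\<^sub>R q" by (auto simp: closed_segment_def)
    then have "Re w = (1 - t) * R + t * R" by (simp add: pq)
    then have re: "Re w = R" by (simp add: algebra_simps)
    have "R - l \<le> norm (w - l)" using complex_Re_le_cmod[of "w - l"] re by simp
    then show "norm (?h w) \<le> B / (R - l)"
      unfolding norm_divide using B w segs re R by (intro frac_le) auto
  qed (use B R in auto)
  have "norm (q - p) = 2 * (\<kappa> * R)"
  proof -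
    have "q - p = \<i> * of_real (2 * (\<kappa> * R))" by (simp add: complex_eq_iff pq)
    then show ?thesis using \<kappa> R0 by (simp add: norm_mult)
  qed
  with V have "norm V \<le> B / (R - l) * (2 * (\<kappa> * R))" by (simp only:)
  also have "\<dots> = 2 * (B / (R - l) * (\<kappa> * R))" by (rule mult.left_commute)
  finally have V2: "norm V \<le> 2 * (B / (R - l) * (\<kappa> * R))" .
  have "2 * pi * \<i> * f l = cnj J - J + V"
    unfolding cauchy[symmetric] split up' low V_def[symmetric] by simp
  then have "Im (2 * pi * \<i> * f l) = Im (cnj J - J + V)" by simp
  then have "2 * pi * Re (f l) = - 2 * Im J + Im V" by simp
  then have "Re (f l) + Im J / pi = Im V / (2 * pi)" by (simp add: field_simps)
  then have "\<bar>Re (f l) + Im J / pi\<bar> = \<bar>Im V\<bar> / (2 * pi)" by (simp add: abs_divide)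
  also have "\<dots> \<le> \<bar>Im V\<bar> / 2" using pi_ge_two by (intro divide_left_mono) auto
  also have "\<dots> \<le> B / (R - l) * (\<kappa> * R)" using V2 abs_Im_le_cmod[of V] by linarith
  finally show ?thesis unfolding J_def .
qed

lemma exp_decay_integral_real:
  fixes x :: real
  assumes x: "0 < x"
  shows "set_integrable lborel {0<..} (\<lambda>t. exp (- (x * t)))"
    and "(LINT t:{0<..}|lborel. exp (- (x * t))) = 1 / x"
proof -
  interpret prob_space "density lborel (exponential_density x)"
    by (rule prob_space_exponential_density[OF x])
  have "(\<integral>\<^sup>+t. ennreal (exponential_density x t) \<partial>lborel) = 1"
    using emeasure_space_1 by (simp add: emeasure_density)
  then have "has_bochner_integral lborel (exponential_density x) 1"
    using x by (intro has_bochner_integral_nn_integral) (auto simp: exponential_density_nonneg)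
  then have *: "has_bochner_integral lborel (\<lambda>t. exponential_density x t / x) (1 / x)"
    by (intro has_bochner_integral_divide)
  have "has_bochner_integral lborel (\<lambda>t. indicator {0<..} t *\<^sub>R exp (- (x * t))) (1 / x)"
  proof (rule has_bochner_integral_cong_AE[THEN iffD1, OF _ _ _ *])
    show "AE t in lborel. exponential_density x t / x = indicator {0<..} t *\<^sub>R exp (- (x * t))"
      using AE_lborel_singleton[of 0]
      by eventually_elim (use x in \<open>auto simp: exponential_density_def indicator_def mult.commute\<close>)
  qed measurable
  then show "set_integrable lborel {0<..} (\<lambda>t. exp (- (x * t)))" "(LINT t:{0<..}|lborel. exp (- (x * t))) = 1 / x"
    unfolding set_integrable_def set_lebesgue_integral_def by (auto simp: has_bochner_integral_iff)
qed

text \<open>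
  The complex case follows by letting the upper limit tend to infinity in the fundamental theorem of
  calculus; absolute integrability comes from the real case.
\<close>

lemma exp_decay_integral:
  fixes a :: complex
  assumes a: "0 < Re a"
  shows "set_integrable lborel {0<..} (\<lambda>t. exp (- (a * of_real t)))"
    and "(LINT t:{0<..}|lborel. exp (- (a * of_real t))) = 1 / a"
proof -
  let ?g = "\<lambda>t::real. indicator {0<..} t *\<^sub>R exp (- (a * of_real t))"
  have int: "integrable lborel ?g"
    by (rule Bochner_Integration.integrable_bound[OF exp_decay_integral_real(1)[OF a, unfolded set_integrable_def]])
       (auto simp: norm_exp_eq_Re)
  then show "set_integrable lborel {0<..} (\<lambda>t. exp (- (a * of_real t)))"
    by (simp add: set_integrable_def)
  have "((\<lambda>y. LINT t|lborel. indicator {..y} t *\<^sub>R ?g t) \<longlongrightarrow> (LINT t|lborel. ?g t)) at_top"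
    by (rule tendsto_integral_at_top[OF _ int]) simp
  moreover have "((\<lambda>y. LINT t|lborel. indicator {..y} t *\<^sub>R ?g t) \<longlongrightarrow> 1 / a) at_top"
  proof (rule Lim_transform_eventually)
    have "((\<lambda>y. exp (- (Re a * y))) \<longlongrightarrow> 0) at_top" using a by real_asymp
    then have "((\<lambda>y. exp (- (a * of_real y))) \<longlongrightarrow> 0) at_top"
      by (intro tendsto_norm_zero_cancel[of "\<lambda>y. exp (- (a * of_real y))"]) (simp add: norm_exp_eq_Re)
    then have "((\<lambda>y. (1 - exp (- (a * of_real y))) / a) \<longlongrightarrow> (1 - 0) / a) at_top"
      by (intro tendsto_intros) (use a in auto)
    then show "((\<lambda>y. (1 - exp (- (a * of_real y))) / a) \<longlongrightarrow> 1 / a) at_top" by simp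
    show "\<forall>\<^sub>F y in at_top. (1 - exp (- (a * of_real y))) / a = (LINT t|lborel. indicator {..y} t *\<^sub>R ?g t)"
      using eventually_ge_at_top[of 0]
    proof eventually_elim
      case (elim y)
      have "(LINT t|lborel. indicator {..y} t *\<^sub>R ?g t) = (LINT t|lborel. indicator {0..y} t *\<^sub>R exp (- (a * of_real t)))"
        by (intro integral_cong_AE, measurable)
           (use AE_lborel_singleton[of 0] in \<open>eventually_elim, auto simp: indicator_def\<close>)
      also have "\<dots> = - exp (- (a * of_real y)) / a - (- exp (- (a * of_real 0)) / a)"
      proof (rule integral_FTC_Icc[OF elim])
        fix x
        have "((\<lambda>z. - exp (- (a * z)) / a) has_field_derivative exp (- (a * of_real x))) (at (of_real x))"
          using a by (auto intro!: derivative_eq_intros)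
        then show "((\<lambda>x. - exp (- (a * of_real x)) / a) has_vector_derivative exp (- (a * of_real x))) (at x within {0..y})"
          by (rule has_vector_derivative_real_field)
      qed (intro continuous_intros)
      finally show ?case by (simp add: diff_divide_distrib)
    qed
  qed
  ultimately show "(LINT t:{0<..}|lborel. exp (- (a * of_real t))) = 1 / a"
    unfolding set_lebesgue_integral_def by (rule tendsto_unique[rotated]) simp
qed

text \<open>
  Letting $R \to \infty$ in Cauchy's formula expresses $f(l)$ through $1/(rb - l)$ on the ray of
  direction \<open>b\<close>. The direction \<open>c\<close> is chosen with $\mathrm{Re}\, c > 0$
  and $\mathrm{Re}\, cb < 0$, so that $1/(l - rb) = c \int_0^\infty e^{-ct(l - rb)} dt$ converges
  absolutely; here $cb$ has real part $-1$. Interchanging the integrals gives the density $\rho(t) =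
  (bc/\pi) \int_0^\infty f(rb)\, e^{cbrt} dr$, and its $L^1$ norm is controlled by $\int_0^\infty
  |f(rb)|\, dr/r$, which explains the integrability hypothesis.
\<close>

lemma ray_laplace_representation:
  fixes f :: "complex \<Rightarrow> complex" and \<kappa> :: real and B :: "real \<Rightarrow> real"
  defines "T \<equiv> {z. \<bar>Im z\<bar> \<le> \<kappa> * Re z}" and "b \<equiv> Complex 1 \<kappa>" and "c \<equiv> Complex 1 (2 / \<kappa>)"
  assumes \<kappa>: "0 < \<kappa>"
    and cont: "continuous_on T f"
    and hol: "f holomorphic_on {z. \<bar>Im z\<bar> < \<kappa> * Re z}"
    and sym: "\<And>z. z \<in> T \<Longrightarrow> f (cnj z) = cnj (f z)"
    and B: "\<And>z. z \<in> T \<Longrightarrow> norm (f z) \<le> B (Re z)" and B0: "(B \<longlongrightarrow> 0) at_top"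
    and int: "set_integrable lborel {0<..} (\<lambda>r. f (of_real r * b) / of_real r)"
  obtains \<rho> :: "real \<Rightarrow> complex" where "integrable lborel \<rho>" "\<And>t. t \<le> 0 \<Longrightarrow> \<rho> t = 0"
    "\<And>l. 0 < l \<Longrightarrow> Re (f (complex_of_real l)) = Im (LINT t|lborel. \<rho> t * exp (- (c * t * l)))"
proof -
  have cb: "c * b = Complex (-1) (\<kappa> + 2 / \<kappa>)" using \<kappa> by (simp add: c_def b_def complex_eq_iff)
  have bT: "complex_of_real r * b \<in> T" if "0 \<le> r" for r
    using that \<kappa> by (auto simp: T_def b_def abs_mult)
  have contr: "continuous_on {0..} (\<lambda>r. f (complex_of_real r * b))"
    by (rule continuous_on_compose2[OF cont]) (use bT in \<open>auto intro!: continuous_intros\<close>)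
  define F where "F r = indicator {0<..} r *\<^sub>R f (complex_of_real r * b)" for r :: real
  have Fm[measurable]: "F \<in> borel_measurable borel"
    unfolding F_def by (rule borel_measurable_continuous_on_indicator) (auto intro: continuous_on_subset[OF contr])
  \<comment> \<open>the integrand of \<open>\<rho>\<close>, cut off to the quadrant \<open>r > 0\<close>, \<open>t > 0\<close>\<close>
  define h where "h r t = F r * (b * c / pi) * (indicator {0<..} t *\<^sub>R exp (c * b * of_real (t * r)))" for r t :: real
  have hm[measurable]: "case_prod h \<in> borel_measurable (borel \<Otimes>\<^sub>M borel)"
    unfolding h_def by measurable
  have hm'[measurable]: "case_prod h \<in> borel_measurable (lborel \<Otimes>\<^sub>M lborel)"
    using hm by (simp cong: measurable_cong_sets sets_pair_measure_cong)
  have inner: "integrable lborel (\<lambda>t. h r t * exp (- (c * t * l)))" (is ?A)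
      "(LINT t|lborel. h r t * exp (- (c * t * l))) = F r * (b / pi) / (l - r * b)" (is ?B) if l: "0 \<le> l" for l r :: real
  proof -
    have "?A \<and> ?B"
    proof (cases "0 < r")
      case True
      define a where "a = c * (of_real l - of_real r * b)"
      have "a = of_real l * c - of_real r * (c * b)" by (simp add: a_def algebra_simps)
      then have a: "0 < Re a" using True l unfolding cb by (simp add: c_def)
      have c0: "c \<noteq> 0" by (simp add: c_def complex_eq_iff)
      have e: "h r t * exp (- (c * t * l)) = F r * (b * c / pi) * (indicator {0<..} t *\<^sub>R exp (- (a * t)))" for t
      proof -
        have "exp (c * b * of_real (t * r)) * exp (- (c * t * l)) = exp (- (a * t))"
          unfolding exp_add[symmetric] a_def by (simp add: algebra_simps)
        then show ?thesis by (simp add: h_def)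
      qed
      have K: "F r * (b * c / pi) * (1 / a) = F r * (b / pi) / (l - r * b)" using c0 by (simp add: a_def)
      show ?thesis
        unfolding e K[symmetric] exp_decay_integral(2)[OF a, symmetric] set_lebesgue_integral_def integral_mult_right_zero
        using exp_decay_integral(1)[OF a] by (intro conjI refl Bochner_Integration.integrable_mult_right) (simp add: set_integrable_def)
    qed (simp add: h_def F_def)
    then show ?A ?B by auto
  qed
  \<comment> \<open>integrating \<open>exp (- r t)\<close> in \<open>t\<close> first produces the factor \<open>1 / r\<close>\<close>
  have h_int: "integrable (lborel \<Otimes>\<^sub>M lborel) (case_prod h)"
  proof (rule lborel_pair.Fubini_integrable[OF hm'])
    have nh: "norm (h r t) = norm (b * c / pi) * norm (F r) * (indicator {0<..} t *\<^sub>R exp (- (r * t)))" for r t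
      unfolding h_def cb by (simp add: norm_mult norm_divide norm_exp_eq_Re mult_ac)
    have "(LINT t|lborel. norm (h r t)) = norm (b * c / pi) * norm (indicator {0<..} r *\<^sub>R (f (of_real r * b) / of_real r))" for r
    proof (cases "0 < r")
      case True
      then show ?thesis
        unfolding nh using exp_decay_integral_real[OF True]
        by (simp add: set_lebesgue_integral_def F_def norm_divide)
    qed (simp add: h_def F_def)
    then show "integrable lborel (\<lambda>r. LINT t|lborel. norm (case_prod h (r, t)))"
      unfolding case_prod_conv
      by (simp only:) (intro Bochner_Integration.integrable_mult_right integrable_norm int[unfolded set_integrable_def])
    have "integrable lborel (h r)" for r using inner(1)[of 0 r] by simp
    then show "AE r in lborel. integrable lborel (\<lambda>t. case_prod h (r, t))" by simp
  qed
  define \<rho> where "\<rho> t = (LINT r|lborel. h r t)" for t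
  have \<rho>_int: "integrable lborel \<rho>"
    unfolding \<rho>_def using lborel_pair.integrable_snd[of h] h_int by simp
  show ?thesis
  proof (rule that[OF \<rho>_int])
    show "\<rho> t = 0" if "t \<le> 0" for t using that by (simp add: \<rho>_def h_def)
  next
    fix l :: real assume l: "0 < l"
    show "Re (f (complex_of_real l)) = Im (LINT t|lborel. \<rho> t * exp (- (c * t * l)))"
    proof -
      define g where "g r = f (of_real r * b) * b / (of_real r * b - l)" for r :: real
      define J where "J = (LINT r|lborel. indicator {0<..} r *\<^sub>R g r)"
      have g_int: "integrable lborel (\<lambda>r. indicator {0<..} r *\<^sub>R g r)"
      proof (rule Bochner_Integration.integrable_bound)
        show "integrable lborel (\<lambda>r. (norm b / \<kappa>) *\<^sub>R (indicator {0<..} r *\<^sub>R (f (of_real r * b) / of_real r)))"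
          by (intro integrable_scaleR_right int[unfolded set_integrable_def])
        have "(\<lambda>r. indicator {0<..} r *\<^sub>R g r) = (\<lambda>r. F r * b / (of_real r * b - l))"
          by (auto simp: fun_eq_iff F_def g_def indicator_def)
        then show "(\<lambda>r. indicator {0<..} r *\<^sub>R g r) \<in> borel_measurable lborel" by simp
        show "AE r in lborel. norm (indicator {0<..} r *\<^sub>R g r) \<le> norm ((norm b / \<kappa>) *\<^sub>R (indicator {0<..} r *\<^sub>R (f (of_real r * b) / of_real r)))"
        proof (intro AE_I2)
          fix r :: real
          show "norm (indicator {0<..} r *\<^sub>R g r) \<le> norm ((norm b / \<kappa>) *\<^sub>R (indicator {0<..} r *\<^sub>R (f (of_real r * b) / of_real r)))"
          proof (cases "0 < r")
            case True
            have "\<kappa> * r \<le> norm (of_real r * b - l)"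
              using abs_Im_le_cmod[of "of_real r * b - l"] True \<kappa> by (simp add: b_def mult.commute)
            moreover have "0 < \<kappa> * r" using True \<kappa> by simp
            ultimately have "norm (g r) \<le> norm (f (of_real r * b)) * norm b / (\<kappa> * r)"
              unfolding g_def norm_divide norm_mult using True \<kappa> by (intro divide_left_mono mult_nonneg_nonneg mult_pos_pos norm_ge_zero) linarith+
            then show ?thesis using True \<kappa> by (simp add: norm_divide mult_ac)
          qed auto
        qed
      qed
      have lim: "((\<lambda>R. LINT r|lborel. indicator {..R} r *\<^sub>R (indicator {0<..} r *\<^sub>R g r)) \<longlongrightarrow> J) at_top"
        unfolding J_def by (rule tendsto_integral_at_top[OF _ g_int]) simp
      have "((\<lambda>R. \<bar>Re (f l) + Im (LINT r|lborel. indicator {..R} r *\<^sub>R (indicator {0<..} r *\<^sub>R g r)) / pi\<bar>) \<longlongrightarrow> \<bar>Re (f l) + Im J / pi\<bar>) at_top"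
        by (intro tendsto_intros lim) auto
      moreover have "((\<lambda>R. B R / (R - l) * (\<kappa> * R)) \<longlongrightarrow> 0) at_top"
      proof -
        have "((\<lambda>R. \<kappa> * R / (R - l)) \<longlongrightarrow> \<kappa>) at_top" using \<kappa> by real_asymp
        from tendsto_mult[OF B0 this] show ?thesis by (simp add: mult_ac)
      qed
      moreover have "\<forall>\<^sub>F R in at_top. \<bar>Re (f l) + Im (LINT r|lborel. indicator {..R} r *\<^sub>R (indicator {0<..} r *\<^sub>R g r)) / pi\<bar> \<le> B R / (R - l) * (\<kappa> * R)"
        using eventually_gt_at_top[of l]
      proof eventually_elim
        case (elim R)
        have "(LINT r|lborel. indicator {..R} r *\<^sub>R (indicator {0<..} r *\<^sub>R g r)) = (LINT r:{0..R}|lborel. f (r * b) * b / (r * b - l))"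
          unfolding set_lebesgue_integral_def
        proof (rule integral_cong_AE)
          show "AE r in lborel. indicator {..R} r *\<^sub>R (indicator {0<..} r *\<^sub>R g r) = indicator {0..R} r *\<^sub>R (f (of_real r * b) * b / (of_real r * b - l))"
            using AE_lborel_singleton[of 0] by eventually_elim (auto simp: indicator_def g_def)
          show "(\<lambda>r. indicator {..R} r *\<^sub>R (indicator {0<..} r *\<^sub>R g r)) \<in> borel_measurable lborel"
            using borel_measurable_integrable[OF g_int] by measurable
          have "continuous_on {0..R} (\<lambda>r. f (of_real r * b))" by (rule continuous_on_subset[OF contr]) auto
          then have "(\<lambda>r. indicator {0..R} r *\<^sub>R f (of_real r * b)) \<in> borel_measurable borel"
            by (intro borel_measurable_continuous_on_indicator) auto
          then have "(\<lambda>r. (indicator {0..R} r *\<^sub>R f (of_real r * b)) * b / (of_real r * b - l)) \<in> borel_measurable borel"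
            by measurable
          moreover have "(\<lambda>r. indicator {0..R} r *\<^sub>R (f (of_real r * b) * b / (of_real r * b - l)))
              = (\<lambda>r. (indicator {0..R} r *\<^sub>R f (of_real r * b)) * b / (of_real r * b - l))"
            by (auto simp: fun_eq_iff indicator_def)
          ultimately show "(\<lambda>r. indicator {0..R} r *\<^sub>R (f (of_real r * b) * b / (of_real r * b - l))) \<in> borel_measurable lborel"
            by (simp only: measurable_lborel2)
        qed
        moreover have "norm (f (of_real R)) \<le> B R"
          using B[of "of_real R"] \<kappa> l elim by (simp add: T_def)
        then have "0 \<le> B R" by (rule order_trans[OF norm_ge_zero])
        ultimately show ?case
          using sector_Cauchy_estimate[OF \<kappa> l cont[unfolded T_def] hol sym[unfolded T_def] elim, of "B R"] B
          by (auto simp: T_def b_def)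
      qed
      ultimately have "\<bar>Re (f l) + Im J / pi\<bar> \<le> 0"
        by (intro tendsto_le[OF _ _ _]) auto
      then have 1: "Re (f l) = - Im J / pi" by simp
      have "(LINT t|lborel. \<rho> t * exp (- (c * t * l))) = (LINT t|lborel. (LINT r|lborel. h r t * exp (- (c * t * l))))"
        unfolding \<rho>_def by simp
      also have "\<dots> = (LINT r|lborel. (LINT t|lborel. h r t * exp (- (c * t * l))))"
      proof (rule lborel_pair.Fubini_integral)
        show "integrable (lborel \<Otimes>\<^sub>M lborel) (\<lambda>(r, t). h r t * exp (- (c * t * l)))"
        proof (rule Bochner_Integration.integrable_bound[OF h_int])
          show "(\<lambda>(r, t). h r t * exp (- (c * t * l))) \<in> borel_measurable (lborel \<Otimes>\<^sub>M lborel)" by measurable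
          show "AE z in lborel \<Otimes>\<^sub>M lborel. norm (case z of (r, t) \<Rightarrow> h r t * exp (- (c * t * l))) \<le> norm (case_prod h z)"
          proof (intro AE_I2)
            fix z :: "real \<times> real"
            obtain r t where z: "z = (r, t)" by (cases z)
            have "norm (h r t) * norm (exp (- (c * t * l))) \<le> norm (h r t) * 1"
            proof (cases "0 < t")
              case True
              then have "norm (exp (- (c * t * l))) \<le> 1" using l by (simp add: norm_exp_eq_Re c_def)
              then show ?thesis by (intro mult_left_mono) auto
            qed (simp add: h_def)
            then show "norm (case z of (r, t) \<Rightarrow> h r t * exp (- (c * t * l))) \<le> norm (case_prod h z)"
              by (simp add: z norm_mult)
          qed
        qed
      qed
      also have "\<dots> = (LINT r|lborel. (- 1 / pi) *\<^sub>R (indicator {0<..} r *\<^sub>R g r))"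
      proof (rule Bochner_Integration.integral_cong[OF refl])
        fix r :: real
        have "F r * (b / pi) / (l - r * b) = - (F r * b / (r * b - l)) / pi"
          by (metis (no_types, opaque_lifting) divide_divide_eq_left divide_minus_right minus_diff_eq minus_divide_left mult.commute times_divide_eq_right)
        then show "(LINT t|lborel. h r t * exp (- (c * t * l))) = (- 1 / pi) *\<^sub>R (indicator {0<..} r *\<^sub>R g r)"
          using inner(2)[of l r] l by (simp add: F_def g_def scaleR_conv_of_real mult_ac)
      qed
      also have "\<dots> = (- 1 / pi) *\<^sub>R J" unfolding J_def by (rule Bochner_Integration.integral_scaleR_right)
      finally show ?thesis using 1 by simp
    qed
  qed
qed

section \<open>The symbol of the fractional semigroup\<close>

lemma power_times_exp_powr_bounded:
  fixes c \<beta> :: real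
  assumes c: "0 < c" and \<beta>: "0 < \<beta>"
  shows "\<exists>C>0. \<forall>u\<ge>0. (1 + u) ^ N * exp (- (c * u powr \<beta>)) \<le> C"
proof -
  obtain n :: nat where n: "real N / \<beta> \<le> real n" using real_arch_simple by blast
  define C where "C = 2 ^ N * (1 + fact n / c ^ n)"
  have C: "2 ^ N \<le> C" "2 ^ N * (fact n / c ^ n) \<le> C" "0 < C"
    using c by (auto simp: C_def algebra_simps intro!: add_pos_pos)
  have "(1 + u) ^ N * exp (- (c * u powr \<beta>)) \<le> C" if u: "0 \<le> u" for u
  proof (cases "u \<le> 1")
    case True
    have "(1 + u) ^ N * exp (- (c * u powr \<beta>)) \<le> 2 ^ N * 1"
      using True u c by (intro mult_mono power_mono) auto
    then show ?thesis using C(1) by simp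
  next
    case False
    define v where "v = u powr \<beta>"
    have v: "0 < v" using False by (simp add: v_def)
    have "u ^ N = u powr real N" using False by (simp add: powr_realpow)
    also have "\<dots> \<le> u powr (\<beta> * real n)"
      using False n \<beta> by (intro powr_mono) (auto simp: field_simps)
    also have "\<dots> = v ^ n" using False by (simp add: v_def powr_powr powr_realpow[symmetric])
    finally have uN: "u ^ N \<le> v ^ n" .
    have "(c * v) ^ n / fact n \<le> exp (c * v)"
    proof -
      have "(\<Sum>k\<in>{n}. (c * v) ^ k / fact k) \<le> (\<Sum>k. (c * v) ^ k / fact k)"
        using c v summable_exp_generic[of "c * v"]
        by (intro sum_le_suminf) (auto simp: scaleR_conv_of_real divide_inverse mult.commute)
      then show ?thesis by (simp add: exp_def scaleR_conv_of_real divide_inverse mult.commute)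
    qed
    then have "v ^ n * exp (- (c * v)) \<le> fact n / c ^ n"
      using c by (simp add: exp_minus power_mult_distrib field_simps)
    then have "2 ^ N * (v ^ n * exp (- (c * v))) \<le> 2 ^ N * (fact n / c ^ n)" by (intro mult_left_mono) auto
    moreover have "(1 + u) ^ N \<le> 2 ^ N * v ^ n"
    proof -
      have "(1 + u) ^ N \<le> (2 * u) ^ N" using False by (intro power_mono) auto
      also have "\<dots> = 2 ^ N * u ^ N" by (simp add: power_mult_distrib)
      also have "\<dots> \<le> 2 ^ N * v ^ n" using uN by simp
      finally show ?thesis .
    qed
    then have "(1 + u) ^ N * exp (- (c * v)) \<le> 2 ^ N * v ^ n * exp (- (c * v))" by (intro mult_right_mono) auto
    ultimately have "(1 + u) ^ N * exp (- (c * v)) \<le> 2 ^ N * (fact n / c ^ n)" by (simp only: mult.assoc order_trans)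
    then show ?thesis using C(2) unfolding v_def by (rule order_trans)
  qed
  then show ?thesis using C(3) by blast
qed

text \<open>
  If $|\arg z| \le \theta$, then $\mathrm{Re}\, z^\beta = |z|^\beta \cos(\beta \arg z)$, and
  \<open>tan\<close> turns the bound on the argument into the linear condition that describes the
  sector.
\<close>

lemma Re_powr_sector:
  fixes z :: complex
  assumes z: "\<bar>Im z\<bar> \<le> tan \<theta> * Re z" and \<theta>: "0 < \<theta>" "\<theta> < pi / 2" and \<beta>: "0 < \<beta>" "\<beta> * \<theta> \<le> pi"
  shows "cos (\<beta> * \<theta>) * norm z powr \<beta> \<le> Re (z powr of_real \<beta>)"
proof (cases "z = 0")
  case False
  have t: "0 < tan \<theta>" using \<theta> by (rule tan_gt_zero)
  have "0 \<le> tan \<theta> * Re z" using z by (meson abs_ge_zero order_trans)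
  then have re: "0 \<le> Re z" using t by (simp add: zero_le_mult_iff)
  have "Re z \<noteq> 0" using False z by (auto simp: complex_eq_iff)
  with re have re: "0 < Re z" by simp
  have "Arg z = arctan (Im z / Re z)" by (rule arg_conv_arctan[OF re])
  moreover have q: "\<bar>Im z / Re z\<bar> \<le> tan \<theta>" using z re by (simp add: abs_divide divide_le_eq)
  have "- tan \<theta> \<le> Im z / Re z" using abs_le_D2[OF q] by (simp only: minus_le_iff)
  then have "arctan (Im z / Re z) \<le> arctan (tan \<theta>)" "arctan (- tan \<theta>) \<le> arctan (Im z / Re z)"
    using abs_le_D1[OF q] by (simp_all only: arctan_le_iff)
  moreover have "arctan (tan \<theta>) = \<theta>" using \<theta> by (intro arctan_tan) auto
  ultimately have A: "\<bar>Arg z\<bar> \<le> \<theta>" by (auto simp: arctan_minus abs_le_iff)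
  have "cos (\<beta> * \<theta>) \<le> cos (\<beta> * \<bar>Arg z\<bar>)"
    using A \<beta> by (intro cos_monotone_0_pi_le mult_left_mono) auto
  also have "cos (\<beta> * \<bar>Arg z\<bar>) = cos (\<beta> * Arg z)" by (metis abs_mult abs_of_pos \<beta>(1) cos_abs_real)
  finally have "cos (\<beta> * \<theta>) * norm z powr \<beta> \<le> cos (\<beta> * Arg z) * norm z powr \<beta>" by (intro mult_right_mono) auto
  also have "\<dots> = Re (z powr of_real \<beta>)"
  proof -
    have "Im (Ln z) = Arg z" using False by (simp add: Arg_eq_Im_Ln)
    then show ?thesis using False
      by (simp add: powr_def Re_exp mult.commute)
  qed
  finally show ?thesis .
qed simp

lemma set_integrable_powr:
  fixes a :: real
  shows "- 1 < a \<Longrightarrow> set_integrable lborel {0<..1} (\<lambda>x. x powr a)"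
    and "a < - 1 \<Longrightarrow> set_integrable lborel {1<..} (\<lambda>x. x powr a)"
proof -
  assume a: "- 1 < a"
  have "(\<lambda>x::real. x powr a) absolutely_integrable_on {0..1}"
    by (rule nonnegative_absolutely_integrable_1[OF integrable_on_powr_from_0]) (use a in auto)
  then have "set_integrable lborel {0..1} (\<lambda>x::real. x powr a)"
    unfolding set_integrable_def by (subst (asm) integrable_completion) auto
  then show "set_integrable lborel {0<..1} (\<lambda>x. x powr a)"
    by (rule set_integrable_subset) auto
next
  assume a: "a < - 1"
  have "(\<lambda>x::real. x powr a) absolutely_integrable_on {1..}"
    by (rule nonnegative_absolutely_integrable_1) (use has_integral_powr_to_inf[OF a, of 1] in \<open>auto simp: has_integral_integrable_integral\<close>)
  then have "set_integrable lborel {1..} (\<lambda>x::real. x powr a)"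
    unfolding set_integrable_def by (subst (asm) integrable_completion) auto
  then show "set_integrable lborel {1<..} (\<lambda>x. x powr a)"
    by (rule set_integrable_subset) auto
qed

text \<open>
  The angle $\theta$ is small enough that $\mathrm{Re}\, z^\beta$ is comparable to $|z|^\beta$ in
  the sector, so $e^{-z^\beta}$ beats the polynomial factor. Subtracting $1/(1+z)$, whose own
  Laplace representation is explicit, removes the value $1$ of the symbol at the origin, which would
  make $f(rb)/r$ non-integrable near $r = 0$. The factor $(1+l)^M$ prepares the division by
  $(1+l)^M$ through which \<open>heat_kernel_small_time\<close> gains integrability at the origin.
\<close>

lemma fractional_laplace_representation:
  fixes \<beta> :: real and M :: nat
  assumes \<beta>: "0 < \<beta>"
  obtains \<rho> :: "real \<Rightarrow> complex" and \<eta> :: real where "0 < \<eta>" "integrable lborel \<rho>" "\<And>t. t \<le> 0 \<Longrightarrow> \<rho> t = 0"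
    "\<And>l. 0 < l \<Longrightarrow> exp (- (l powr \<beta>)) * (1 + l) ^ M - 1 / (1 + l) = Im (LINT t|lborel. \<rho> t * exp (- (Complex 1 \<eta> * t * l)))"
proof -
  define \<theta> where "\<theta> = pi / (4 * (1 + \<beta>))"
  have \<theta>: "0 < \<theta>" "\<theta> < pi / 2" and b\<theta>: "0 < \<beta> * \<theta>" "\<beta> * \<theta> < pi / 2"
  proof -
    show "0 < \<theta>" unfolding \<theta>_def using \<beta> by simp
    then show "0 < \<beta> * \<theta>" using \<beta> by simp
    have "pi / (4 * (1 + \<beta>)) \<le> pi / 4" using \<beta> by (intro divide_left_mono) auto
    then show "\<theta> < pi / 2" unfolding \<theta>_def using pi_gt_zero by linarith
    have "\<beta> * \<theta> = pi / 4 * (\<beta> / (1 + \<beta>))" by (simp add: \<theta>_def)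
    also have "\<dots> \<le> pi / 4 * 1" using \<beta> by (intro mult_left_mono) auto
    also have "\<dots> < pi / 2" using pi_gt_zero by simp
    finally show "\<beta> * \<theta> < pi / 2" .
  qed
  define \<kappa> where "\<kappa> = tan \<theta>"
  have \<kappa>: "0 < \<kappa>" unfolding \<kappa>_def using \<theta> by (rule tan_gt_zero)
  define c0 where "c0 = cos (\<beta> * \<theta>)"
  have c0: "0 < c0" unfolding c0_def using b\<theta> by (rule cos_gt_zero)
  define T where "T = {z. \<bar>Im z\<bar> \<le> \<kappa> * Re z}"
  have re0: "0 \<le> Re z" if "z \<in> T" for z
  proof -
    have "\<bar>Im z\<bar> \<le> \<kappa> * Re z" using that by (simp add: T_def)
    then have "0 \<le> \<kappa> * Re z" by (rule order_trans[OF abs_ge_zero])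
    then show ?thesis using \<kappa> by (simp add: zero_le_mult_iff)
  qed
  have nle: "norm z \<le> (1 + \<kappa>) * Re z" if "z \<in> T" for z
    using cmod_le[of z] that re0[OF that] by (simp add: T_def algebra_simps)
  have repowr: "c0 * norm z powr \<beta> \<le> Re (z powr of_real \<beta>)" if "z \<in> T" for z
    unfolding c0_def using that \<theta> \<beta> b\<theta> by (intro Re_powr_sector) (auto simp: T_def \<kappa>_def)
  define f where "f z = exp (- (z powr of_real \<beta>)) * (1 + z) ^ M - 1 / (1 + z)" for z :: complex
  have p1: "1 + Re z \<le> norm (1 + z)" for z using complex_Re_le_cmod[of "1 + z"] by simp
  have ne: "1 + z \<noteq> 0" if "z \<in> T" for z using re0[OF that] p1[of z] by auto
  obtain C where C: "0 < C" "\<And>u. 0 \<le> u \<Longrightarrow> (1 + u) ^ (M + 1) * exp (- (c0 * u powr \<beta>)) \<le> C"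
    using power_times_exp_powr_bounded[OF c0 \<beta>, of "M + 1"] by blast
  have B: "norm (f z) \<le> (C + 1) / (1 + Re z)" if z: "z \<in> T" for z
  proof -
    have r: "0 \<le> Re z" by (rule re0[OF z])
    have "norm (exp (- (z powr of_real \<beta>)) * (1 + z) ^ M) \<le> exp (- (c0 * norm z powr \<beta>)) * (1 + norm z) ^ M"
      unfolding norm_mult norm_power norm_exp_eq_Re using repowr[OF z]
      by (intro mult_mono power_mono) (auto intro: norm_triangle_le)
    also have "\<dots> = (1 + norm z) ^ (M + 1) * exp (- (c0 * norm z powr \<beta>)) / (1 + norm z)"
    proof -
      have "0 < 1 + norm z" by (intro add_pos_nonneg) auto
      then show ?thesis by simp
    qed
    also have "\<dots> \<le> C / (1 + Re z)"
      using C complex_Re_le_cmod[of z] r by (intro frac_le) auto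
    finally have 1: "norm (exp (- (z powr of_real \<beta>)) * (1 + z) ^ M) \<le> C / (1 + Re z)" .
    have "norm (1 / (1 + z)) \<le> 1 / (1 + Re z)"
      unfolding norm_divide using p1[of z] r by (intro frac_le) auto
    with 1 norm_triangle_ineq4[of "exp (- (z powr of_real \<beta>)) * (1 + z) ^ M" "1 / (1 + z)"]
    show ?thesis by (simp add: f_def add_divide_distrib)
  qed
  define b where "b = Complex 1 \<kappa>"
  define K where "K = 1 + \<kappa>"
  have K: "1 < K" using \<kappa> by (simp add: K_def)
  have bT: "complex_of_real r * b \<in> T" "norm (complex_of_real r * b) \<le> K * r" if "0 \<le> r" for r
  proof -
    show "complex_of_real r * b \<in> T" using that \<kappa> by (auto simp: T_def b_def abs_mult)
    from nle[OF this] show "norm (complex_of_real r * b) \<le> K * r" by (simp add: K_def b_def)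
  qed
  \<comment> \<open>the correction \<open>1 / (1 + z)\<close> makes the symbol vanish at the vertex of the sector\<close>
  define D1 D2 where "D1 = exp (K powr \<beta>) * K powr \<beta> * (1 + K) ^ M" and "D2 = K * (M + 1) * (1 + K) ^ M"
  \<comment> \<open>\<open>f\<close> splits into \<open>exp (- w) - 1\<close>, of size \<open>r powr \<beta>\<close>, and a difference of powers, of size \<open>r\<close>\<close>
  have small: "norm (f (of_real r * b)) \<le> D1 * r powr \<beta> + D2 * r" if r: "0 < r" "r \<le> 1" for r
  proof -
    define z where "z = complex_of_real r * b"
    have z: "z \<in> T" "norm z \<le> K * r" using bT[of r] r by (auto simp: z_def)
    have zK: "norm z \<le> K"
    proof -
      have "K * r \<le> K * 1" using r K by (intro mult_left_mono) auto
      with z(2) show ?thesis by linarith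
    qed
    have z1: "norm (1 + z) \<le> 1 + K" using norm_triangle_ineq[of 1 z] zK by simp
    define w where "w = z powr of_real \<beta>"
    have nw: "norm w = norm z powr \<beta>" unfolding w_def by (subst norm_powr_real_powr') auto
    have nw1: "norm w \<le> K powr \<beta> * r powr \<beta>"
      unfolding nw using z(2) r K \<beta> by (simp add: powr_mult[symmetric] powr_mono2)
    have "K powr \<beta> * r powr \<beta> \<le> K powr \<beta> * 1" using r \<beta> by (intro mult_left_mono powr_le1) auto
    with nw1 have nw2: "norm w \<le> K powr \<beta>" by simp
    have "norm (exp (- w) - 1) \<le> exp \<bar>Re (- w)\<bar> * norm w"
      using Taylor_exp[of "- w" 0] by simp
    also have "\<dots> \<le> exp (K powr \<beta>) * (K powr \<beta> * r powr \<beta>)"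
      using nw1 nw2 abs_Re_le_cmod[of w] by (intro mult_mono) auto
    finally have 1: "norm (exp (- w) - 1) \<le> exp (K powr \<beta>) * (K powr \<beta> * r powr \<beta>)" .
    have 2: "norm ((1 + z) ^ (M + 1) - 1) \<le> K * r * ((M + 1) * (1 + K) ^ M)"
    proof -
      have "(1 + z) ^ (M + 1) - 1 = z * (\<Sum>i<M + 1. (1 + z) ^ i)" using power_diff_1_eq[of "1 + z" "M + 1"] by simp
      then have "norm ((1 + z) ^ (M + 1) - 1) = norm z * norm (\<Sum>i<M + 1. (1 + z) ^ i)" by (simp only: norm_mult)
      also have "\<dots> \<le> K * r * (\<Sum>i<M + 1. (1 + K) ^ M)"
      proof (intro mult_mono z sum_norm_le)
        fix i assume "i \<in> {..<M + 1}"
        then have "norm (1 + z) ^ i \<le> (1 + K) ^ i" "(1 + K) ^ i \<le> (1 + K) ^ M"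
          using z1 K by (auto intro!: power_mono power_increasing)
        then show "norm ((1 + z) ^ i) \<le> (1 + K) ^ M" by (simp add: norm_power)
      qed (use K r in auto)
      finally show ?thesis by simp
    qed
    have "f z = (exp (- w) - 1) * (1 + z) ^ M + ((1 + z) ^ (M + 1) - 1) / (1 + z)"
    proof -
      have "((1 + z) ^ (M + 1) - 1) / (1 + z) = (1 + z) ^ M - 1 / (1 + z)"
        using ne[OF z(1)] by (simp add: diff_divide_distrib)
      then show ?thesis by (simp add: f_def w_def left_diff_distrib)
    qed
    also have "norm \<dots> \<le> norm ((exp (- w) - 1) * (1 + z) ^ M) + norm (((1 + z) ^ (M + 1) - 1) / (1 + z))"
      by (rule norm_triangle_ineq)
    also have "\<dots> \<le> exp (K powr \<beta>) * (K powr \<beta> * r powr \<beta>) * (1 + K) ^ M + K * r * ((M + 1) * (1 + K) ^ M) / 1"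
    proof (intro add_mono)
      show "norm ((exp (- w) - 1) * (1 + z) ^ M) \<le> exp (K powr \<beta>) * (K powr \<beta> * r powr \<beta>) * (1 + K) ^ M"
        unfolding norm_mult norm_power using 1 z1 K by (intro mult_mono power_mono) auto
      show "norm (((1 + z) ^ (M + 1) - 1) / (1 + z)) \<le> K * r * ((M + 1) * (1 + K) ^ M) / 1"
        unfolding norm_divide using 2 p1[of z] re0[OF z(1)] K r by (intro frac_le) auto
    qed
    also have "\<dots> = D1 * r powr \<beta> + D2 * r" unfolding D1_def D2_def by simp
    finally show ?thesis unfolding z_def .
  qed
  have contr: "continuous_on T f"
    unfolding f_def using re0 ne \<beta> by (intro continuous_intros) auto
  have int: "set_integrable lborel {0<..} (\<lambda>r. f (of_real r * b) / of_real r)"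
  proof -
    let ?G = "\<lambda>r::real. D1 * (indicator {0<..1} r *\<^sub>R r powr (\<beta> - 1)) + D2 * (indicator {0<..1} r *\<^sub>R r powr 0) + (C + 1) * (indicator {1<..} r *\<^sub>R r powr (- 2))"
    have G: "integrable lborel ?G"
      using set_integrable_powr(1)[of "\<beta> - 1"] set_integrable_powr(1)[of 0] set_integrable_powr(2)[of "- 2"] \<beta>
      unfolding set_integrable_def by (intro Bochner_Integration.integrable_add Bochner_Integration.integrable_mult_right) auto
    show ?thesis
      unfolding set_integrable_def
    proof (rule Bochner_Integration.integrable_bound[OF G])
      have "continuous_on {0<..} (\<lambda>r. f (of_real r * b) / of_real r)"
        by (intro continuous_intros continuous_on_compose2[OF contr]) (use bT(1) in auto)
      then show "(\<lambda>r. indicator {0<..} r *\<^sub>R (f (of_real r * b) / of_real r)) \<in> borel_measurable lborel"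
        unfolding measurable_lborel2 by (intro borel_measurable_continuous_on_indicator) auto
      show "AE r in lborel. norm (indicator {0<..} r *\<^sub>R (f (of_real r * b) / of_real r)) \<le> norm (?G r)"
      proof (intro AE_I2)
        fix r :: real
        consider "r \<le> 0" | "0 < r" "r \<le> 1" | "1 < r" by linarith
        then show "norm (indicator {0<..} r *\<^sub>R (f (of_real r * b) / of_real r)) \<le> norm (?G r)"
        proof cases
          case 2
          have "norm (f (of_real r * b)) / r \<le> (D1 * r powr \<beta> + D2 * r) / r"
            using small[OF 2] 2 by (intro divide_right_mono) auto
          also have "\<dots> = D1 * r powr (\<beta> - 1) + D2" using 2 by (simp add: powr_diff add_divide_distrib)
          finally have "norm (f (of_real r * b)) / r \<le> D1 * r powr (\<beta> - 1) + D2" .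
          then show ?thesis using 2 by (simp add: norm_divide)
        next
          case 3
          have "norm (f (of_real r * b)) / r \<le> ((C + 1) / (1 + r)) / r"
            using B[OF bT(1)[of r]] 3 by (intro divide_right_mono) (auto simp: b_def)
          also have "\<dots> \<le> ((C + 1) / r) / r" using 3 C by (intro divide_right_mono divide_left_mono) auto
          also have "\<dots> = (C + 1) * r powr (- 2)" using 3 by (simp add: powr_minus_divide power2_eq_square)
          finally have "norm (f (of_real r * b)) / r \<le> (C + 1) * r powr (- 2)" .
          then show ?thesis using 3 C by (simp add: norm_divide)
        qed simp
      qed
    qed
  qed
  have sym: "f (cnj z) = cnj (f z)" if "z \<in> T" for z
    using re0[OF that] by (simp add: f_def exp_cnj cnj_powr)
  have hol: "f holomorphic_on {z. \<bar>Im z\<bar> < \<kappa> * Re z}"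
  proof -
    have "0 < Re z" if "\<bar>Im z\<bar> < \<kappa> * Re z" for z
    proof -
      have "0 < \<kappa> * Re z" using abs_ge_zero that by (rule le_less_trans)
      then show ?thesis using \<kappa> by (simp add: zero_less_mult_iff)
    qed
    then have "z \<notin> \<real>\<^sub>\<le>\<^sub>0 \<and> 1 + z \<noteq> 0" if "\<bar>Im z\<bar> < \<kappa> * Re z" for z
      using that p1[of z] by (fastforce simp: complex_nonpos_Reals_iff)
    then show ?thesis unfolding f_def by (intro holomorphic_intros) auto
  qed
  have lim: "((\<lambda>R. (C + 1) / (1 + R)) \<longlongrightarrow> 0) at_top" by real_asymp
  have fl: "Re (f (complex_of_real l)) = exp (- (l powr \<beta>)) * (1 + l) ^ M - 1 / (1 + l)" if "0 < l" for l
  proof -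
    have "f (complex_of_real l) = of_real (exp (- (l powr \<beta>)) * (1 + l) ^ M - 1 / (1 + l))"
      using that by (simp add: f_def powr_of_real exp_of_real[symmetric])
    then show ?thesis by simp
  qed
  show ?thesis
  proof (rule ray_laplace_representation[OF \<kappa> contr[unfolded T_def] hol sym[unfolded T_def] B[unfolded T_def] lim int[unfolded b_def]])
    fix \<rho> :: "real \<Rightarrow> complex"
    assume \<rho>: "integrable lborel \<rho>" "\<And>t. t \<le> 0 \<Longrightarrow> \<rho> t = 0"
      "\<And>l. 0 < l \<Longrightarrow> Re (f (complex_of_real l)) = Im (LINT t|lborel. \<rho> t * exp (- (Complex 1 (2 / \<kappa>) * t * l)))"
    show thesis
    proof (rule that[OF _ \<rho>(1,2)])
      show "0 < 2 / \<kappa>" using \<kappa> by simp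
      show "exp (- (l powr \<beta>)) * (1 + l) ^ M - 1 / (1 + l) = Im (LINT t|lborel. \<rho> t * exp (- (Complex 1 (2 / \<kappa>) * t * l)))"
        if "0 < l" for l using \<rho>(3)[OF that] fl[OF that] by simp
    qed
  qed
qed

section \<open>Superpositions of Mehler kernels\<close>

definition mehler_prod_majorant :: "complex \<Rightarrow> real ^ 'n::finite \<Rightarrow> real ^ 'n \<Rightarrow> real" where
  "mehler_prod_majorant r x y = (\<Prod>j\<in>UNIV. mehler_majorant r (x $ j) (y $ j))"

lemma mehler_prod_majorant_nonneg: "0 \<le> mehler_prod_majorant r x y"
  unfolding mehler_prod_majorant_def by (intro prod_nonneg) (simp add: mehler_majorant_nonneg)

lemma mehler_prod_majorant_commute: "mehler_prod_majorant r x y = mehler_prod_majorant r y x"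
  unfolding mehler_prod_majorant_def by (simp add: mehler_majorant_commute)

lemma borel_measurable_vec_component[measurable (raw)]:
  fixes g :: "'a \<Rightarrow> real ^ 'n::finite"
  assumes [measurable]: "g \<in> borel_measurable M"
  shows "(\<lambda>z. g z $ j) \<in> borel_measurable M"
  unfolding cart_eq_inner_axis by measurable

lemma mehler_prod_majorant_measurable[measurable]:
  "(\<lambda>z. mehler_prod_majorant (f z) (g z) (h z)) \<in> borel_measurable M"
  if [measurable]: "f \<in> borel_measurable M" "g \<in> borel_measurable M" "h \<in> borel_measurable M"
  unfolding mehler_prod_majorant_def by measurable

context stolz_point
begin

lemma prod_row:
  fixes x :: "real ^ 'n::finite"
  shows "(\<integral>\<^sup>+y. ennreal (mehler_prod_majorant r x y) \<partial>lborel) \<le> ennreal ((2 * (1 + L)) ^ CARD('n))"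
proof -
  have "(\<integral>\<^sup>+y. ennreal (mehler_prod_majorant r x y) \<partial>lborel)
      = (\<integral>\<^sup>+y. (\<Prod>j\<in>UNIV. ennreal (mehler_majorant r (x $ j) (y $ j))) \<partial>(lborel :: (real ^ 'n) measure))"
    unfolding mehler_prod_majorant_def by (subst prod_ennreal) (auto simp: mehler_majorant_nonneg)
  also have "\<dots> = (\<Prod>j\<in>UNIV. \<integral>\<^sup>+s. ennreal (mehler_majorant r (x $ j) s) \<partial>lborel)"
    by (rule nn_integral_vec_prod) measurable
  also have "\<dots> \<le> (\<Prod>j\<in>(UNIV :: 'n set). ennreal (2 * (1 + L)))"
    by (intro prod_mono_ennreal majorant_row)
  also have "\<dots> = ennreal ((2 * (1 + L)) ^ CARD('n))"
    unfolding prod_constant by (rule ennreal_power) (use L in simp)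
  finally show ?thesis .
qed

lemma prod_sup:
  fixes x y :: "real ^ 'n::finite"
  shows "mehler_prod_majorant r x y \<le> (8 * sqrt ((1 + L) / (1 - norm r))) ^ CARD('n)"
proof -
  have "mehler_prod_majorant r x y \<le> (\<Prod>j\<in>(UNIV :: 'n set). 8 * sqrt ((1 + L) / (1 - norm r)))"
    unfolding mehler_prod_majorant_def by (intro prod_mono) (auto simp: mehler_majorant_nonneg majorant_sup)
  then show ?thesis by simp
qed

lemma prod_mass:
  "(\<integral>\<^sup>+x. \<integral>\<^sup>+y. ennreal (mehler_prod_majorant r x y) \<partial>lborel \<partial>(lborel :: (real ^ 'n::finite) measure))
     \<le> ennreal ((8 * sqrt ((1 + L) / (1 - norm r))) ^ CARD('n))"
proof -
  have "(\<integral>\<^sup>+x. \<integral>\<^sup>+y. ennreal (mehler_prod_majorant r x y) \<partial>lborel \<partial>(lborel :: (real ^ 'n) measure))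
      = (\<integral>\<^sup>+x. \<integral>\<^sup>+y. (\<Prod>j\<in>UNIV. ennreal (mehler_majorant r (x $ j) (y $ j))) \<partial>lborel \<partial>(lborel :: (real ^ 'n) measure))"
    unfolding mehler_prod_majorant_def by (subst prod_ennreal) (auto simp: mehler_majorant_nonneg)
  also have "\<dots> = (\<integral>\<^sup>+x. (\<Prod>j\<in>UNIV. \<integral>\<^sup>+s. ennreal (mehler_majorant r (x $ j) s) \<partial>lborel) \<partial>(lborel :: (real ^ 'n) measure))"
    by (intro nn_integral_cong nn_integral_vec_prod) measurable
  also have "\<dots> = (\<Prod>j\<in>(UNIV :: 'n set). \<integral>\<^sup>+u. \<integral>\<^sup>+s. ennreal (mehler_majorant r u s) \<partial>lborel \<partial>lborel)"
    by (rule nn_integral_vec_prod[where f = "\<lambda>_ u. \<integral>\<^sup>+s. ennreal (mehler_majorant r u s) \<partial>lborel"]) measurable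
  also have "\<dots> \<le> (\<Prod>j\<in>(UNIV :: 'n set). ennreal (8 * sqrt ((1 + L) / (1 - norm r))))"
    by (intro prod_mono_ennreal majorant_mass)
  also have "\<dots> = ennreal ((8 * sqrt ((1 + L) / (1 - norm r))) ^ CARD('n))"
    using L pos by (simp add: ennreal_power)
  finally show ?thesis .
qed

lemma prod_bounds:
  "kernel_bounds (\<lambda>x y :: real ^ 'n::finite. ennreal (mehler_prod_majorant r x y))
     (ennreal ((2 * (1 + L)) ^ CARD('n))) (ennreal ((8 * sqrt ((1 + L) / (1 - norm r))) ^ CARD('n)))"
proof (rule kernel_boundsI)
  show "ennreal (mehler_prod_majorant r x y) = ennreal (mehler_prod_majorant r y x)" for x y :: "real ^ 'n"
    by (rule arg_cong[OF mehler_prod_majorant_commute])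
qed (measurable, intro prod_row prod_mass ennreal_leI prod_sup)+

end

lemma norm_prod_mehler:
  fixes x y :: "real ^ 'n::finite"
  assumes "norm r < 1"
  shows "norm (\<Prod>j\<in>UNIV. mehler r (x $ j) (y $ j)) = mehler_prod_majorant r x y"
  unfolding mehler_prod_majorant_def prod_norm[symmetric] by (simp add: norm_mehler[OF assms])

text \<open>
  Off-diagonal kernels are controlled by diagonal ones, so that absolute convergence of the
  expansion only needs Mehler's formula on the diagonal, where every term is nonnegative.
\<close>

lemma hermite_kernel_le_diag: "\<bar>hermite_kernel k x y\<bar> \<le> (hermite_kernel k x x + hermite_kernel k y y) / 2"
proof -
  have "\<bar>hermite_kernel k x y\<bar> \<le> (\<Sum>\<alpha> | (\<Sum>j\<in>UNIV. \<alpha> j) = k. \<bar>hermite_Phi \<alpha> x * hermite_Phi \<alpha> y\<bar>)"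
    unfolding hermite_kernel_def by (rule sum_abs)
  also have "\<dots> \<le> (\<Sum>\<alpha> | (\<Sum>j\<in>UNIV. \<alpha> j) = k. (hermite_Phi \<alpha> x * hermite_Phi \<alpha> x + hermite_Phi \<alpha> y * hermite_Phi \<alpha> y) / 2)"
  proof (rule sum_mono)
    fix \<alpha>
    have "0 \<le> (\<bar>hermite_Phi \<alpha> x\<bar> - \<bar>hermite_Phi \<alpha> y\<bar>)\<^sup>2" by simp
    then show "\<bar>hermite_Phi \<alpha> x * hermite_Phi \<alpha> y\<bar> \<le> (hermite_Phi \<alpha> x * hermite_Phi \<alpha> x + hermite_Phi \<alpha> y * hermite_Phi \<alpha> y) / 2"
      by (simp add: power2_eq_square algebra_simps abs_mult)
  qed
  also have "\<dots> = (hermite_kernel k x x + hermite_kernel k y y) / 2"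
    unfolding hermite_kernel_def by (simp add: sum_divide_distrib[symmetric] sum.distrib)
  finally show ?thesis .
qed

lemma hermite_kernel_abs_summable:
  fixes x y :: "real ^ 'n::finite"
  assumes \<rho>: "0 \<le> \<rho>" "\<rho> < 1"
  shows "summable (\<lambda>k. \<rho> ^ k * \<bar>hermite_kernel k x y\<bar>)"
    and "(\<Sum>k. \<rho> ^ k * \<bar>hermite_kernel k x y\<bar>) \<le> (8 * sqrt (2 / (1 - \<rho>))) ^ CARD('n)"
proof -
  interpret stolz_point "complex_of_real \<rho>" 1
  proof
    have "norm (1 - complex_of_real \<rho>) = norm (complex_of_real (1 - \<rho>))" by simp
    then show "norm (1 - complex_of_real \<rho>) \<le> 1 * (1 - norm (complex_of_real \<rho>))"
      using \<rho> by (simp del: of_real_diff)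
  qed (use \<rho> in auto)
  let ?B = "(8 * sqrt (2 / (1 - \<rho>))) ^ CARD('n)"
  have diag: "summable (\<lambda>k. \<rho> ^ k * hermite_kernel k z z)" "(\<Sum>k. \<rho> ^ k * hermite_kernel k z z) \<le> ?B" for z :: "real ^ 'n"
  proof -
    have s: "(\<lambda>k. \<rho> ^ k * hermite_kernel k z z) sums Re (\<Prod>j\<in>UNIV. mehler (of_real \<rho>) (z $ j) (z $ j))"
      using sums_Re[OF hermite_kernel_sums[of "of_real \<rho>" z z]] \<rho>
      by (simp add: mult.commute flip: of_real_power of_real_mult)
    then show "summable (\<lambda>k. \<rho> ^ k * hermite_kernel k z z)" by (rule sums_summable)
    have "Re (\<Prod>j\<in>UNIV. mehler (of_real \<rho>) (z $ j) (z $ j)) \<le> norm (\<Prod>j\<in>UNIV. mehler (of_real \<rho>) (z $ j) (z $ j))"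
      by (rule complex_Re_le_cmod)
    also have "\<dots> = mehler_prod_majorant (of_real \<rho>) z z" by (rule norm_prod_mehler) (use \<rho> in simp)
    also have "\<dots> \<le> ?B" using prod_sup[of z z] \<rho> by simp
    finally show "(\<Sum>k. \<rho> ^ k * hermite_kernel k z z) \<le> ?B" using sums_unique[OF s] by simp
  qed
  have le: "\<rho> ^ k * \<bar>hermite_kernel k x y\<bar> \<le> (\<rho> ^ k * hermite_kernel k x x) / 2 + (\<rho> ^ k * hermite_kernel k y y) / 2" for k
    using mult_left_mono[OF hermite_kernel_le_diag[of k x y], of "\<rho> ^ k"] \<rho> by (simp add: field_simps)
  have sm: "summable (\<lambda>k. (\<rho> ^ k * hermite_kernel k x x) / 2 + (\<rho> ^ k * hermite_kernel k y y) / 2)"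
    by (intro summable_add summable_divide diag)
  show 1: "summable (\<lambda>k. \<rho> ^ k * \<bar>hermite_kernel k x y\<bar>)"
    by (rule summable_comparison_test'[OF sm, of 0]) (use le \<rho> in auto)
  have "(\<Sum>k. \<rho> ^ k * \<bar>hermite_kernel k x y\<bar>) \<le> (\<Sum>k. (\<rho> ^ k * hermite_kernel k x x) / 2 + (\<rho> ^ k * hermite_kernel k y y) / 2)"
    by (rule suminf_le[OF le 1 sm])
  also have "\<dots> = (\<Sum>k. \<rho> ^ k * hermite_kernel k x x) / 2 + (\<Sum>k. \<rho> ^ k * hermite_kernel k y y) / 2"
    by (simp add: suminf_add[symmetric] suminf_divide diag(1) summable_divide)
  also have "\<dots> \<le> ?B" using diag(2)[of x] diag(2)[of y] by linarith
  finally show "(\<Sum>k. \<rho> ^ k * \<bar>hermite_kernel k x y\<bar>) \<le> ?B" .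
qed

lemma inverse_one_minus_exp_le:
  fixes a s :: real
  assumes a: "0 < a" and s: "0 < s" "s \<le> 1"
  shows "1 / (1 - exp (- 2 * (s * a))) \<le> (1 + 1 / a) / s"
proof -
  define u where "u = 2 * (s * a)"
  have u: "0 < u" using a s by (simp add: u_def)
  have "1 + u \<le> exp u" by (rule exp_ge_add_one_self)
  then have "exp (- u) \<le> 1 / (1 + u)" using u by (simp add: exp_minus divide_simps)
  then have "u / (1 + u) \<le> 1 - exp (- u)" using u by (simp add: field_simps)
  then have "1 / (1 - exp (- u)) \<le> 1 / (u / (1 + u))" using u by (intro divide_left_mono mult_pos_pos) auto
  also have "\<dots> = 1 / u + 1" using u by (simp add: add_divide_distrib)
  also have "\<dots> \<le> 1 / (s * a) + 1 / s"
    using a s by (intro add_mono) (auto simp: u_def field_simps)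
  also have "\<dots> = (1 + 1 / a) / s" using a s by (simp add: field_simps)
  finally show ?thesis by (simp add: u_def)
qed

text \<open>
  Inserting the integral representation of \<open>F\<close> into the Hermite expansion and summing
  under the integral gives, for each \<open>\<omega>\<close>, the Mehler kernel at the point $r =
  e^{-2s\zeta(\omega)}$, up to the harmless factor $e^{-sd\zeta(\omega)}$. The row and column
  integrals of its modulus are bounded, while its supremum and its mass are of order $(1-|r|)^{-d/2}
  \lesssim (1 + 1/\mathrm{Re}\,\zeta(\omega))^d s^{-d/2}$, which is why the weight in the hypothesis
  contains the power $d$ of $1 + 1/\mathrm{Re}\,\zeta$.
\<close>

lemma laplace_multiplier_kernel:
  fixes M :: "'w measure" and w \<zeta> :: "'w \<Rightarrow> complex" and F :: "real \<Rightarrow> complex" and \<kappa> W s :: real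
  assumes sf: "sigma_finite_measure M"
    and [measurable]: "w \<in> borel_measurable M" "\<zeta> \<in> borel_measurable M"
    and \<kappa>: "0 \<le> \<kappa>" and sector: "\<And>\<omega>. w \<omega> \<noteq> 0 \<Longrightarrow> 0 < Re (\<zeta> \<omega>) \<and> \<bar>Im (\<zeta> \<omega>)\<bar> \<le> \<kappa> * Re (\<zeta> \<omega>)"
    and W: "(\<integral>\<^sup>+\<omega>. ennreal (norm (w \<omega>) * (1 + 1 / Re (\<zeta> \<omega>)) ^ CARD('n::finite)) \<partial>M) \<le> ennreal W" and W0: "0 \<le> W"
    and F: "\<And>l. 0 < l \<Longrightarrow> F l = (LINT \<omega>|M. w \<omega> * exp (- (\<zeta> \<omega> * of_real l)))"
    and s: "0 < s" "s \<le> 1"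
  defines "C \<equiv> (8 * (2 + \<kappa>)) ^ CARD('n) * W" and "D \<equiv> (8 * (2 + \<kappa>)) ^ CARD('n) * W * (1 / sqrt s) ^ CARD('n)"
  obtains J :: "real ^ 'n \<Rightarrow> real ^ 'n \<Rightarrow> ennreal" where "kernel_bounds J (ennreal C) (ennreal D)"
    "\<And>(x :: real ^ 'n) y. summable (\<lambda>k. F (s * (2 * real k + real CARD('n))) * of_real (hermite_kernel k x y))"
    "\<And>x y. ennreal (norm (\<Sum>k. F (s * (2 * real k + real CARD('n))) * of_real (hermite_kernel k x y))) \<le> J x y"
proof -
  let ?d = "CARD('n)"
  define r where "r \<omega> = exp (- 2 * (of_real s * \<zeta> \<omega>))" for \<omega>
  have [measurable]: "r \<in> borel_measurable M" unfolding r_def by measurable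
  define J where "J x y = (\<integral>\<^sup>+\<omega>. ennreal (norm (w \<omega>)) * ennreal (mehler_prod_majorant (r \<omega>) x y) \<partial>M)" for x y :: "real ^ 'n"
  have nr: "norm (r \<omega>) = exp (- 2 * (s * Re (\<zeta> \<omega>)))" for \<omega> by (simp add: r_def norm_exp_eq_Re)
  have stolz: "stolz_point (r \<omega>) (1 + \<kappa>)" if "w \<omega> \<noteq> 0" for \<omega>
  proof
    note z = sector[OF that]
    show "norm (r \<omega>) < 1" using z s by (simp add: nr)
    show "norm (1 - r \<omega>) \<le> (1 + \<kappa>) * (1 - norm (r \<omega>))"
      unfolding r_def using z s \<kappa> by (intro stolz_exp) (auto simp: abs_mult mult.left_commute)
  qed (use \<kappa> in auto)
  define A where "A = (8 * (2 + \<kappa>)) ^ ?d"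
  have A: "0 \<le> A" using \<kappa> by (simp add: A_def)
  define S where "S = (1 / sqrt s) ^ ?d"
  have S: "0 \<le> S" using s by (simp add: S_def)
  have CD: "C = A * W" "D = A * S * W" by (simp_all add: C_def D_def A_def S_def)
  define v where "v \<omega> = norm (w \<omega>) * (1 + 1 / Re (\<zeta> \<omega>)) ^ ?d" for \<omega>
  have v0: "0 \<le> v \<omega>" for \<omega>
    using sector[of \<omega>] by (cases "w \<omega> = 0") (auto simp: v_def)
  have vW: "(\<integral>\<^sup>+\<omega>. ennreal (v \<omega>) \<partial>M) \<le> ennreal W" using W by (simp add: v_def)
  have v1: "norm (w \<omega>) \<le> v \<omega>" for \<omega>
  proof (cases "w \<omega> = 0")
    case False
    then have "norm (w \<omega>) * 1 \<le> norm (w \<omega>) * (1 + 1 / Re (\<zeta> \<omega>)) ^ ?d"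
      using sector[OF False] by (intro mult_left_mono one_le_power) auto
    then show ?thesis by (simp add: v_def)
  qed (simp add: v_def)
  have gap: "(8 * sqrt ((2 + \<kappa>) / (1 - norm (r \<omega>)))) ^ ?d \<le> A * S * (1 + 1 / Re (\<zeta> \<omega>)) ^ ?d" if w: "w \<omega> \<noteq> 0" for \<omega>
  proof -
    define a where "a = Re (\<zeta> \<omega>)"
    have a: "0 < a" using sector[OF w] by (simp add: a_def)
    have i: "1 / (1 - norm (r \<omega>)) \<le> (1 + 1 / a) / s"
      using inverse_one_minus_exp_le[OF a s] by (simp add: nr a_def)
    have "(2 + \<kappa>) / (1 - norm (r \<omega>)) = (2 + \<kappa>) * (1 / (1 - norm (r \<omega>)))" by simp
    also have "\<dots> \<le> (2 + \<kappa>) * ((1 + 1 / a) / s)" using i \<kappa> by (intro mult_left_mono) auto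
    finally have "sqrt ((2 + \<kappa>) / (1 - norm (r \<omega>))) \<le> sqrt ((2 + \<kappa>) * ((1 + 1 / a) / s))" by simp
    also have "\<dots> = sqrt (2 + \<kappa>) * sqrt (1 + 1 / a) * (1 / sqrt s)" by (simp add: real_sqrt_mult real_sqrt_divide)
    also have "\<dots> \<le> (2 + \<kappa>) * (1 + 1 / a) * (1 / sqrt s)"
    proof (intro mult_right_mono mult_mono)
      have sq: "sqrt u \<le> u" if "1 \<le> u" for u :: real
        using that by (intro real_le_lsqrt) (auto simp: power2_eq_square)
      show "sqrt (2 + \<kappa>) \<le> 2 + \<kappa>" "sqrt (1 + 1 / a) \<le> 1 + 1 / a" using \<kappa> a by (auto intro!: sq)
    qed (use \<kappa> a s in auto)
    finally have h: "sqrt ((2 + \<kappa>) / (1 - norm (r \<omega>))) \<le> (2 + \<kappa>) * (1 + 1 / a) * (1 / sqrt s)" .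
    have "8 * sqrt ((2 + \<kappa>) / (1 - norm (r \<omega>))) \<le> 8 * ((2 + \<kappa>) * (1 + 1 / a) * (1 / sqrt s))"
      by (intro mult_left_mono h) simp
    also have "\<dots> = 8 * (2 + \<kappa>) * (1 / sqrt s) * (1 + 1 / a)" by (simp only: mult_ac)
    finally have "(8 * sqrt ((2 + \<kappa>) / (1 - norm (r \<omega>)))) ^ ?d \<le> (8 * (2 + \<kappa>) * (1 / sqrt s) * (1 + 1 / a)) ^ ?d"
      using \<kappa> stolz_point.pos(3)[OF stolz[OF w]] by (intro power_mono) auto
    also have "\<dots> = A * S * (1 + 1 / a) ^ ?d" unfolding A_def S_def by (simp only: power_mult_distrib)
    finally show ?thesis by (simp add: a_def)
  qed
  have cmult: "(\<integral>\<^sup>+\<omega>. ennreal (c * v \<omega>) \<partial>M) \<le> ennreal (c * W)" if "0 \<le> c" for c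
  proof -
    have "(\<integral>\<^sup>+\<omega>. ennreal (c * v \<omega>) \<partial>M) = ennreal c * (\<integral>\<^sup>+\<omega>. ennreal (v \<omega>) \<partial>M)"
      using that v0 by (simp add: ennreal_mult nn_integral_cmult v_def)
    also have "\<dots> \<le> ennreal c * ennreal W" by (intro mult_left_mono vW) auto
    finally show ?thesis using that W0 by (simp add: ennreal_mult)
  qed
  have AS: "0 \<le> A * S" using A S by simp
  have bnd: "norm (w \<omega>) * (8 * sqrt ((1 + (1 + \<kappa>)) / (1 - norm (r \<omega>)))) ^ ?d \<le> A * S * v \<omega>" for \<omega>
  proof (cases "w \<omega> = 0")
    case False
    from mult_left_mono[OF gap[OF False], of "norm (w \<omega>)"] show ?thesis by (simp add: v_def mult_ac add.assoc[symmetric])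
  qed (use AS v0 in simp)
  have Jbounds: "kernel_bounds J (ennreal C) (ennreal D)"
    unfolding J_def
  proof (rule kernel_bounds_superposition[OF sf, where K = "\<lambda>\<omega> (x, y). ennreal (norm (w \<omega>)) * ennreal (mehler_prod_majorant (r \<omega>) x y)", unfolded prod.case])
    show "kernel_bounds (\<lambda>x y :: real ^ 'n. ennreal (norm (w \<omega>)) * ennreal (mehler_prod_majorant (r \<omega>) x y))
      (ennreal (A * v \<omega>)) (ennreal (A * S * v \<omega>))" for \<omega>
    proof (cases "w \<omega> = 0")
      case False
      show ?thesis
      proof (rule kernel_bounds_mono[OF kernel_bounds_cmult[OF stolz_point.prod_bounds[OF stolz[OF False]]]])
        have "norm (w \<omega>) * (2 * (1 + (1 + \<kappa>))) ^ ?d \<le> v \<omega> * A"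
          unfolding A_def using \<kappa> v0 by (intro mult_mono v1 power_mono) auto
        then show "ennreal (norm (w \<omega>)) * ennreal ((2 * (1 + (1 + \<kappa>))) ^ ?d) \<le> ennreal (A * v \<omega>)"
          using \<kappa> by (simp add: ennreal_mult[symmetric] mult.commute ennreal_leI)
        show "ennreal (norm (w \<omega>)) * ennreal ((8 * sqrt ((1 + (1 + \<kappa>)) / (1 - norm (r \<omega>)))) ^ ?d) \<le> ennreal (A * S * v \<omega>)"
          using bnd[of \<omega>] \<kappa> stolz_point.pos(3)[OF stolz[OF False]] by (subst ennreal_mult[symmetric]) (auto intro: ennreal_leI)
      qed
    qed (simp add: kernel_bounds_def)
    show "(\<integral>\<^sup>+\<omega>. ennreal (A * v \<omega>) \<partial>M) \<le> ennreal C" unfolding CD by (rule cmult[OF A])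
    show "(\<integral>\<^sup>+\<omega>. ennreal (A * S * v \<omega>) \<partial>M) \<le> ennreal D" unfolding CD by (rule cmult[OF AS])
  qed measurable
  have series: "summable (\<lambda>k. F (s * (2 * real k + real ?d)) * of_real (hermite_kernel k x y)) \<and>
      ennreal (norm (\<Sum>k. F (s * (2 * real k + real ?d)) * of_real (hermite_kernel k x y))) \<le> J x y" for x y :: "real ^ 'n"
  proof -
    define p where "p k = hermite_kernel k x y" for k
    define t where "t k = s * (2 * real k + real ?d)" for k
    have t0: "0 < t k" for k using s by (auto simp: t_def intro!: mult_pos_pos add_nonneg_pos)
    define f where "f k \<omega> = w \<omega> * exp (- (\<zeta> \<omega> * of_real (t k))) * of_real (p k)" for k \<omega>
    have [measurable]: "f k \<in> borel_measurable M" for k unfolding f_def by measurable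
    have split: "exp (- (\<zeta> \<omega> * of_real (t k))) = exp (- (\<zeta> \<omega> * of_real (s * ?d))) * r \<omega> ^ k" for k \<omega>
      unfolding r_def t_def exp_of_nat_mult[symmetric] exp_add[symmetric] by (simp add: algebra_simps)
    \<comment> \<open>the bottom eigenvalue \<open>d\<close> contributes a factor of modulus at most 1\<close>
    have damp: "norm (exp (- (\<zeta> \<omega> * of_real (s * ?d)))) \<le> 1" if "w \<omega> \<noteq> 0" for \<omega>
      using sector[OF that] s by (simp add: norm_exp_eq_Re)
    have nf: "norm (f k \<omega>) \<le> norm (w \<omega>) * (norm (r \<omega>) ^ k * \<bar>p k\<bar>)" for k \<omega>
    proof (cases "w \<omega> = 0")
      case False
      have "norm (f k \<omega>) = norm (w \<omega>) * (norm (exp (- (\<zeta> \<omega> * of_real (s * ?d)))) * (norm (r \<omega>) ^ k * \<bar>p k\<bar>))"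
        unfolding f_def split by (simp add: norm_mult norm_power)
      also have "\<dots> \<le> norm (w \<omega>) * (1 * (norm (r \<omega>) ^ k * \<bar>p k\<bar>))"
        by (intro mult_left_mono mult_right_mono damp[OF False]) auto
      finally show ?thesis by simp
    qed (simp add: f_def)
    have abs: "summable (\<lambda>k. norm (r \<omega>) ^ k * \<bar>p k\<bar>)"
        "(\<Sum>k. norm (r \<omega>) ^ k * \<bar>p k\<bar>) \<le> (8 * sqrt (2 / (1 - norm (r \<omega>)))) ^ ?d" if "w \<omega> \<noteq> 0" for \<omega>
      unfolding p_def using hermite_kernel_abs_summable[of "norm (r \<omega>)" x y] stolz_point.r1[OF stolz[OF that]] by auto
    have sumf: "summable (\<lambda>k. norm (f k \<omega>))" and sumf_le: "(\<Sum>k. norm (f k \<omega>)) \<le> A * S * v \<omega>" for \<omega>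
    proof -
      have "summable (\<lambda>k. norm (f k \<omega>)) \<and> (\<Sum>k. norm (f k \<omega>)) \<le> A * S * v \<omega>"
      proof (cases "w \<omega> = 0")
        case False
        note pos = stolz_point.pos(3)[OF stolz[OF False]]
        have sm: "summable (\<lambda>k. norm (w \<omega>) * (norm (r \<omega>) ^ k * \<bar>p k\<bar>))" by (intro summable_mult abs False)
        have sf: "summable (\<lambda>k. norm (f k \<omega>))"
          by (rule summable_comparison_test'[OF sm, of 0]) (use nf in auto)
        have "(\<Sum>k. norm (f k \<omega>)) \<le> (\<Sum>k. norm (w \<omega>) * (norm (r \<omega>) ^ k * \<bar>p k\<bar>))"
          by (rule suminf_le[OF nf sf sm])
        also have "\<dots> = norm (w \<omega>) * (\<Sum>k. norm (r \<omega>) ^ k * \<bar>p k\<bar>)" by (rule suminf_mult[OF abs(1)[OF False]])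
        also have "\<dots> \<le> norm (w \<omega>) * (8 * sqrt (2 / (1 - norm (r \<omega>)))) ^ ?d"
          by (intro mult_left_mono abs(2) False) auto
        also have "\<dots> \<le> norm (w \<omega>) * (8 * sqrt ((1 + (1 + \<kappa>)) / (1 - norm (r \<omega>)))) ^ ?d"
          using pos \<kappa> by (intro mult_left_mono power_mono real_sqrt_le_mono divide_right_mono) auto
        also have "\<dots> \<le> A * S * v \<omega>" by (rule bnd)
        finally show ?thesis using sf by simp
      qed (use AS v0 in \<open>simp add: f_def\<close>)
      then show "summable (\<lambda>k. norm (f k \<omega>))" "(\<Sum>k. norm (f k \<omega>)) \<le> A * S * v \<omega>" by auto
    qed
    \<comment> \<open>justifies the exchange of sum and integral\<close>
    have tot: "(\<Sum>k. \<integral>\<^sup>+\<omega>. ennreal (norm (f k \<omega>)) \<partial>M) < \<infinity>"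
    proof -
      have "(\<Sum>k. \<integral>\<^sup>+\<omega>. ennreal (norm (f k \<omega>)) \<partial>M) = (\<integral>\<^sup>+\<omega>. (\<Sum>k. ennreal (norm (f k \<omega>))) \<partial>M)"
        by (rule nn_integral_suminf[symmetric]) measurable
      also have "\<dots> = (\<integral>\<^sup>+\<omega>. ennreal (\<Sum>k. norm (f k \<omega>)) \<partial>M)"
        by (intro nn_integral_cong suminf_ennreal2 sumf) auto
      also have "\<dots> \<le> (\<integral>\<^sup>+\<omega>. ennreal (A * S * v \<omega>) \<partial>M)" by (intro nn_integral_mono ennreal_leI sumf_le)
      also have "\<dots> \<le> ennreal (A * S * W)" by (rule cmult[OF AS])
      also have "\<dots> < \<infinity>" by simp
      finally show ?thesis .
    qed
    have fint: "integrable M (f k)" for k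
    proof (rule integrableI_bounded)
      have "(\<integral>\<^sup>+\<omega>. ennreal (norm (f k \<omega>)) \<partial>M) \<le> (\<Sum>k. \<integral>\<^sup>+\<omega>. ennreal (norm (f k \<omega>)) \<partial>M)"
        using sum_le_suminf[of "\<lambda>k. \<integral>\<^sup>+\<omega>. ennreal (norm (f k \<omega>)) \<partial>M" "{k}"] by simp
      then show "(\<integral>\<^sup>+\<omega>. ennreal (norm (f k \<omega>)) \<partial>M) < \<infinity>" using tot by (rule le_less_trans)
    qed measurable
    have sumint: "summable (\<lambda>k. LINT \<omega>|M. norm (f k \<omega>))"
    proof (rule summable_suminf_not_top)
      have "(\<integral>\<^sup>+\<omega>. ennreal (norm (f k \<omega>)) \<partial>M) = ennreal (LINT \<omega>|M. norm (f k \<omega>))" for k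
        by (rule nn_integral_eq_integral) (use fint in auto)
      then show "(\<Sum>k. ennreal (LINT \<omega>|M. norm (f k \<omega>))) \<noteq> top" using tot by simp
    qed auto
    have AEs: "AE \<omega> in M. summable (\<lambda>k. norm (f k \<omega>))" using sumf by simp
    have Ff: "F (t k) * of_real (p k) = (LINT \<omega>|M. f k \<omega>)" for k
      unfolding F[OF t0] f_def by simp
    have sums: "(\<lambda>k. F (t k) * of_real (p k)) sums (LINT \<omega>|M. (\<Sum>k. f k \<omega>))"
      unfolding Ff by (rule sums_integral[OF fint AEs sumint])
    have "ennreal (norm (\<Sum>k. F (t k) * of_real (p k))) \<le> (\<integral>\<^sup>+\<omega>. ennreal (norm (\<Sum>k. f k \<omega>)) \<partial>M)"
      unfolding sums_unique[OF sums, symmetric]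
      by (rule integral_norm_bound_ennreal[OF integrable_suminf[OF fint AEs sumint]])
    also have "\<dots> \<le> J x y"
      unfolding J_def
    proof (rule nn_integral_mono)
      fix \<omega>
      have "norm (\<Sum>k. f k \<omega>) \<le> norm (w \<omega>) * mehler_prod_majorant (r \<omega>) x y"
      proof (cases "w \<omega> = 0")
        case False
        note r1 = stolz_point.r1[OF stolz[OF False]]
        have "(\<lambda>k. w \<omega> * exp (- (\<zeta> \<omega> * of_real (s * ?d))) * (of_real (hermite_kernel k x y) * r \<omega> ^ k))
            sums (w \<omega> * exp (- (\<zeta> \<omega> * of_real (s * ?d))) * (\<Prod>j\<in>UNIV. mehler (r \<omega>) (x $ j) (y $ j)))"
          by (intro sums_mult hermite_kernel_sums r1)
        then have "(\<lambda>k. f k \<omega>) sums (w \<omega> * exp (- (\<zeta> \<omega> * of_real (s * ?d))) * (\<Prod>j\<in>UNIV. mehler (r \<omega>) (x $ j) (y $ j)))"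
          unfolding f_def split p_def by (simp only: mult_ac)
        then have "norm (\<Sum>k. f k \<omega>) = norm (w \<omega>) * norm (exp (- (\<zeta> \<omega> * of_real (s * ?d)))) * mehler_prod_majorant (r \<omega>) x y"
          by (simp only: sums_unique[symmetric] norm_mult norm_prod_mehler[OF r1])
        also have "\<dots> \<le> norm (w \<omega>) * 1 * mehler_prod_majorant (r \<omega>) x y"
          by (intro mult_right_mono mult_left_mono damp[OF False] mehler_prod_majorant_nonneg) auto
        finally show ?thesis by simp
      qed (simp add: f_def)
      then show "ennreal (norm (\<Sum>k. f k \<omega>)) \<le> ennreal (norm (w \<omega>)) * ennreal (mehler_prod_majorant (r \<omega>) x y)"
        by (simp add: ennreal_mult[symmetric] ennreal_leI mehler_prod_majorant_nonneg)
    qed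
    finally show ?thesis using sums_summable[OF sums] by (simp add: t_def p_def)
  qed
  show ?thesis
    by (rule that[OF Jbounds series[THEN conjunct1] series[THEN conjunct2]])
qed

section \<open>The kernel of the fractional semigroup\<close>

lemma summable_fractional_heat_weights:
  fixes \<beta> t :: real
  assumes \<beta>: "0 < \<beta>" and t: "0 < t" and d: "0 \<le> d"
  shows "summable (\<lambda>k. exp (- t * (2 * real k + d) powr \<beta>) * (real k + 2) ^ N)"
proof -
  obtain C where C: "0 < C" "\<And>u. 0 \<le> u \<Longrightarrow> (1 + u) ^ (N + 2) * exp (- (t * u powr \<beta>)) \<le> C"
    using power_times_exp_powr_bounded[OF t \<beta>, of "N + 2"] by blast
  have le: "norm (exp (- t * (2 * real k + d) powr \<beta>) * (real k + 2) ^ N) \<le> (2 ^ N * C) * (1 / (real (k + 1))\<^sup>2)" for k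
  proof -
    define u where "u = 2 * real k + d"
    have u: "0 \<le> u" "real k + 1 \<le> 1 + u" "real k + 2 \<le> 2 * (1 + u)" using d by (auto simp: u_def)
    have "(real k + 2) ^ N * (real k + 1)\<^sup>2 \<le> (2 * (1 + u)) ^ N * (1 + u)\<^sup>2"
      using u by (intro mult_mono power_mono) auto
    also have "\<dots> = 2 ^ N * (1 + u) ^ (N + 2)" by (simp only: power_mult_distrib power_add mult.assoc)
    finally have "exp (- (t * u powr \<beta>)) * ((real k + 2) ^ N * (real k + 1)\<^sup>2) \<le> exp (- (t * u powr \<beta>)) * (2 ^ N * (1 + u) ^ (N + 2))"
      by (intro mult_left_mono) auto
    also have "\<dots> = 2 ^ N * ((1 + u) ^ (N + 2) * exp (- (t * u powr \<beta>)))" by (simp only: mult_ac)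
    also have "\<dots> \<le> 2 ^ N * C" by (intro mult_left_mono C u) auto
    finally have "exp (- (t * u powr \<beta>)) * (real k + 2) ^ N * (real k + 1)\<^sup>2 \<le> 2 ^ N * C" by (simp only: mult.assoc)
    then have "exp (- (t * u powr \<beta>)) * (real k + 2) ^ N \<le> 2 ^ N * C / (real k + 1)\<^sup>2"
      by (subst pos_le_divide_eq) auto
    then show ?thesis by (simp add: u_def add.commute)
  qed
  have "summable (\<lambda>k. 1 / (real (k + 1))\<^sup>2)"
    using inverse_power_summable[of 2, where 'a = real] by (subst summable_iff_shift[of _ 1]) (simp add: inverse_eq_divide)
  from summable_mult[OF this, of "2 ^ N * C"] show ?thesis
    by (rule summable_comparison_test'[of _ 0]) (rule le)
qed

lemma hermite_fun_continuous: "continuous_on UNIV (hermite_fun k)"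
proof -
  have "hermite_fun k = (\<lambda>s. (sqrt pi * 2 ^ k * fact k) powr (- 1 / 2) * (- 1) ^ k * exp (s\<^sup>2 / 2) * gauss_deriv k s)"
    by (auto simp: hermite_fun_def deriv_funpow_gauss)
  moreover have "continuous_on UNIV (gauss_deriv k)"
    by (intro DERIV_continuous_on) (auto intro: gauss_deriv_has_derivative)
  ultimately show ?thesis by (auto intro!: continuous_intros)
qed

lemma hermite_Phi_measurable[measurable]: "hermite_Phi \<alpha> \<in> borel_measurable borel"
proof -
  have [measurable]: "hermite_fun k \<in> borel_measurable borel" for k
    by (rule borel_measurable_continuous_onI[OF hermite_fun_continuous])
  have "hermite_Phi \<alpha> = (\<lambda>x. \<Prod>j\<in>UNIV. hermite_fun (\<alpha> j) (x $ j))" by (auto simp: hermite_Phi_def)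
  then show ?thesis by simp
qed

lemma hermite_kernel_measurable[measurable]:
  "(\<lambda>z. hermite_kernel k (f z) (g z)) \<in> borel_measurable M"
  if [measurable]: "f \<in> borel_measurable M" "g \<in> borel_measurable M"
  unfolding hermite_kernel_def by measurable

lemma decay_weight_measurable[measurable]: "decay_weight \<in> borel_measurable borel"
  unfolding decay_weight_def by measurable

lemma borel_measurable_lebesgueI: "g \<in> borel_measurable borel \<Longrightarrow> g \<in> borel_measurable lebesgue"
  by (simp add: measurable_completion)

lemma decay_weight_integrable: "integrable lebesgue (decay_weight :: real ^ 'n::finite \<Rightarrow> real)"
proof -
  have "integrable lborel (decay_weight :: real ^ 'n \<Rightarrow> real)"
    by (rule integrableI_bounded) (simp_all add: decay_weight_nonneg nn_integral_decay_weight)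
  then show ?thesis by (subst integrable_completion) auto
qed

text \<open>
  Makes the Hermite coefficients of every $f \in L^p$ absolutely convergent. For finite $p$ the
  bound is $|f| W \le W + |f|^p$, from $0 \le W \le 1$ and $p \ge 1$.
\<close>

lemma Lp_decay_weight_integrable:
  fixes f :: "real ^ 'n::finite \<Rightarrow> complex"
  assumes f: "f \<in> Lp_space p" and p: "1 \<le> p"
  shows "integrable lebesgue (\<lambda>y. cmod (f y) * decay_weight y)"
proof -
  have [measurable]: "f \<in> borel_measurable lebesgue" using f by (auto simp: Lp_space_def)
  have [measurable]: "(decay_weight :: real ^ 'n \<Rightarrow> real) \<in> borel_measurable lebesgue"
    by (intro borel_measurable_lebesgueI decay_weight_measurable)
  show ?thesis
  proof (cases "p = \<infinity>")
    case True
    define n where "n = Lp_norm p f"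
    have fin: "esssup lebesgue (\<lambda>x. ennreal (cmod (f x))) < \<infinity>" using f True by (auto simp: Lp_space_def)
    have "AE y in lebesgue. ennreal (cmod (f y)) \<le> esssup lebesgue (\<lambda>x. ennreal (cmod (f x)))" by (rule esssup_AE)
    then have ae: "AE y in lebesgue. norm (cmod (f y) * decay_weight y) \<le> norm (n * decay_weight y)"
    proof eventually_elim
      case (elim y)
      then have "ennreal (cmod (f y)) \<le> ennreal n" using fin True by (simp add: n_def Lp_norm_def)
      then have "cmod (f y) \<le> n" using Lp_norm_nonneg[of p f] by (simp add: n_def)
      then show ?case using Lp_norm_nonneg[of p f]
        by (auto simp: n_def abs_mult decay_weight_nonneg intro!: mult_right_mono)
    qed
    show ?thesis
      by (rule Bochner_Integration.integrable_bound[OF _ _ ae]) (auto intro: decay_weight_integrable)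
  next
    case False
    define P where "P = enn2real p"
    have P: "1 \<le> P" using p False by (cases p) (auto simp: P_def)
    have int: "integrable lebesgue (\<lambda>y. decay_weight y + cmod (f y) powr P)"
      using f False by (intro Bochner_Integration.integrable_add decay_weight_integrable) (auto simp: Lp_space_def P_def)
    show ?thesis
    proof (rule Bochner_Integration.integrable_bound[OF int])
      show "AE y in lebesgue. norm (cmod (f y) * decay_weight y) \<le> norm (decay_weight y + cmod (f y) powr P)"
      proof (rule AE_I2)
        fix y
        have "cmod (f y) * decay_weight y \<le> decay_weight y + cmod (f y) powr P"
        proof (cases "cmod (f y) \<le> 1")
          case True
          then have "cmod (f y) * decay_weight y \<le> 1 * decay_weight y" by (intro mult_right_mono decay_weight_nonneg)
          then show ?thesis by (simp add: add_increasing2)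
        next
          case False
          have "cmod (f y) * decay_weight y \<le> cmod (f y) * 1" by (intro mult_left_mono decay_weight_le_1) auto
          also have "\<dots> \<le> cmod (f y) powr P" using False powr_mono[of 1 P "cmod (f y)"] P by simp
          finally show ?thesis using decay_weight_nonneg[of y] by linarith
        qed
        then show "norm (cmod (f y) * decay_weight y) \<le> norm (decay_weight y + cmod (f y) powr P)"
          by (simp add: decay_weight_nonneg abs_mult)
      qed
    qed measurable
  qed
qed

definition heat_kernel :: "real \<Rightarrow> real \<Rightarrow> real ^ 'n::finite \<Rightarrow> real ^ 'n \<Rightarrow> real" where
  "heat_kernel \<beta> t x y = (\<Sum>k. exp (- t * (2 * real k + real CARD('n)) powr \<beta>) * hermite_kernel k x y)"

lemma heat_kernel_series:
  fixes x y :: "real ^ 'n::finite"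
  assumes \<beta>: "0 < \<beta>" and t: "0 < t"
  shows "summable (\<lambda>k. \<bar>exp (- t * (2 * real k + real CARD('n)) powr \<beta>) * hermite_kernel k x y\<bar>)"
    and "(\<Sum>k. \<bar>exp (- t * (2 * real k + real CARD('n)) powr \<beta>) * hermite_kernel k x y\<bar>)
      \<le> 49 ^ CARD('n) * (\<Sum>k. exp (- t * (2 * real k + real CARD('n)) powr \<beta>) * (real k + 2) ^ (5 * CARD('n))) * (decay_weight x * decay_weight y)"
proof -
  let ?e = "\<lambda>k. exp (- t * (2 * real k + real CARD('n)) powr \<beta>)"
  let ?c = "49 ^ CARD('n) * (decay_weight x * decay_weight y)"
  have s: "summable (\<lambda>k. ?e k * (real k + 2) ^ (5 * CARD('n)))"
    by (rule summable_fractional_heat_weights[OF \<beta> t]) simp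
  have le: "\<bar>?e k * hermite_kernel k x y\<bar> \<le> ?c * (?e k * (real k + 2) ^ (5 * CARD('n)))" for k
  proof -
    have "\<bar>?e k * hermite_kernel k x y\<bar> = ?e k * \<bar>hermite_kernel k x y\<bar>" by (simp add: abs_mult)
    also have "\<dots> \<le> ?e k * (49 ^ CARD('n) * (real k + 2) ^ (5 * CARD('n)) * (decay_weight x * decay_weight y))"
      by (intro mult_left_mono hermite_kernel_bound) auto
    also have "\<dots> = ?c * (?e k * (real k + 2) ^ (5 * CARD('n)))" by (simp only: mult_ac)
    finally show ?thesis .
  qed
  have s2: "summable (\<lambda>k. ?c * (?e k * (real k + 2) ^ (5 * CARD('n))))" by (intro summable_mult s)
  show 1: "summable (\<lambda>k. \<bar>?e k * hermite_kernel k x y\<bar>)"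
    by (rule summable_comparison_test'[OF s2, of 0]) (use le in auto)
  have "(\<Sum>k. \<bar>?e k * hermite_kernel k x y\<bar>) \<le> (\<Sum>k. ?c * (?e k * (real k + 2) ^ (5 * CARD('n))))"
    by (rule suminf_le[OF le 1 s2])
  also have "\<dots> = ?c * (\<Sum>k. ?e k * (real k + 2) ^ (5 * CARD('n)))" by (rule suminf_mult[OF s])
  finally show "(\<Sum>k. \<bar>?e k * hermite_kernel k x y\<bar>)
      \<le> 49 ^ CARD('n) * (\<Sum>k. ?e k * (real k + 2) ^ (5 * CARD('n))) * (decay_weight x * decay_weight y)"
    by (simp only: mult_ac)
qed

lemma hermite_proj_eq_integral:
  fixes f :: "real ^ 'n::finite \<Rightarrow> complex"
  assumes f: "f \<in> Lp_space p" and p: "1 \<le> p"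
  shows "integrable lebesgue (\<lambda>y. f y * of_real (hermite_kernel k x y))"
    and "hermite_proj k f x = (LINT y|lebesgue. f y * of_real (hermite_kernel k x y))"
proof -
  have [measurable]: "f \<in> borel_measurable lebesgue" using f by (auto simp: Lp_space_def)
  have [measurable]: "hermite_Phi \<alpha> \<in> borel_measurable lebesgue" for \<alpha> :: "'n \<Rightarrow> nat"
    by (intro borel_measurable_lebesgueI hermite_Phi_measurable)
  have int: "integrable lebesgue (\<lambda>y. f y * of_real (hermite_Phi \<alpha> y))" for \<alpha>
  proof (rule Bochner_Integration.integrable_bound)
    define b where "b = (7 * (real (\<Sum>j\<in>UNIV. \<alpha> j) + 2)\<^sup>2) ^ CARD('n)"
    show "integrable lebesgue (\<lambda>y. b * (cmod (f y) * decay_weight y))"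
      by (intro Bochner_Integration.integrable_mult_right Lp_decay_weight_integrable[OF f p])
    show "AE y in lebesgue. norm (f y * of_real (hermite_Phi \<alpha> y)) \<le> norm (b * (cmod (f y) * decay_weight y))"
    proof (rule AE_I2)
      fix y
      have "cmod (f y) * \<bar>hermite_Phi \<alpha> y\<bar> \<le> cmod (f y) * (b * decay_weight y)"
        unfolding b_def by (intro mult_left_mono hermite_Phi_bound) auto
      also have "\<dots> = b * (cmod (f y) * decay_weight y)" by simp
      also have "\<dots> \<le> norm (b * (cmod (f y) * decay_weight y))" by simp
      finally show "norm (f y * of_real (hermite_Phi \<alpha> y)) \<le> norm (b * (cmod (f y) * decay_weight y))"
        by (simp add: norm_mult)
    qed
  qed measurable
  have eq: "f y * of_real (hermite_kernel k x y) = (\<Sum>\<alpha> | (\<Sum>j\<in>UNIV. \<alpha> j) = k. (f y * of_real (hermite_Phi \<alpha> y)) * of_real (hermite_Phi \<alpha> x))" for y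
    by (simp add: hermite_kernel_def sum_distrib_left mult_ac)
  show "integrable lebesgue (\<lambda>y. f y * of_real (hermite_kernel k x y))"
    unfolding eq by (intro Bochner_Integration.integrable_sum Bochner_Integration.integrable_mult_left int)
  show "hermite_proj k f x = (LINT y|lebesgue. f y * of_real (hermite_kernel k x y))"
    unfolding eq hermite_proj_def hermite_coeff_def
    by (subst Bochner_Integration.integral_sum) (auto intro!: Bochner_Integration.integrable_mult_left int)
qed

text \<open>
  The Hermite expansion of $e^{-tH^\beta}f$ and the integral against $f$ may be interchanged, since
  the projection kernels grow polynomially in \<open>k\<close> while the coefficients decay faster
  than any power.
\<close>

lemma frac_heat_kernel_bound:
  fixes f :: "real ^ 'n::finite \<Rightarrow> complex"
  assumes \<beta>: "0 < \<beta>" and t: "0 < t" and f: "f \<in> Lp_space p" and p: "1 \<le> p"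
  shows "ennreal (cmod (frac_heat \<beta> t f x)) \<le> (\<integral>\<^sup>+y. ennreal \<bar>heat_kernel \<beta> t x y\<bar> * ennreal (cmod (f y)) \<partial>lebesgue)"
proof -
  define e where "e k = exp (- t * (2 * real k + real CARD('n)) powr \<beta>)" for k
  define g where "g k y = complex_of_real (e k) * (f y * of_real (hermite_kernel k x y))" for k y
  have gint: "integrable lebesgue (g k)" for k
    unfolding g_def by (intro Bochner_Integration.integrable_mult_right hermite_proj_eq_integral[OF f p])
  have ng: "norm (g k y) = cmod (f y) * \<bar>e k * hermite_kernel k x y\<bar>" for k y
    by (simp add: g_def norm_mult abs_mult e_def mult_ac)
  have AEs: "AE y in lebesgue. summable (\<lambda>k. norm (g k y))"
    unfolding ng e_def by (intro AE_I2 summable_mult heat_kernel_series[OF \<beta> t])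
  define b where "b k = e k * (49 ^ CARD('n) * (real k + 2) ^ (5 * CARD('n)))" for k
  have sumint: "summable (\<lambda>k. LINT y|lebesgue. norm (g k y))"
  proof (rule summable_comparison_test'[of _ 0])
    let ?I = "LINT y|lebesgue. cmod (f y) * decay_weight y"
    show "summable (\<lambda>k. (49 ^ CARD('n) * ?I) * (e k * (real k + 2) ^ (5 * CARD('n))))"
      unfolding e_def by (intro summable_mult summable_fractional_heat_weights \<beta> t) simp
    fix k
    have "(LINT y|lebesgue. norm (g k y)) \<le> (LINT y|lebesgue. b k * (cmod (f y) * decay_weight y))"
    proof (rule integral_mono)
      fix y
      have "\<bar>e k * hermite_kernel k x y\<bar> = e k * \<bar>hermite_kernel k x y\<bar>" by (simp add: abs_mult e_def)
      also have "\<dots> \<le> e k * (49 ^ CARD('n) * (real k + 2) ^ (5 * CARD('n)) * (1 * decay_weight y))"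
        by (intro mult_left_mono order_trans[OF hermite_kernel_bound] mult_right_mono decay_weight_le_1 decay_weight_nonneg) (auto simp: e_def)
      also have "\<dots> = b k * decay_weight y" by (simp add: b_def)
      finally have "cmod (f y) * \<bar>e k * hermite_kernel k x y\<bar> \<le> cmod (f y) * (b k * decay_weight y)" by (intro mult_left_mono) auto
      then show "norm (g k y) \<le> b k * (cmod (f y) * decay_weight y)" unfolding ng by (simp only: mult_ac)
    qed (use gint Lp_decay_weight_integrable[OF f p] in \<open>auto intro!: Bochner_Integration.integrable_mult_right\<close>)
    also have "\<dots> = b k * ?I" by simp
    also have "\<dots> = (49 ^ CARD('n) * ?I) * (e k * (real k + 2) ^ (5 * CARD('n)))" by (simp add: b_def mult_ac)
    finally show "norm (LINT y|lebesgue. norm (g k y)) \<le> (49 ^ CARD('n) * ?I) * (e k * (real k + 2) ^ (5 * CARD('n)))"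
      by (simp add: integral_nonneg_AE)
  qed
  have "frac_heat \<beta> t f x = (\<Sum>k. LINT y|lebesgue. g k y)"
    unfolding frac_heat_def hermite_proj_eq_integral(2)[OF f p] g_def e_def by simp
  also have "\<dots> = (LINT y|lebesgue. (\<Sum>k. g k y))"
    by (rule integral_suminf[OF gint AEs sumint, symmetric])
  finally have E: "ennreal (cmod (frac_heat \<beta> t f x)) = ennreal (norm (LINT y|lebesgue. (\<Sum>k. g k y)))" by simp
  have G: "(\<Sum>k. g k y) = f y * of_real (heat_kernel \<beta> t x y)" for y
  proof -
    have "(\<lambda>k. e k * hermite_kernel k x y) sums heat_kernel \<beta> t x y"
      unfolding heat_kernel_def e_def
      by (rule summable_sums) (rule summable_rabs_cancel[OF heat_kernel_series(1)[OF \<beta> t]])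
    then have "(\<lambda>k. f y * of_real (e k * hermite_kernel k x y)) sums (f y * of_real (heat_kernel \<beta> t x y))"
      by (intro sums_mult sums_of_real)
    then show ?thesis by (simp add: g_def sums_iff mult_ac)
  qed
  have "ennreal (cmod (frac_heat \<beta> t f x)) \<le> (\<integral>\<^sup>+y. ennreal (norm (\<Sum>k. g k y)) \<partial>lebesgue)"
    unfolding E by (rule integral_norm_bound_ennreal[OF integrable_suminf[OF gint AEs sumint]])
  then show ?thesis unfolding G by (simp add: norm_mult ennreal_mult mult.commute)
qed

lemma frac_heat_measurable:
  "frac_heat \<beta> t f \<in> borel_measurable lebesgue"
proof -
  have "frac_heat \<beta> t f \<in> borel_measurable borel"
    unfolding frac_heat_def hermite_proj_def by measurable
  then show ?thesis by (rule borel_measurable_lebesgueI)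
qed

text \<open>
  The eigenvalues are at least \<open>d\<close>, so passing from time $1$ to time \<open>t\<close>
  multiplies each coefficient by at most $e^{-(t-1)d^\beta}$. At time $1$ the series is dominated by
  a convergent one times $W(x) W(y)$.
\<close>

lemma heat_kernel_large_time:
  fixes \<beta> :: real
  assumes \<beta>: "0 < \<beta>"
  obtains C where "0 < C" "\<And>t (x :: real ^ 'n::finite) y. 1 \<le> t \<Longrightarrow>
    \<bar>heat_kernel \<beta> t x y\<bar> \<le> C * exp (- t * real CARD('n) powr \<beta>) * (decay_weight x * decay_weight y)"
proof -
  let ?d = "real CARD('n)"
  define e where "e t k = exp (- t * (2 * real k + ?d) powr \<beta>)" for t k
  define S where "S = (\<Sum>k. e 1 k * (real k + 2) ^ (5 * CARD('n)))"
  have sS: "summable (\<lambda>k. e 1 k * (real k + 2) ^ (5 * CARD('n)))"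
    unfolding e_def by (rule summable_fractional_heat_weights[OF \<beta>]) auto
  have S: "0 < S" unfolding S_def by (rule suminf_pos[OF sS]) (simp add: e_def)
  define C where "C = exp (?d powr \<beta>) * (49 ^ CARD('n) * S)"
  show ?thesis
  proof (rule that[of C])
    show "0 < C" using S by (simp add: C_def)
    fix t :: real and x y :: "real ^ 'n" assume t: "1 \<le> t"
    define E where "E = exp (- t * ?d powr \<beta>) * exp (?d powr \<beta>)"
    note s1 = heat_kernel_series[OF \<beta> zero_less_one, of x y, folded e_def]
    have t0: "0 < t" using t by simp
    note st = heat_kernel_series[OF \<beta> t0, of x y, folded e_def]
    have le: "\<bar>e t k * hermite_kernel k x y\<bar> \<le> E * \<bar>e 1 k * hermite_kernel k x y\<bar>" for k
    proof -
      have "?d powr \<beta> \<le> (2 * real k + ?d) powr \<beta>" using \<beta> by (intro powr_mono2) auto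
      then have "(t - 1) * ?d powr \<beta> \<le> (t - 1) * (2 * real k + ?d) powr \<beta>" using t by (intro mult_left_mono) auto
      then have "- t * (2 * real k + ?d) powr \<beta> \<le> - t * ?d powr \<beta> + ?d powr \<beta> + - 1 * (2 * real k + ?d) powr \<beta>"
        by (simp add: algebra_simps)
      then have "e t k \<le> E * e 1 k" unfolding e_def E_def exp_add[symmetric] by simp
      then have "e t k * \<bar>hermite_kernel k x y\<bar> \<le> E * e 1 k * \<bar>hermite_kernel k x y\<bar>" by (intro mult_right_mono) auto
      then show ?thesis by (simp add: abs_mult e_def mult.assoc)
    qed
    have "\<bar>heat_kernel \<beta> t x y\<bar> \<le> (\<Sum>k. \<bar>e t k * hermite_kernel k x y\<bar>)"
      unfolding heat_kernel_def e_def[symmetric] by (rule summable_rabs[OF st(1)])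
    also have "\<dots> \<le> (\<Sum>k. E * \<bar>e 1 k * hermite_kernel k x y\<bar>)"
      by (rule suminf_le[OF le st(1) summable_mult[OF s1(1)]])
    also have "\<dots> = E * (\<Sum>k. \<bar>e 1 k * hermite_kernel k x y\<bar>)" by (rule suminf_mult[OF s1(1)])
    also have "\<dots> \<le> E * (49 ^ CARD('n) * S * (decay_weight x * decay_weight y))"
      using s1(2) by (intro mult_left_mono) (auto simp: S_def E_def)
    also have "\<dots> = C * exp (- t * ?d powr \<beta>) * (decay_weight x * decay_weight y)"
      unfolding C_def E_def by (simp only: mult_ac)
    finally show "\<bar>heat_kernel \<beta> t x y\<bar> \<le> C * exp (- t * ?d powr \<beta>) * (decay_weight x * decay_weight y)" .
  qed
qed

text \<open>
  Multiplying the density of rate $1$ by $e^{-xl}$ gives, up to the factor $(1+l)^{-(m+1)}$, the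
  density of rate $1 + l$, which has total mass one.
\<close>

lemma erlang_laplace:
  assumes l: "0 \<le> l"
  shows "integrable lborel (\<lambda>x. erlang_density m 1 x * exp (- (x * l)))"
    and "(LINT x|lborel. erlang_density m 1 x * exp (- (x * l))) = 1 / (1 + l) ^ (m + 1)"
proof -
  have l1: "0 < 1 + l" using l by simp
  interpret prob_space "density lborel (erlang_density m (1 + l))" by (rule prob_space_erlang_density[OF l1])
  have "(\<integral>\<^sup>+x. ennreal (erlang_density m (1 + l) x) \<partial>lborel) = 1"
    using emeasure_space_1 by (simp add: emeasure_density)
  then have "has_bochner_integral lborel (erlang_density m (1 + l)) 1"
    using l1 by (intro has_bochner_integral_nn_integral) auto
  then have "has_bochner_integral lborel (\<lambda>x. erlang_density m (1 + l) x / (1 + l) ^ (m + 1)) (1 / (1 + l) ^ (m + 1))"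
    by (intro has_bochner_integral_divide)
  moreover have "erlang_density m (1 + l) x / (1 + l) ^ (m + 1) = erlang_density m 1 x * exp (- (x * l))" for x
  proof -
    have "exp (- (1 + l) * x) = exp (- x) * exp (- (x * l))" by (simp add: exp_add[symmetric] algebra_simps)
    then show ?thesis using l1 by (simp add: erlang_density_def)
  qed
  ultimately have "has_bochner_integral lborel (\<lambda>x. erlang_density m 1 x * exp (- (x * l))) (1 / (1 + l) ^ (m + 1))"
    by (simp only:)
  then show "integrable lborel (\<lambda>x. erlang_density m 1 x * exp (- (x * l)))"
    "(LINT x|lborel. erlang_density m 1 x * exp (- (x * l))) = 1 / (1 + l) ^ (m + 1)"
    by (auto simp only: has_bochner_integral_iff)
qed

text \<open>
  The zero of order \<open>m\<close> of the density at the origin absorbs the singularity of order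
  \<open>n\<close>.
\<close>

lemma erlang_weight_finite:
  assumes nm: "n \<le> m" and m: "0 < m"
  obtains V where "0 \<le> V" "(\<integral>\<^sup>+x. ennreal (erlang_density m 1 x * (1 + 1 / x) ^ n) \<partial>lborel) \<le> ennreal V"
proof -
  have "\<exists>C>0. \<forall>u\<ge>0. (1 + u) ^ m * exp (- (1 / 2 * u powr 1)) \<le> (C :: real)"
    by (rule power_times_exp_powr_bounded) auto
  then obtain C :: real where C: "0 < C" "\<And>u. 0 \<le> u \<Longrightarrow> (1 + u) ^ m * exp (- (1 / 2 * u powr 1)) \<le> C"
    by blast
  have "(\<integral>\<^sup>+x. ennreal (erlang_density m 1 x * (1 + 1 / x) ^ n) \<partial>lborel) \<le> (\<integral>\<^sup>+x. ennreal (C * (indicator {0<..} x *\<^sub>R exp (- (1 / 2 * x)))) \<partial>lborel)"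
  proof (intro nn_integral_mono ennreal_leI)
    fix x :: real
    consider "x < 0" | "x = 0" | "0 < x" by linarith
    then show "erlang_density m 1 x * (1 + 1 / x) ^ n \<le> C * (indicator {0<..} x *\<^sub>R exp (- (1 / 2 * x)))"
    proof cases
      case 3
      have "x ^ m * (1 + 1 / x) ^ n = x ^ (m - n) * (x * (1 + 1 / x)) ^ n"
        using nm by (simp add: power_mult_distrib power_add[symmetric] mult.assoc[symmetric])
      also have "x * (1 + 1 / x) = 1 + x" using 3 by (simp add: field_simps)
      also have "x ^ (m - n) * (1 + x) ^ n \<le> (1 + x) ^ (m - n) * (1 + x) ^ n" using 3 by (intro mult_right_mono power_mono) auto
      also have "\<dots> = (1 + x) ^ m" using nm by (simp add: power_add[symmetric])
      finally have 1: "x ^ m * (1 + 1 / x) ^ n \<le> (1 + x) ^ m" .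
      have "exp (- (1 / 2 * x)) * exp (- (1 / 2 * x)) = exp (- x)" by (simp add: exp_add[symmetric])
      then have "erlang_density m 1 x * (1 + 1 / x) ^ n = (x ^ m * (1 + 1 / x) ^ n) * exp (- (1 / 2 * x)) * exp (- (1 / 2 * x)) / fact m"
        using 3 by (simp add: erlang_density_def mult_ac)
      also have "\<dots> \<le> (1 + x) ^ m * exp (- (1 / 2 * x)) * exp (- (1 / 2 * x)) / 1"
        using 1 3 by (intro frac_le mult_right_mono) auto
      also have "\<dots> \<le> C * exp (- (1 / 2 * x))" using C(2)[of x] 3 by simp
      finally show ?thesis using 3 by simp
    qed (use m in \<open>auto simp: erlang_density_def zero_power\<close>)
  qed
  also have "\<dots> = ennreal (LINT x|lborel. C * (indicator {0<..} x *\<^sub>R exp (- (1 / 2 * x))))"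
    using exp_decay_integral_real(1)[of "1 / 2"] C(1)
    by (intro nn_integral_eq_integral Bochner_Integration.integrable_mult_right) (auto simp: set_integrable_def)
  also have "\<dots> = ennreal (C * 2)"
    using exp_decay_integral_real(2)[of "1 / 2"] by (simp add: set_lebesgue_integral_def)
  finally show ?thesis using C(1) by (intro that[of "C * 2"]) auto
qed

text \<open>
  By homogeneity, $e^{-t\lambda^\beta} = e^{-(s\lambda)^\beta}$ with $s = t^{1/\beta}$, so the
  symbol is always the same and only the scale changes. Dividing the representation of
  $e^{-l^\beta}(1+l)^{d+1} - 1/(1+l)$ by $(1+l)^{d+1}$ writes $e^{-l^\beta}$ as $\mathrm{Im}\,
  F_1(l) + F_2(l)$, where \<open>F1\<close> is a superposition of exponentials with parameters
  $(1+i\eta)t + x$, the ray variable \<open>t\<close> carrying the integrable density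
  \<open>\<rho>\<close> and \<open>x\<close> an Erlang density, and \<open>F2\<close> is a
  superposition over an Erlang density alone. The real part of the parameter is at least
  \<open>x\<close>, so the Erlang densities alone provide the integrability at the origin.
\<close>

lemma heat_kernel_small_time:
  fixes \<beta> :: real
  assumes \<beta>: "0 < \<beta>"
  obtains C where "0 < C" "\<And>t. 0 < t \<Longrightarrow> t \<le> 1 \<Longrightarrow> \<exists>J :: real ^ 'n::finite \<Rightarrow> real ^ 'n \<Rightarrow> ennreal.
    kernel_bounds J (ennreal C) (ennreal (C * (1 / sqrt (t powr (1 / \<beta>))) ^ CARD('n))) \<and>
    (\<forall>x y. ennreal \<bar>heat_kernel \<beta> t x y\<bar> \<le> J x y)"
proof -
  let ?d = "CARD('n)"
  obtain \<rho> :: "real \<Rightarrow> complex" and \<eta> :: real where \<eta>: "0 < \<eta>" and \<rho>: "integrable lborel \<rho>" "\<And>t. t \<le> 0 \<Longrightarrow> \<rho> t = 0"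
    and \<rho>_rep: "\<And>l. 0 < l \<Longrightarrow> exp (- (l powr \<beta>)) * (1 + l) ^ (?d + 1) - 1 / (1 + l) = Im (LINT t|lborel. \<rho> t * exp (- (Complex 1 \<eta> * t * l)))"
    by (rule fractional_laplace_representation[OF \<beta>, of "?d + 1"]) (erule that; (assumption | simp))
  have [measurable]: "\<rho> \<in> borel_measurable borel" using borel_measurable_integrable[OF \<rho>(1)] by simp
  define R where "R l = (LINT t|lborel. \<rho> t * exp (- (Complex 1 \<eta> * t * l)))" for l :: real
  define F1 where "F1 l = R l * of_real (1 / (1 + l) ^ (?d + 1))" for l :: real
  define F2 where "F2 l = complex_of_real (1 / (1 + l) ^ (?d + 2))" for l :: real
  have symbol: "exp (- (l powr \<beta>)) = Im (F1 l) + Re (F2 l)" if l: "0 < l" for l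
  proof -
    have l1: "0 < 1 + l" using l by simp
    have "Im (F1 l) = Im (R l) / (1 + l) ^ (?d + 1)" unfolding F1_def by (simp only: times_complex.sel Im_complex_of_real Re_complex_of_real) simp
    also have "\<dots> = (exp (- (l powr \<beta>)) * (1 + l) ^ (?d + 1) - 1 / (1 + l)) / (1 + l) ^ (?d + 1)"
      unfolding R_def \<rho>_rep[OF l] ..
    also have "\<dots> = exp (- (l powr \<beta>)) - 1 / (1 + l) ^ (?d + 2)" using l1 by (simp add: diff_divide_distrib)
    finally show ?thesis by (simp add: F2_def)
  qed
  define w1 \<zeta>1 where "w1 \<omega> = \<rho> (fst \<omega>) * of_real (erlang_density ?d 1 (snd \<omega>))"
    and "\<zeta>1 \<omega> = Complex 1 \<eta> * of_real (fst \<omega>) + of_real (snd \<omega>)" for \<omega> :: "real \<times> real"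
  define w2 \<zeta>2 where "w2 x = complex_of_real (erlang_density (?d + 1) 1 x)" and "\<zeta>2 x = complex_of_real x" for x :: real
  have d0: "0 < ?d" by simp
  have epos: "0 < x" if "erlang_density m 1 x \<noteq> 0" "0 < m" for m x
    using that by (cases "x < 0"; cases "x = 0") (auto simp: erlang_density_def)
  have sec1: "0 < Re (\<zeta>1 \<omega>) \<and> \<bar>Im (\<zeta>1 \<omega>)\<bar> \<le> \<eta> * Re (\<zeta>1 \<omega>)" "0 < fst \<omega> \<and> 0 < snd \<omega>" if "w1 \<omega> \<noteq> 0" for \<omega>
  proof -
    have p: "0 < fst \<omega>" "0 < snd \<omega>"
      using that \<rho>(2)[of "fst \<omega>"] epos[of ?d "snd \<omega>"] d0 by (auto simp: w1_def not_le[symmetric])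
    then show "0 < fst \<omega> \<and> 0 < snd \<omega>" ..
    show "0 < Re (\<zeta>1 \<omega>) \<and> \<bar>Im (\<zeta>1 \<omega>)\<bar> \<le> \<eta> * Re (\<zeta>1 \<omega>)"
      using p \<eta> by (simp add: \<zeta>1_def abs_mult)
  qed
  have sec2: "0 < Re (\<zeta>2 x) \<and> \<bar>Im (\<zeta>2 x)\<bar> \<le> 0 * Re (\<zeta>2 x)" if "w2 x \<noteq> 0" for x
    using epos[of "?d + 1" x] that by (simp add: w2_def \<zeta>2_def)
  obtain V1 where V1: "0 \<le> V1" "(\<integral>\<^sup>+x. ennreal (erlang_density ?d 1 x * (1 + 1 / x) ^ ?d) \<partial>lborel) \<le> ennreal V1"
    using erlang_weight_finite[of ?d ?d] d0 by blast
  obtain V2 where V2: "0 \<le> V2" "(\<integral>\<^sup>+x. ennreal (erlang_density (?d + 1) 1 x * (1 + 1 / x) ^ ?d) \<partial>lborel) \<le> ennreal V2"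
    using erlang_weight_finite[of ?d "?d + 1"] by force
  define N where "N = (LINT t|lborel. norm (\<rho> t))"
  have N: "0 \<le> N" "(\<integral>\<^sup>+t. ennreal (norm (\<rho> t)) \<partial>lborel) = ennreal N"
    unfolding N_def using \<rho>(1) by (auto intro!: nn_integral_eq_integral integral_nonneg_AE)
  have W1: "(\<integral>\<^sup>+\<omega>. ennreal (norm (w1 \<omega>) * (1 + 1 / Re (\<zeta>1 \<omega>)) ^ ?d) \<partial>(lborel \<Otimes>\<^sub>M lborel)) \<le> ennreal (N * V1)"
  proof -
    have "(\<integral>\<^sup>+\<omega>. ennreal (norm (w1 \<omega>) * (1 + 1 / Re (\<zeta>1 \<omega>)) ^ ?d) \<partial>(lborel \<Otimes>\<^sub>M lborel))
       \<le> (\<integral>\<^sup>+\<omega>. ennreal (norm (\<rho> (fst \<omega>))) * ennreal (erlang_density ?d 1 (snd \<omega>) * (1 + 1 / snd \<omega>) ^ ?d) \<partial>(lborel \<Otimes>\<^sub>M lborel))"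
    proof (rule nn_integral_mono)
      fix \<omega> :: "real \<times> real"
      show "ennreal (norm (w1 \<omega>) * (1 + 1 / Re (\<zeta>1 \<omega>)) ^ ?d) \<le> ennreal (norm (\<rho> (fst \<omega>))) * ennreal (erlang_density ?d 1 (snd \<omega>) * (1 + 1 / snd \<omega>) ^ ?d)"
      proof (cases "w1 \<omega> = 0")
        case False
        have p: "0 < fst \<omega>" "0 < snd \<omega>" using sec1(2)[OF False] by auto
        have "(1 + 1 / Re (\<zeta>1 \<omega>)) ^ ?d \<le> (1 + 1 / snd \<omega>) ^ ?d"
          using p by (intro power_mono add_mono divide_left_mono) (auto simp: \<zeta>1_def)
        then have "norm (w1 \<omega>) * (1 + 1 / Re (\<zeta>1 \<omega>)) ^ ?d \<le> norm (w1 \<omega>) * (1 + 1 / snd \<omega>) ^ ?d"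
          by (intro mult_left_mono) auto
        also have "\<dots> = norm (\<rho> (fst \<omega>)) * (erlang_density ?d 1 (snd \<omega>) * (1 + 1 / snd \<omega>) ^ ?d)"
          by (simp add: w1_def norm_mult)
        finally show ?thesis using p by (simp add: ennreal_mult[symmetric] ennreal_leI)
      qed simp
    qed
    also have "\<dots> = (\<integral>\<^sup>+t. \<integral>\<^sup>+x. ennreal (norm (\<rho> t)) * ennreal (erlang_density ?d 1 x * (1 + 1 / x) ^ ?d) \<partial>lborel \<partial>lborel)"
      by (subst lborel.nn_integral_fst[symmetric]) (auto simp: case_prod_unfold)
    also have "\<dots> = (\<integral>\<^sup>+t. ennreal (norm (\<rho> t)) \<partial>lborel) * (\<integral>\<^sup>+x. ennreal (erlang_density ?d 1 x * (1 + 1 / x) ^ ?d) \<partial>lborel)"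
      by (simp add: nn_integral_cmult nn_integral_multc)
    also have "\<dots> \<le> ennreal N * ennreal V1" unfolding N(2) by (intro mult_left_mono V1) auto
    finally show ?thesis using N V1 by (simp add: ennreal_mult)
  qed
  have W2: "(\<integral>\<^sup>+x. ennreal (norm (w2 x) * (1 + 1 / Re (\<zeta>2 x)) ^ ?d) \<partial>lborel) \<le> ennreal V2"
    using V2 by (simp add: w2_def \<zeta>2_def)
  have rep1: "F1 l = (LINT \<omega>|(lborel \<Otimes>\<^sub>M lborel). w1 \<omega> * exp (- (\<zeta>1 \<omega> * of_real l)))" if l: "0 < l" for l
  proof -
    define f where "f t = \<rho> t * exp (- (Complex 1 \<eta> * t * l))" for t :: real
    define g where "g x = complex_of_real (erlang_density ?d 1 x * exp (- (x * l)))" for x :: real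
    have [measurable]: "f \<in> borel_measurable borel" "g \<in> borel_measurable borel" unfolding f_def g_def by measurable
    have f: "integrable lborel f"
    proof (rule Bochner_Integration.integrable_bound[OF \<rho>(1)])
      show "AE t in lborel. norm (f t) \<le> norm (\<rho> t)"
      proof (rule AE_I2)
        fix t :: real
        show "norm (f t) \<le> norm (\<rho> t)"
        proof (cases "0 < t")
          case True
          then have "norm (exp (- (Complex 1 \<eta> * t * l))) \<le> 1" using l by (simp add: norm_exp_eq_Re)
          then have "norm (\<rho> t) * norm (exp (- (Complex 1 \<eta> * t * l))) \<le> norm (\<rho> t) * 1" by (intro mult_left_mono) auto
          then show ?thesis by (simp add: f_def norm_mult)
        qed (simp add: f_def \<rho>(2))
      qed
    qed simp
    have gi: "integrable lborel g" "(LINT x|lborel. g x) = of_real (1 / (1 + l) ^ (?d + 1))"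
      unfolding g_def using erlang_laplace[of l ?d] l by (simp_all only: integrable_of_real integral_complex_of_real less_imp_le)
    have prod: "integrable (lborel \<Otimes>\<^sub>M lborel) (\<lambda>(t, x). f t * g x)"
    proof (rule lborel_pair.Fubini_integrable)
      show "integrable lborel (\<lambda>t. LINT x|lborel. norm (case (t, x) of (t, x) \<Rightarrow> f t * g x))"
        using f gi(1) by (simp add: norm_mult)
      show "AE t in lborel. integrable lborel (\<lambda>x. case (t, x) of (t, x) \<Rightarrow> f t * g x)"
        using gi(1) by simp
    qed measurable
    have "(LINT \<omega>|(lborel \<Otimes>\<^sub>M lborel). (case \<omega> of (t, x) \<Rightarrow> f t * g x)) = (LINT t|lborel. (LINT x|lborel. f t * g x))"
      using lborel_pair.integral_fst'[OF prod] by simp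
    also have "\<dots> = (LINT t|lborel. f t) * (LINT x|lborel. g x)" by simp
    also have "\<dots> = F1 l" unfolding F1_def R_def f_def gi(2) ..
    finally have "F1 l = (LINT \<omega>|(lborel \<Otimes>\<^sub>M lborel). (case \<omega> of (t, x) \<Rightarrow> f t * g x))" ..
    also have "(\<lambda>\<omega>. case \<omega> of (t, x) \<Rightarrow> f t * g x) = (\<lambda>\<omega>. w1 \<omega> * exp (- (\<zeta>1 \<omega> * of_real l)))"
    proof (rule ext, clarify)
      fix t x :: real
      have "exp (- (\<zeta>1 (t, x) * of_real l)) = exp (- (Complex 1 \<eta> * t * l)) * exp (- (of_real x * of_real l))"
        unfolding exp_add[symmetric] by (simp add: \<zeta>1_def algebra_simps)
      then show "f t * g x = w1 (t, x) * exp (- (\<zeta>1 (t, x) * of_real l))"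
        by (simp add: f_def g_def w1_def exp_of_real[symmetric])
    qed
    finally show ?thesis .
  qed
  have rep2: "F2 l = (LINT x|lborel. w2 x * exp (- (\<zeta>2 x * of_real l)))" if l: "0 < l" for l
  proof -
    have "w2 x * exp (- (\<zeta>2 x * of_real l)) = complex_of_real (erlang_density (?d + 1) 1 x * exp (- (x * l)))" for x
      by (simp add: w2_def \<zeta>2_def exp_of_real[symmetric])
    then show ?thesis
      by (simp only: F2_def integral_complex_of_real erlang_laplace(2)[OF less_imp_le[OF l]]) simp
  qed
  define C1 C2 where "C1 = (8 * (2 + \<eta>)) ^ ?d * (N * V1)" and "C2 = (8 * (2 + 0)) ^ ?d * V2"
  have C: "0 \<le> C1" "0 \<le> C2" using \<eta> N V1 V2 by (auto simp: C1_def C2_def)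
  show ?thesis
  proof (rule that[of "C1 + C2 + 1"])
    show "0 < C1 + C2 + 1" using C by simp
    fix t :: real assume t: "0 < t" "t \<le> 1"
    define s where "s = t powr (1 / \<beta>)"
    have s: "0 < s" "s \<le> 1" using t \<beta> by (auto simp: s_def powr_le1)
    have st: "s powr \<beta> = t" using t \<beta> by (simp add: s_def powr_powr)
    define S where "S = (1 / sqrt s) ^ ?d"
    have S: "0 \<le> S" using s by (simp add: S_def)
    have sf: "sigma_finite_measure (lborel \<Otimes>\<^sub>M (lborel :: real measure) :: (real \<times> real) measure)"
      by (simp add: lborel_prod lborel.sigma_finite_measure_axioms)
    have meas: "w1 \<in> borel_measurable (lborel \<Otimes>\<^sub>M lborel)" "\<zeta>1 \<in> borel_measurable (lborel \<Otimes>\<^sub>M lborel)"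
      "w2 \<in> borel_measurable lborel" "\<zeta>2 \<in> borel_measurable lborel"
      unfolding w1_def \<zeta>1_def w2_def \<zeta>2_def by measurable
    have NV: "0 \<le> N * V1" using N V1 by simp
    obtain J1 :: "real ^ 'n \<Rightarrow> real ^ 'n \<Rightarrow> ennreal" where J1: "kernel_bounds J1 (ennreal C1) (ennreal (C1 * S))"
      "\<And>(x :: real ^ 'n) y. summable (\<lambda>k. F1 (s * (2 * real k + real ?d)) * of_real (hermite_kernel k x y))"
      "\<And>x y. ennreal (norm (\<Sum>k. F1 (s * (2 * real k + real ?d)) * of_real (hermite_kernel k x y))) \<le> J1 x y"
      by (rule laplace_multiplier_kernel[where 'n = 'n, OF sf meas(1,2) less_imp_le[OF \<eta>] sec1(1) W1 NV rep1 s, folded S_def C1_def]) (assumption, assumption, (erule that; (assumption | simp)))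
    obtain J2 :: "real ^ 'n \<Rightarrow> real ^ 'n \<Rightarrow> ennreal" where J2: "kernel_bounds J2 (ennreal C2) (ennreal (C2 * S))"
      "\<And>(x :: real ^ 'n) y. summable (\<lambda>k. F2 (s * (2 * real k + real ?d)) * of_real (hermite_kernel k x y))"
      "\<And>x y. ennreal (norm (\<Sum>k. F2 (s * (2 * real k + real ?d)) * of_real (hermite_kernel k x y))) \<le> J2 x y"
      by (rule laplace_multiplier_kernel[where 'n = 'n, OF lborel.sigma_finite_measure_axioms meas(3,4) order_refl sec2 W2 V2(1) rep2 s, folded S_def C2_def]) (assumption, assumption, (erule that; (assumption | simp)))
    \<comment> \<open>the Hermite kernels are real, so \<open>Im\<close> and \<open>Re\<close> may be taken term by term\<close>
    have le: "ennreal \<bar>heat_kernel \<beta> t x y\<bar> \<le> J1 x y + J2 x y" for x y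
    proof -
      define A where "A = (\<Sum>k. F1 (s * (2 * real k + real ?d)) * of_real (hermite_kernel k x y))"
      define B where "B = (\<Sum>k. F2 (s * (2 * real k + real ?d)) * of_real (hermite_kernel k x y))"
      have eq: "exp (- t * (2 * real k + real ?d) powr \<beta>) * hermite_kernel k x y
          = Im (F1 (s * (2 * real k + real ?d)) * of_real (hermite_kernel k x y)) + Re (F2 (s * (2 * real k + real ?d)) * of_real (hermite_kernel k x y))" for k
      proof -
        have "0 < s * (2 * real k + real ?d)" using s by (intro mult_pos_pos add_nonneg_pos) auto
        from symbol[OF this] have "exp (- t * (2 * real k + real ?d) powr \<beta>) = Im (F1 (s * (2 * real k + real ?d))) + Re (F2 (s * (2 * real k + real ?d)))"
          using s by (simp add: powr_mult st)
        then show ?thesis by (simp add: distrib_right)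
      qed
      have "(\<lambda>k. exp (- t * (2 * real k + real ?d) powr \<beta>) * hermite_kernel k x y) sums (Im A + Re B)"
        unfolding eq A_def B_def by (intro sums_add sums_Im sums_Re summable_sums J1 J2)
      then have "heat_kernel \<beta> t x y = Im A + Re B" unfolding heat_kernel_def by (simp add: sums_iff)
      then have "\<bar>heat_kernel \<beta> t x y\<bar> \<le> norm A + norm B" using abs_Im_le_cmod[of A] abs_Re_le_cmod[of B] by linarith
      then have "ennreal \<bar>heat_kernel \<beta> t x y\<bar> \<le> ennreal (norm A) + ennreal (norm B)"
        by (simp add: ennreal_leI flip: ennreal_plus)
      also have "\<dots> \<le> J1 x y + J2 x y" unfolding A_def B_def by (intro add_mono J1 J2)
      finally show ?thesis .
    qed
    have "kernel_bounds (\<lambda>x y. J1 x y + J2 x y) (ennreal (C1 + C2 + 1)) (ennreal ((C1 + C2 + 1) * S))"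
    proof (rule kernel_bounds_mono[OF kernel_bounds_add[OF J1(1) J2(1)]])
      show "ennreal C1 + ennreal C2 \<le> ennreal (C1 + C2 + 1)" using C by (simp add: ennreal_leI flip: ennreal_plus)
      show "ennreal (C1 * S) + ennreal (C2 * S) \<le> ennreal ((C1 + C2 + 1) * S)"
        using C S by (simp add: ennreal_leI distrib_right flip: ennreal_plus)
    qed
    with le show "\<exists>J :: real ^ 'n \<Rightarrow> real ^ 'n \<Rightarrow> ennreal.
      kernel_bounds J (ennreal (C1 + C2 + 1)) (ennreal ((C1 + C2 + 1) * (1 / sqrt (t powr (1 / \<beta>))) ^ ?d)) \<and>
      (\<forall>x y. ennreal \<bar>heat_kernel \<beta> t x y\<bar> \<le> J x y)"
      unfolding s_def[symmetric] S_def[symmetric] by (intro exI[of _ "\<lambda>x y. J1 x y + J2 x y"]) simp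
  qed
qed

section \<open>Smoothing estimates\<close>

text \<open>
  Both regimes are instances of \<open>Lp_kernel_bound\<close>. For $t \ge 1$ the dominating kernel
  $E\, W(x) W(y)$ satisfies all four bounds with one constant, so that $\delta$ drops out. For $t
  \le 1$ the ratio of the two constants is $t^{-d/(2\beta)}$, and $\delta$ times that exponent is
  $\sigma_\beta$.
\<close>

lemma frac_heat_Lp_bounds:
  fixes \<beta> :: real and p q :: ennreal
  assumes \<beta>: "0 < \<beta>" and p: "1 \<le> p" and q: "1 \<le> q"
  shows "\<exists>C>0. \<forall>f \<in> (Lp_space p :: (real ^ 'n::finite \<Rightarrow> complex) set).
             (\<forall>t\<ge>1. frac_heat \<beta> t f \<in> Lp_space q \<and>
                Lp_norm q (frac_heat \<beta> t f) \<le> C * exp (- t * real CARD('n) powr \<beta>) * Lp_norm p f) \<and>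
             (\<forall>t. 0 < t \<and> t \<le> 1 \<longrightarrow> frac_heat \<beta> t f \<in> Lp_space q \<and>
                Lp_norm q (frac_heat \<beta> t f) \<le> C * t powr (- heat_exponent CARD('n) \<beta> p q) * Lp_norm p f)"
proof -
  let ?d = "CARD('n)"
  define \<delta> where "\<delta> = \<bar>enn2real (1 / p) - enn2real (1 / q)\<bar>"
  obtain CL where CL: "0 < CL" "\<And>t (x :: real ^ 'n) y. 1 \<le> t \<Longrightarrow>
    \<bar>heat_kernel \<beta> t x y\<bar> \<le> CL * exp (- t * real ?d powr \<beta>) * (decay_weight x * decay_weight y)"
    by (rule heat_kernel_large_time[OF \<beta>, where 'n = 'n]) (rule that; blast)
  obtain CS where CS: "0 < CS" "\<And>t. 0 < t \<Longrightarrow> t \<le> 1 \<Longrightarrow> \<exists>J :: real ^ 'n::finite \<Rightarrow> real ^ 'n \<Rightarrow> ennreal.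
    kernel_bounds J (ennreal CS) (ennreal (CS * (1 / sqrt (t powr (1 / \<beta>))) ^ ?d)) \<and>
    (\<forall>x y. ennreal \<bar>heat_kernel \<beta> t x y\<bar> \<le> J x y)"
    by (rule heat_kernel_small_time[OF \<beta>, where 'n = 'n]) (rule that; blast)
  have kernel: "frac_heat \<beta> t f \<in> Lp_space q \<and> Lp_norm q (frac_heat \<beta> t f) \<le> A powr (1 - \<delta>) * B powr \<delta> * Lp_norm p f"
    if t: "0 < t" and f: "f \<in> Lp_space p" and A: "0 < A" and B: "0 < B"
      and J: "kernel_bounds J (ennreal A) (ennreal B)"
      and le: "\<And>x y. ennreal \<bar>heat_kernel \<beta> t x y\<bar> \<le> J x y"
    for t A B and f :: "real ^ 'n \<Rightarrow> complex" and J :: "real ^ 'n \<Rightarrow> real ^ 'n \<Rightarrow> ennreal"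
  proof (rule Lp_kernel_bound[OF J A B p q f frac_heat_measurable _ \<delta>_def])
    fix x
    have "(\<integral>\<^sup>+y. ennreal \<bar>heat_kernel \<beta> t x y\<bar> * ennreal (cmod (f y)) \<partial>lebesgue) \<le> (\<integral>\<^sup>+y. J x y * ennreal (cmod (f y)) \<partial>lebesgue)"
      by (intro nn_integral_mono mult_right_mono le) auto
    with frac_heat_kernel_bound[OF \<beta> t f p]
    show "ennreal (cmod (frac_heat \<beta> t f x)) \<le> (\<integral>\<^sup>+y. J x y * ennreal (cmod (f y)) \<partial>lebesgue)"
      by (rule order_trans)
  qed
  define C0 where "C0 = CL * (pi ^ ?d * pi ^ ?d)"
  have pid: "1 \<le> pi ^ ?d" using pi_ge_two by (intro one_le_power) simp
  have C0: "0 < C0" using CL by (simp add: C0_def)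
  have large: "frac_heat \<beta> t f \<in> Lp_space q \<and> Lp_norm q (frac_heat \<beta> t f) \<le> C0 * exp (- t * real ?d powr \<beta>) * Lp_norm p f"
    if t: "1 \<le> t" and f: "f \<in> Lp_space p" for t and f :: "real ^ 'n \<Rightarrow> complex"
  proof -
    define E where "E = CL * exp (- t * real ?d powr \<beta>)"
    have E: "0 < E" using CL by (simp add: E_def)
    define A where "A = E * (pi ^ ?d * pi ^ ?d)"
    have A: "0 < A" using E by (simp add: A_def)
    define J where "J x y = ennreal (E * (decay_weight x * decay_weight y))" for x y :: "real ^ 'n"
    have J: "J x y = ennreal E * (ennreal (decay_weight x) * ennreal (decay_weight y))" for x y
      unfolding J_def using E by (simp add: ennreal_mult decay_weight_nonneg)
    have w1: "ennreal (decay_weight x) \<le> 1" for x :: "real ^ 'n" using ennreal_leI[OF decay_weight_le_1[of x]] by simp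
    have pp: "1 \<le> ennreal (pi ^ ?d)" using ennreal_leI[OF pid] by simp
    have Aeq: "ennreal A = ennreal E * (ennreal (pi ^ ?d) * ennreal (pi ^ ?d))"
      unfolding A_def using E by (simp add: ennreal_mult)
    have row: "(\<integral>\<^sup>+y. J x y \<partial>lborel) = ennreal E * (ennreal (decay_weight x) * ennreal (pi ^ ?d))" for x
      unfolding J by (simp add: nn_integral_cmult nn_integral_decay_weight)
    have "frac_heat \<beta> t f \<in> Lp_space q \<and> Lp_norm q (frac_heat \<beta> t f) \<le> A powr (1 - \<delta>) * A powr \<delta> * Lp_norm p f"
    proof (rule kernel[of t f A A J])
      show "kernel_bounds J (ennreal A) (ennreal A)"
      proof (rule kernel_boundsI)
        show "case_prod J \<in> borel_measurable (borel \<Otimes>\<^sub>M borel)" unfolding J_def by measurable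
        show "J x y = J y x" for x y by (simp add: J_def mult.commute)
        show "(\<integral>\<^sup>+y. J x y \<partial>lborel) \<le> ennreal A" for x
          unfolding row Aeq by (intro mult_left_mono mult_right_mono order_trans[OF w1 pp]) auto
        show "J x y \<le> ennreal A" for x y
          unfolding J Aeq by (intro mult_left_mono mult_mono order_trans[OF w1 pp]) auto
        have "(\<integral>\<^sup>+x. \<integral>\<^sup>+y. J x y \<partial>lborel \<partial>lborel) = ennreal A"
          unfolding row Aeq by (simp add: nn_integral_cmult nn_integral_multc nn_integral_decay_weight)
        then show "(\<integral>\<^sup>+x. \<integral>\<^sup>+y. J x y \<partial>lborel \<partial>lborel) \<le> ennreal A" by simp
      qed
      show "ennreal \<bar>heat_kernel \<beta> t x y\<bar> \<le> J x y" for x y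
        unfolding J_def E_def by (intro ennreal_leI CL t)
    qed (use t f A in auto)
    moreover have "A powr (1 - \<delta>) * A powr \<delta> = A" using A by (simp add: powr_add[symmetric])
    moreover have "A = C0 * exp (- t * real ?d powr \<beta>)" by (simp add: A_def E_def C0_def)
    ultimately show ?thesis by simp
  qed
  have small: "frac_heat \<beta> t f \<in> Lp_space q \<and> Lp_norm q (frac_heat \<beta> t f) \<le> CS * t powr (- heat_exponent ?d \<beta> p q) * Lp_norm p f"
    if t: "0 < t" "t \<le> 1" and f: "f \<in> Lp_space p" for t and f :: "real ^ 'n \<Rightarrow> complex"
  proof -
    define B where "B = CS * (1 / sqrt (t powr (1 / \<beta>))) ^ ?d"
    have B: "0 < B" using CS t by (simp add: B_def)
    obtain J :: "real ^ 'n \<Rightarrow> real ^ 'n \<Rightarrow> ennreal" where J: "kernel_bounds J (ennreal CS) (ennreal B) \<and>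
      (\<forall>x y. ennreal \<bar>heat_kernel \<beta> t x y\<bar> \<le> J x y)"
      using CS(2)[OF t] unfolding B_def by (rule exE)
    have "frac_heat \<beta> t f \<in> Lp_space q \<and> Lp_norm q (frac_heat \<beta> t f) \<le> CS powr (1 - \<delta>) * B powr \<delta> * Lp_norm p f"
      using J by (intro kernel[OF t(1) f CS(1) B, of J]) auto
    moreover have "CS powr (1 - \<delta>) * B powr \<delta> = CS * t powr (- heat_exponent ?d \<beta> p q)"
    proof -
      have "1 / sqrt (t powr (1 / \<beta>)) = t powr (- (1 / (2 * \<beta>)))"
        using t by (simp add: powr_half_sqrt[symmetric] powr_powr powr_minus_divide mult.commute)
      then have "(1 / sqrt (t powr (1 / \<beta>))) ^ ?d = t powr (- (1 / (2 * \<beta>)) * real ?d)"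
        using t by (simp add: powr_powr powr_realpow[symmetric])
      then have "B powr \<delta> = CS powr \<delta> * t powr (- (1 / (2 * \<beta>)) * real ?d * \<delta>)"
        unfolding B_def using CS t by (simp add: powr_mult powr_powr)
      moreover have "CS powr (1 - \<delta>) * CS powr \<delta> = CS" using CS by (simp add: powr_add[symmetric])
      moreover have "- (1 / (2 * \<beta>)) * real ?d * \<delta> = - heat_exponent ?d \<beta> p q"
        by (simp add: heat_exponent_def \<delta>_def)
      ultimately show ?thesis by (simp add: mult.assoc[symmetric])
    qed
    ultimately show ?thesis by simp
  qed
  define C where "C = max C0 CS"
  have C: "0 < C" "C0 \<le> C" "CS \<le> C" using C0 by (auto simp: C_def)
  have mono: "a * b * Lp_norm p f \<le> C * b * Lp_norm p f" if "a \<le> C" "0 \<le> b" for a b and f :: "real ^ 'n \<Rightarrow> complex"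
    using that by (intro mult_right_mono Lp_norm_nonneg) auto
  show ?thesis
  proof (intro exI[of _ C] conjI ballI allI impI C(1))
    fix f :: "real ^ 'n \<Rightarrow> complex" and t :: real
    assume f: "f \<in> Lp_space p"
    { assume t: "1 \<le> t"
      show "frac_heat \<beta> t f \<in> Lp_space q" using large[OF t f] by simp
      show "Lp_norm q (frac_heat \<beta> t f) \<le> C * exp (- t * real ?d powr \<beta>) * Lp_norm p f"
        by (rule order_trans[OF large[OF t f, THEN conjunct2] mono[OF C(2)]]) simp }
    { assume t: "0 < t \<and> t \<le> 1"
      show "frac_heat \<beta> t f \<in> Lp_space q" using small[of t f] t f by simp
      show "Lp_norm q (frac_heat \<beta> t f) \<le> C * t powr (- heat_exponent ?d \<beta> p q) * Lp_norm p f"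
        using t by (intro order_trans[OF small[OF _ _ f, THEN conjunct2] mono[OF C(3)]]) auto }
  qed
qed

theorem theorem1p1:
  fixes \<beta> :: real
  assumes "\<beta> > 0"
  shows "(\<forall>p q :: ennreal. 1 \<le> p \<and> 1 \<le> q \<and>
            ((1 < p \<and> p < \<infinity> \<and> 1 < q \<and> q < \<infinity>) \<or>
             (p = 1 \<and> q = \<infinity>) \<or>
             (p = 1 \<and> 2 \<le> q \<and> q < \<infinity>) \<or>
             (1 < p \<and> p < \<infinity> \<and> q = 1)) \<longrightarrow>
          (\<exists>C>0. \<forall>f \<in> (Lp_space p :: (real ^ 'n::finite \<Rightarrow> complex) set).
             (\<forall>t\<ge>1. frac_heat \<beta> t f \<in> Lp_space q \<and>
                Lp_norm q (frac_heat \<beta> t f) \<le> C * exp (- t * real CARD('n) powr \<beta>) * Lp_norm p f) \<and>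
             (\<forall>t. 0 < t \<and> t \<le> 1 \<longrightarrow> frac_heat \<beta> t f \<in> Lp_space q \<and>
                Lp_norm q (frac_heat \<beta> t f) \<le> C * t powr (- heat_exponent CARD('n) \<beta> p q) * Lp_norm p f)))
       \<and> (\<beta> \<le> 1 \<longrightarrow>
          (\<forall>p q :: ennreal. 1 \<le> p \<and> 1 \<le> q \<longrightarrow>
          (\<exists>C>0. \<forall>f \<in> (Lp_space p :: (real ^ 'n \<Rightarrow> complex) set).
             (\<forall>t\<ge>1. frac_heat \<beta> t f \<in> Lp_space q \<and>
                Lp_norm q (frac_heat \<beta> t f) \<le> C * exp (- t * real CARD('n) powr \<beta>) * Lp_norm p f) \<and>
             (\<forall>t. 0 < t \<and> t \<le> 1 \<longrightarrow> frac_heat \<beta> t f \<in> Lp_space q \<and>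
                Lp_norm q (frac_heat \<beta> t f) \<le> C * t powr (- heat_exponent CARD('n) \<beta> p q) * Lp_norm p f))))"
  using frac_heat_Lp_bounds[OF assms, where 'n = 'n] by blast

end
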